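(* There exist universal constants $c_1>0$, $\bar\gamma\in(0,1)$, and $C_0,C_1,C_2>0$ with $C_1<C_2$, and, for every failure probability $\epsilon\in(0,1)$, a constant $c_2=c_2(\epsilon)>0$ (none of them depending on $d,r,m,\rho,\kappa,\lambda,z$) such that the following holds. Let $d=2^n$ with $n\ge1$, let $1\le r\le d$, and let $\rho\in\mathbb{H}_d(\mathbb{C})$ be a density matrix (positive semidefinite, trace one) of rank $r$ with nonzero singular values $\sigma_1\ge\cdots\ge\sigma_r>0$ and condition number $\kappa:=\sigma_1/\sigma_r$. Let $\lambda\ge0$ and $m\in\mathbb{N}$ satisfy $$\lambda\le c_1\frac{\sigma_r}{\sqrt r},\qquad m\ge c_2\,\kappa^2r^2d\log^6d .$$ Let $S_1,\dots,S_m$ be drawn i.i.d. uniformly from the $d^2$ Pauli matrices on $n$ qubits, and let $\mathcal{A}$ be the associated Pauli sampling map. Then with probability at least $1-\epsilon$ over the choice of $S_1,\dots,S_m$, for every $z\in\mathbb{R}^m$ with $\|\mathcal{A}^\dagger(z)\|\le\lambda$ and $y=\mathcal{A}(\rho)+z$, the iterates $X_k$ of the RGD algorithm with input $(\mathcal{A},y,r)$ and initial point $X_0=\mathcal{H}_r(\mathcal{A}^\dagger(y))$ satisfy: (i) If $\lambda>0$, then the output $\hat\rho=X_k$ satisfies $$\frac{\|\hat\rho-\rho\|_F}{\|\rho\|_F}\le C_2\frac{\sqrt r\,\lambda}{\|\rho\|_F}$$ for every integer $k\ge0$ with $$k\ge\frac{1}{\ln(1/\bar\gamma)}\left(\ln\left(\frac{2C_0\|\rho\|_F}{r\kappa\lambda}+2\sqrt2\right)-\ln(C_2-C_1)\right).$$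 (ii) In the noiseless case $\lambda=0$, $z=0$ (so $y=\mathcal{A}(\rho)$), for every $\varepsilon>0$ the output $\hat\rho=X_k$ satisfies $\|\hat\rho-\rho\|_F/\|\rho\|_F\le\varepsilon$ for every integer $k\ge0$ with $$k\ge \ln\left(\frac{C_0}{\sqrt r\,\kappa\,\varepsilon}\right)\Big/\ln\left(\frac1{\bar\gamma}\right).$$
   Context: **Notation.** $\mathbb{H}_d(\mathbb{C})$ is the space of Hermitian $d\times d$ complex matrices. $\|\cdot\|_F$ is the Frobenius norm, $\|\cdot\|$ the spectral norm (largest singular value), and $\|\cdot\|_2$ the Euclidean norm on $\mathbb{R}^m$. **Pauli matrices.** For $d=2^n$, the Pauli matrices $W_1,\dots,W_{d^2}$ are the $4^n$ tensor products $P_1\otimes\cdots\otimes P_n$ with each $P_i\in\{\sigma_0,\sigma_1,\sigma_2,\sigma_3\}$, the $2\times2$ identity and the three standard Pauli matrices $X,Y,Z$ (unnormalized, so $\operatorname{Tr}(W_iW_j)=d\,\delta_{ij}$). In the claim itself, $\sigma_1,\dots,\sigma_r$ denote singular values of $\rho$. **Pauli sampling map.** Given $S_1,\dots,S_m\in\{W_1,\dots,W_{d^2}\}$, define the linear map $\mathcal{A}:\mathbb{H}_d(\mathbb{C})\to\mathbb{R}^m$ by $(\mathcal{A}(X))_i=\sqrt{d/m}\,\operatorname{Tr}(S_iX)$. Its adjoint is $\mathcal{A}^\dagger(y)=\sqrt{d/m}\sum_{i=1}^m y_iS_i$. **Hard thresholding.** $\mathcal{H}_r(M)$ is the truncated singular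 value decomposition of $M$, keeping the $r$ largest singular values and the corresponding singular vectors and discarding the rest. For Hermitian $M$ this means keeping the $r$ eigenvalues of largest absolute value in a spectral decomposition, ties broken arbitrarily. **RGD algorithm.** Input: $\mathcal{A}$, $y\in\mathbb{R}^m$, rank $r$, and an initial Hermitian matrix $X_0$ of rank at most $r$. For $k=0,1,2,\dots$, take the singular value decomposition $X_k=U_k\Sigma_kV_k^\dagger$ and set $P_{U_k}=U_kU_k^\dagger$, $P_{V_k}=V_kV_k^\dagger$ (projections onto the column and row spaces of $X_k$). Define the tangent-space projection $\mathcal{P}_{T_k}(X)=P_{U_k}X+XP_{V_k}-P_{U_k}XP_{V_k}$. Then: 1. $G_k=\mathcal{A}^\dagger(y-\mathcal{A}(X_k))$; 2. $\alpha_k=\|\mathcal{P}_{T_k}(G_k)\|_F^2/\|\mathcal{A}\mathcal{P}_{T_k}(G_k)\|_2^2$ (with $\alpha_k:=0$ if the denominator vanishes); 3. $W_k=X_k+\alpha_k\mathcal{P}_{T_k}(G_k)$; 4. $X_{k+1}=\mathcal{H}_r(W_k)$. The output after $k$ steps is $\hat\rho=X_k$. *)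

theory Defs
  imports
    "HOL-Probability.Product_PMF"
    "Jordan_Normal_Form.Schur_Decomposition"
    "Jordan_Normal_Form.DL_Rank"
begin

unbundle no vec_syntax and no inner_syntax

section \<open>Hermitian matrices, norms and singular values\<close>

definition hermitian_mat :: "nat \<Rightarrow> complex mat \<Rightarrow> bool" where
  "hermitian_mat d A \<longleftrightarrow> A \<in> carrier_mat d d \<and> mat_adjoint A = A"

definition mat_trace :: "'a::comm_monoid_add mat \<Rightarrow> 'a" where
  "mat_trace A = (\<Sum>i<dim_row A. A $$ (i, i))"

definition density_mat :: "nat \<Rightarrow> complex mat \<Rightarrow> bool" where
  "density_mat d A \<longleftrightarrow> hermitian_mat d A
     \<and> (\<forall>v\<in>carrier_vec d. 0 \<le> Re ((A *\<^sub>v v) \<bullet>c v))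
     \<and> mat_trace A = 1"

definition frob_norm :: "complex mat \<Rightarrow> real" where
  "frob_norm A = L2_set (\<lambda>ij. cmod (A $$ ij)) ({..<dim_row A} \<times> {..<dim_col A})"

definition euclid_norm :: "real vec \<Rightarrow> real" where
  "euclid_norm v = L2_set (\<lambda>i. v $ i) {..<dim_vec v}"

text \<open>All singular values of \<open>A\<close> (square roots of the eigenvalues of \<open>A\<^sup>\<dagger>A\<close>), zeros included, with
  multiplicity and in nonincreasing order; for \<open>A\<close> of rank \<open>r\<close> the nonzero ones are the first
  \<open>r\<close> entries. The list is indexed from 0.\<close>

definition singular_values :: "complex mat \<Rightarrow> real list" where
  "singular_values A = rev (sorted_list_of_multiset
     (image_mset (\<lambda>z. sqrt (Re z)) (proots (char_poly (mat_adjoint A * A)))))"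

definition spectral_norm :: "complex mat \<Rightarrow> real" where
  "spectral_norm A = Max (set (singular_values A))"

text \<open>Compact singular value decomposition \<open>A = U diag(s) V\<^sup>\<dagger>\<close>: only the nonzero singular values
  are kept, so \<open>U U\<^sup>\<dagger>\<close> and \<open>V V\<^sup>\<dagger>\<close> are the projections onto the column and row spaces of \<open>A\<close>.
  For \<open>A = 0\<close> the list \<open>s\<close> is empty and both projections are zero.\<close>

definition compact_svd :: "complex mat \<Rightarrow> complex mat \<Rightarrow> real list \<Rightarrow> complex mat \<Rightarrow> bool" where
  "compact_svd A U s V \<longleftrightarrow>
     U \<in> carrier_mat (dim_row A) (length s) \<and> mat_adjoint U * U = 1\<^sub>m (length s) \<and>
     V \<in> carrier_mat (dim_col A) (length s) \<and> mat_adjoint V * V = 1\<^sub>m (length s) \<and>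
     sorted_wrt (\<ge>) s \<and> (\<forall>x\<in>set s. 0 < x) \<and>
     A = U * mat_diag (length s) (\<lambda>i. complex_of_real (s ! i)) * mat_adjoint V"

text \<open>\<open>N\<close> is a possible value of \<open>H\<^sub>r(M)\<close> for Hermitian \<open>M\<close>. If \<open>u\<^sub>i\<close> is a unit eigenvector for
  \<open>l\<^sub>i\<close>, then \<open>|l\<^sub>i|\<close> is a singular value with left and right singular vectors \<open>u\<^sub>i\<close> and
  \<open>sgn(l\<^sub>i) u\<^sub>i\<close>. A relation rather than a function, since ties \<open>|l\<^sub>i| = |l\<^sub>j|\<close> (and bases of
  eigenspaces) may be resolved in any way.\<close>

definition hard_threshold :: "nat \<Rightarrow> complex mat \<Rightarrow> complex mat \<Rightarrow> bool" where
  "hard_threshold r M N \<longleftrightarrow> (\<exists>U l. let d = dim_row M in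
     U \<in> carrier_mat d d \<and> mat_adjoint U * U = 1\<^sub>m d \<and>
     (\<forall>i j. i \<le> j \<longrightarrow> j < d \<longrightarrow> \<bar>l j\<bar> \<le> \<bar>l i :: real\<bar>) \<and>
     M = U * mat_diag d (\<lambda>i. complex_of_real (l i)) * mat_adjoint U \<and>
     N = U * mat_diag d (\<lambda>i. if i < r then complex_of_real (l i) else 0) * mat_adjoint U)"

section \<open>Pauli matrices and the Pauli sampling map\<close>

definition kronecker :: "'a::times mat \<Rightarrow> 'a mat \<Rightarrow> 'a mat" where
  "kronecker A B = mat (dim_row A * dim_row B) (dim_col A * dim_col B)
     (\<lambda>(i, j). A $$ (i div dim_row B, j div dim_col B) * B $$ (i mod dim_row B, j mod dim_col B))"

definition single_qubit_paulis :: "complex mat set" where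
  "single_qubit_paulis =
     {mat_of_rows_list 2 [[1, 0], [0, 1]],
      mat_of_rows_list 2 [[0, 1], [1, 0]],
      mat_of_rows_list 2 [[0, - \<i>], [\<i>, 0]],
      mat_of_rows_list 2 [[1, 0], [0, - 1]]}"

primrec paulis :: "nat \<Rightarrow> complex mat set" where
  "paulis 0 = {1\<^sub>m 1}"
| "paulis (Suc n) = {kronecker P W | P W. P \<in> single_qubit_paulis \<and> W \<in> paulis n}"

lemma finite_paulis: "finite (paulis n)"
proof (induction n)
  case (Suc n)
  have "paulis (Suc n) = (\<lambda>(P, W). kronecker P W) ` (single_qubit_paulis \<times> paulis n)"
    by auto
  then show ?case
    using Suc by (simp add: single_qubit_paulis_def)
qed simp

lemma paulis_nonempty: "paulis n \<noteq> {}"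
  by (induction n) (auto simp: single_qubit_paulis_def)

text \<open>The joint law of \<open>S\<^sub>0, \<dots>, S\<^sub>m\<^sub>-\<^sub>1\<close>; values at indices \<open>\<ge> m\<close> are irrelevant.\<close>

definition pauli_sample :: "nat \<Rightarrow> nat \<Rightarrow> (nat \<Rightarrow> complex mat) pmf" where
  "pauli_sample n m = Pi_pmf {..<m} undefined (\<lambda>_. pmf_of_set (paulis n))"

text \<open>On Hermitian matrices \<open>Tr(S\<^sub>i X)\<close> is real, so \<open>Re\<close> is only a type conversion there.\<close>

definition sampling_map ::
    "nat \<Rightarrow> nat \<Rightarrow> (nat \<Rightarrow> complex mat) \<Rightarrow> complex mat \<Rightarrow> real vec" where
  "sampling_map d m S X = vec m (\<lambda>i. sqrt (real d / real m) * Re (mat_trace (S i * X)))"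

definition sampling_adj ::
    "nat \<Rightarrow> nat \<Rightarrow> (nat \<Rightarrow> complex mat) \<Rightarrow> real vec \<Rightarrow> complex mat" where
  "sampling_adj d m S y = mat d d (\<lambda>ab.
     complex_of_real (sqrt (real d / real m)) * (\<Sum>i<m. complex_of_real (y $ i) * S i $$ ab))"

section \<open>Riemannian gradient descent\<close>

definition tangent_proj :: "complex mat \<Rightarrow> complex mat \<Rightarrow> complex mat \<Rightarrow> complex mat" where
  "tangent_proj PU PV X = PU * X + X * PV - PU * X * PV"

text \<open>The convention \<open>x / 0 = 0\<close> gives step size \<open>0\<close> when the denominator vanishes.\<close>

definition rgd_step :: "nat \<Rightarrow> nat \<Rightarrow> (nat \<Rightarrow> complex mat) \<Rightarrow> real vec \<Rightarrow> nat \<Rightarrow>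
    complex mat \<Rightarrow> complex mat \<Rightarrow> bool" where
  "rgd_step d m S y r X X' \<longleftrightarrow> (\<exists>U s V. compact_svd X U s V \<and>
     (let PT = tangent_proj (U * mat_adjoint U) (V * mat_adjoint V);
          G = sampling_adj d m S (y - sampling_map d m S X);
          \<alpha> = (frob_norm (PT G))\<^sup>2 / (euclid_norm (sampling_map d m S (PT G)))\<^sup>2;
          W = X + complex_of_real \<alpha> \<cdot>\<^sub>m PT G
      in hard_threshold r W X'))"

definition rgd_iterates :: "nat \<Rightarrow> nat \<Rightarrow> (nat \<Rightarrow> complex mat) \<Rightarrow> real vec \<Rightarrow> nat \<Rightarrow>
    complex mat \<Rightarrow> (nat \<Rightarrow> complex mat) \<Rightarrow> bool" where
  "rgd_iterates d m S y r X\<^sub>0 X \<longleftrightarrow>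
     X 0 = X\<^sub>0 \<and> (\<forall>k. rgd_step d m S y r (X k) (X (Suc k)))"

end

theory Submission
  imports Defs "HOL-Analysis.Analysis"
begin

text \<open>With high probability the sampling operator is a near isometry on all Hermitian matrices whose
  nuclear norm is at most \<open>2 \<surd>r\<close> times their Frobenius norm, a cone containing the tangent vectors
  of the rank \<open>r\<close> matrices. The coefficient functions \<open>W \<mapsto> Tr (W X)\<close> of such matrices have small
  fat-shattering dimension, because Rademacher sums of Pauli matrices have small spectral norm (moment
  method: only words with even multiplicities survive). So they have small uniform covers at every
  scale, and a Chernoff bound for each dyadic level set of the squared coefficients, with a union bound
  over the covers, gives the isometry. Symmetrization and the same Rademacher bound show that
  \<open>X\<^sub>0\<close> is close to \<open>\<rho>\<close>. From there on one step of the algorithm contracts the error up to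
  \<open>\<surd>r \<lambda>\<close>: the isometry controls the component of \<open>\<rho> - X\<^sub>k\<close> in the tangent space, and the normal
  component is quadratic in \<open>\<rho> - X\<^sub>k\<close>.\<close>

unbundle no vec_syntax and no inner_syntax

section \<open>Finitely supported matrices\<close>

text \<open>The obstacle is uniformity: the isometry must hold for all iterates at once, and these
  depend on the sample. Proving it on a nuclear norm cone serves two ends. Duality with the operator
  norm turns estimates over the cone into spectral bounds for signed sums of Pauli matrices. The
  cone also contains the normal part of the error, which is not tangent but is a Gram matrix of rank
  at most \<open>r\<close>. Scales are tied to the largest possible coefficient 2 sqrt r, so
  \<open>r\<close> cancels from the entropy: log cover size and Chernoff exponent both grow like 4^j
  at level \<open>j\<close>, and all levels cost equally many samples. The entropy contributes n^3
  and the number of levels one more factor n. The factor \<kappa>^2 r^2 comes from the start: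
  contraction needs an initial Frobenius error of order \<sigma>_r, while the mean spectral error of
  the initialization is of order sqrt (n d / m) times the norm of \<rho>. That event is bounded by
  Markov, hence the 1/\<epsilon>^2 in \<open>c2\<close>. The rate 1/2 reflects that hard
  thresholding may double the error: the gradient step itself must contract by 1/4, which isometry
  constant 1/20 allows.\<close>

text \<open>Square matrices of all sizes live in one type, padded by zeros, so that they form a real
  inner product space and a normed algebra; \<open>supp d A\<close> says that \<open>A\<close> is a \<open>d \<times> d\<close> matrix.\<close>

typedef fmat = "{f :: nat \<Rightarrow> nat \<Rightarrow> complex. \<exists>N. \<forall>i j. N \<le> i \<or> N \<le> j \<longrightarrow> f i j = 0}"
  morphisms ent Abs_fmat
  by (rule exI[of _ "\<lambda>_ _. 0"]) auto

setup_lifting type_definition_fmat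

definition supp :: "nat \<Rightarrow> fmat \<Rightarrow> bool" where
  "supp N A \<longleftrightarrow> (\<forall>i j. N \<le> i \<or> N \<le> j \<longrightarrow> ent A i j = 0)"

lemma fmat_eqI: "(\<And>i j. ent A i j = ent B i j) \<Longrightarrow> A = B"
  by (metis ent_inject ext)

lemma suppD: "supp N A \<Longrightarrow> N \<le> i \<Longrightarrow> ent A i j = 0" "supp N A \<Longrightarrow> N \<le> j \<Longrightarrow> ent A i j = 0"
  by (auto simp: supp_def)

lemma supp_mono: "supp N A \<Longrightarrow> N \<le> M \<Longrightarrow> supp M A"
  unfolding supp_def by (meson order_trans)

text \<open>A canonical size, so that product and inner product need no size argument;
  \<open>ent_mult\<close> and \<open>inner_fmat_eq\<close> then trade it for any common support
  bound.\<close>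

definition bd :: "fmat \<Rightarrow> nat" where "bd A = (LEAST N. supp N A)"

lemma supp_bd: "supp (bd A) A"
proof -
  have "\<exists>N. supp N A" using ent[of A] by (auto simp: supp_def)
  then show ?thesis unfolding bd_def by (rule LeastI_ex)
qed

lemma common_supp: "finite \<A> \<Longrightarrow> \<exists>N. \<forall>A\<in>\<A>. supp N A"
proof (induction rule: finite_induct)
  case (insert A \<A>)
  then obtain N where "\<forall>A\<in>\<A>. supp N A" by auto
  then show ?case using supp_mono[OF _ max.cobounded1[of N "bd A"]]
      supp_mono[OF supp_bd max.cobounded2[of "bd A" N]] by blast
qed auto

lemma sum_lessThan_extend:
  fixes N M :: nat
  assumes "\<And>j. N \<le> j \<Longrightarrow> f j = 0" "\<And>j. M \<le> j \<Longrightarrow> f j = (0::'a::comm_monoid_add)"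
  shows "(\<Sum>j<N. f j) = (\<Sum>j<M. f j)"
proof -
  have "(\<Sum>j<N. f j) = (\<Sum>j<max N M. f j)"
    by (rule sum.mono_neutral_left) (use assms in \<open>auto simp: not_less max_def\<close>)
  also have "\<dots> = (\<Sum>j<M. f j)"
    by (rule sum.mono_neutral_right) (use assms not_less in \<open>auto simp: max_def\<close>)
  finally show ?thesis .
qed

lemma double_sum_extend:
  fixes N M :: nat
  assumes "\<And>i j. N \<le> i \<or> N \<le> j \<Longrightarrow> f i j = 0" "\<And>i j. M \<le> i \<or> M \<le> j \<Longrightarrow> f i j = (0::'a::comm_monoid_add)"
  shows "(\<Sum>i<N. \<Sum>j<N. f i j) = (\<Sum>i<M. \<Sum>j<M. f i j)"
proof -
  have "(\<Sum>i<N. \<Sum>j<N. f i j) = (\<Sum>i<N. \<Sum>j<M. f i j)"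
    by (intro sum.cong refl sum_lessThan_extend) (use assms in auto)
  also have "\<dots> = (\<Sum>i<M. \<Sum>j<M. f i j)"
    by (intro sum_lessThan_extend) (use assms in auto)
  finally show ?thesis .
qed

lift_definition mkfm :: "nat \<Rightarrow> (nat \<Rightarrow> nat \<Rightarrow> complex) \<Rightarrow> fmat" is
  "\<lambda>N f i j. if i < N \<and> j < N then f i j else 0"
  by (rule_tac x=nat in exI) auto

lemma ent_mkfm: "ent (mkfm N f) i j = (if i < N \<and> j < N then f i j else 0)"
  by transfer simp

lift_definition adj :: "fmat \<Rightarrow> fmat" is "\<lambda>f i j. cnj (f j i)"
  by force

lemma ent_adj: "ent (adj A) i j = cnj (ent A j i)"
  by transfer simp

instantiation fmat :: "{real_vector,times}"
begin
lift_definition zero_fmat :: fmat is "\<lambda>_ _. 0" by auto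
lift_definition plus_fmat :: "fmat \<Rightarrow> fmat \<Rightarrow> fmat" is "\<lambda>f g i j. f i j + g i j"
  subgoal for f g
    by (elim exE, rule_tac x="max N Na" in exI) auto
  done
lift_definition minus_fmat :: "fmat \<Rightarrow> fmat \<Rightarrow> fmat" is "\<lambda>f g i j. f i j - g i j"
  subgoal for f g
    by (elim exE, rule_tac x="max N Na" in exI) auto
  done
lift_definition uminus_fmat :: "fmat \<Rightarrow> fmat" is "\<lambda>f i j. - f i j" by auto
lift_definition scaleR_fmat :: "real \<Rightarrow> fmat \<Rightarrow> fmat" is "\<lambda>c f i j. c *\<^sub>R f i j" by auto
definition times_fmat :: "fmat \<Rightarrow> fmat \<Rightarrow> fmat" where
  "A * B = mkfm (max (bd A) (bd B)) (\<lambda>i k. \<Sum>j<bd A. ent A i j * ent B j k)"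
instance
  by standard (transfer; auto simp: algebra_simps fun_eq_iff)+
end

lemma ent_simps [simp]:
  "ent 0 i j = 0" "ent (A + B) i j = ent A i j + ent B i j" "ent (A - B) i j = ent A i j - ent B i j"
  "ent (- A) i j = - ent A i j" "ent (c *\<^sub>R A) i j = c *\<^sub>R ent A i j"
  by (transfer; simp)+

lemma ent_sum: "ent (sum f I) i j = (\<Sum>x\<in>I. ent (f x) i j)"
  by (induction I rule: infinite_finite_induct) auto

lemma ent_mult:
  assumes "supp N A \<or> supp N B"
  shows "ent (A * B) i k = (\<Sum>j<N. ent A i j * ent B j k)"
proof -
  let ?f = "\<lambda>j. ent A i j * ent B j k"
  have "(\<Sum>j<bd A. ?f j) = (\<Sum>j<N. ?f j)"
    by (rule sum_lessThan_extend) (use assms suppD[OF supp_bd] suppD in auto)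
  moreover have "(\<Sum>j<bd A. ?f j) = 0" if "\<not> (i < max (bd A) (bd B) \<and> k < max (bd A) (bd B))"
    by (rule sum.neutral) (use that suppD[OF supp_bd] in \<open>auto simp: not_less\<close>)
  ultimately show ?thesis
    unfolding times_fmat_def ent_mkfm by auto
qed

lemma supp_mult: "supp N A \<Longrightarrow> supp N B \<Longrightarrow> supp N (A * B)"
  using suppD by (auto simp: supp_def[of N "A * B"] ent_mult[of N])

lemma supp_simps [simp, intro]:
  "supp N 0" "supp N A \<Longrightarrow> supp N B \<Longrightarrow> supp N (A + B)" "supp N A \<Longrightarrow> supp N B \<Longrightarrow> supp N (A - B)"
  "supp N A \<Longrightarrow> supp N (c *\<^sub>R A)" "supp N A \<Longrightarrow> supp N (adj A)" "supp N (mkfm N f)"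
  unfolding supp_def by (auto simp: ent_adj ent_mkfm)

lemma supp_sum: "(\<And>x. x \<in> I \<Longrightarrow> supp N (f x)) \<Longrightarrow> supp N (sum f I)"
  unfolding supp_def by (simp add: ent_sum)

instance fmat :: real_algebra
proof
  fix A B C :: fmat and c :: real
  obtain N where N: "supp N A" "supp N B" "supp N C" using common_supp[of "{A, B, C}"] by auto
  note e = ent_mult[of N]
  show "A * B * C = A * (B * C)"
  proof (rule fmat_eqI)
    fix i k
    have "ent (A * B * C) i k = (\<Sum>l<N. \<Sum>j<N. ent A i j * ent B j l * ent C l k)"
      using N by (simp add: e supp_mult sum_distrib_right)
    also have "\<dots> = (\<Sum>j<N. \<Sum>l<N. ent A i j * ent B j l * ent C l k)"
      by (rule sum.swap)
    also have "\<dots> = ent (A * (B * C)) i k"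
      using N by (simp add: e supp_mult sum_distrib_left mult.assoc)
    finally show "ent (A * B * C) i k = ent (A * (B * C)) i k" .
  qed
  show "(A + B) * C = A * C + B * C" "A * (B + C) = A * B + A * C"
    "c *\<^sub>R A * B = c *\<^sub>R (A * B)" "A * c *\<^sub>R B = c *\<^sub>R (A * B)"
    using N by (auto intro!: fmat_eqI
        simp: e distrib_left distrib_right sum.distrib scaleR_sum_right)
qed

text \<open>Real part of the trace of \<open>adj A * B\<close>. Its norm is the Frobenius norm, and
  on Hermitian matrices nothing is lost, because there this trace is real.\<close>

definition finner :: "fmat \<Rightarrow> fmat \<Rightarrow> real" where
  "finner A B = (\<Sum>i<bd A. \<Sum>j<bd A. Re (cnj (ent A i j) * ent B i j))"

instantiation fmat :: real_inner
begin
definition inner_fmat :: "fmat \<Rightarrow> fmat \<Rightarrow> real" where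
  "inner_fmat = finner"
definition norm_fmat :: "fmat \<Rightarrow> real" where "norm_fmat A = sqrt (finner A A)"
definition dist_fmat :: "fmat \<Rightarrow> fmat \<Rightarrow> real" where "dist_fmat A B = norm_class.norm (A - B)"
definition sgn_fmat :: "fmat \<Rightarrow> fmat" where "sgn_fmat A = A /\<^sub>R norm_class.norm A"
definition uniformity_fmat :: "(fmat \<times> fmat) filter" where
  "uniformity_fmat = (INF e\<in>{0<..}. principal {(x, y). dist x y < e})"
definition open_fmat :: "fmat set \<Rightarrow> bool" where
  "open_fmat U \<longleftrightarrow> (\<forall>x\<in>U. eventually (\<lambda>(x', y). x' = x \<longrightarrow> y \<in> U) uniformity)"

lemma inner_fmat_eq:
  assumes "supp N A \<or> supp N B"
  shows "inner A B = (\<Sum>i<N. \<Sum>j<N. Re (cnj (ent A i j) * ent B i j))"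
  unfolding inner_fmat_def finner_def
  by (rule double_sum_extend) (use assms suppD[OF supp_bd] suppD in auto)

instance
proof
  fix A B C :: fmat and c :: real
  obtain N where N: "supp N A" "supp N B" "supp N C" using common_supp[of "{A, B, C}"] by auto
  note e = inner_fmat_eq[of N]
  show "inner A B = inner B A" using N by (simp add: e algebra_simps)
  show "inner (A + B) C = inner A C + inner B C"
    using N by (simp add: e algebra_simps sum.distrib)
  show "inner (c *\<^sub>R A) B = c * inner A B"
    using N by (simp add: e algebra_simps sum_distrib_left)
  have sq: "Re (cnj z * z) = (cmod z)\<^sup>2" for z by (simp add: cmod_def power2_eq_square)
  have iA: "inner A A = (\<Sum>i<N. \<Sum>j<N. (cmod (ent A i j))\<^sup>2)"
    by (simp only: e[OF disjI1[OF N(1)]] sq)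
  show "0 \<le> inner A A" unfolding iA by (simp add: sum_nonneg)
  show "(inner A A = 0) = (A = 0)"
  proof
    assume "inner A A = 0"
    then have z: "(\<Sum>i<N. \<Sum>j<N. (cmod (ent A i j))\<^sup>2) = 0" by (simp add: iA)
    have "ent A i j = 0" for i j
    proof (cases "i < N \<and> j < N")
      case True
      have "(\<Sum>j<N. (cmod (ent A i j))\<^sup>2) = 0"
        using z True by (subst (asm) sum_nonneg_eq_0_iff) (auto intro: sum_nonneg)
      then show ?thesis using True by (subst (asm) sum_nonneg_eq_0_iff) auto
    qed (use N in \<open>auto simp: supp_def not_less\<close>)
    then show "A = 0" by (auto intro: fmat_eqI)
  next
    assume "A = 0"
    then show "inner A A = 0" using inner_fmat_eq[of 0 0 0] by (simp add: supp_def)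
  qed
qed (auto simp: norm_fmat_def inner_fmat_def dist_fmat_def sgn_fmat_def uniformity_fmat_def open_fmat_def)
end

lemma norm_fmat_sq:
  assumes "supp N A"
  shows "(norm A)\<^sup>2 = (\<Sum>i<N. \<Sum>j<N. (cmod (ent A i j))\<^sup>2)"
proof -
  have "Re (cnj z * z) = (cmod z)\<^sup>2" for z by (simp add: cmod_def power2_eq_square)
  then show ?thesis
    by (simp only: power2_norm_eq_inner inner_fmat_eq[OF disjI1[OF assms]])
qed

lemma adj_simps [simp]:
  "adj (adj A) = A" "adj (A + B) = adj A + adj B" "adj (A - B) = adj A - adj B"
  "adj (c *\<^sub>R A) = c *\<^sub>R adj A" "adj 0 = 0" "adj (- A) = - adj A"
  by (auto intro!: fmat_eqI simp: ent_adj)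

lemma adj_sum: "adj (sum f I) = (\<Sum>x\<in>I. adj (f x))"
  by (auto intro!: fmat_eqI simp: ent_adj ent_sum)

lemma adj_mult [simp]: "adj (A * B) = adj B * adj A"
proof -
  obtain N where N: "supp N A" "supp N B" using common_supp[of "{A, B}"] by auto
  then show ?thesis
    by (auto intro!: fmat_eqI simp: ent_adj ent_mult[of N] mult.commute)
qed

lemma inner_fmat_Re:
  assumes "supp N A \<or> supp N B"
  shows "inner A B = Re (\<Sum>i<N. \<Sum>j<N. cnj (ent A i j) * ent B i j)"
  by (simp only: inner_fmat_eq[OF assms] Re_sum)

lemma inner_mult_left: "inner (A * B) C = inner B (adj A * C)"
proof -
  obtain N where N: "supp N A" "supp N B" "supp N C" using common_supp[of "{A, B, C}"] by auto
  let ?t = "\<lambda>i j k. cnj (ent A i j) * cnj (ent B j k) * ent C i k"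
  have "inner (A * B) C = Re (\<Sum>i<N. \<Sum>k<N. \<Sum>j<N. ?t i j k)"
    by (subst inner_fmat_Re[OF disjI2[OF N(3)]])
      (simp only: ent_mult[OF disjI1[OF N(1)]] cnj_sum complex_cnj_mult sum_distrib_right)
  also have "(\<Sum>i<N. \<Sum>k<N. \<Sum>j<N. ?t i j k) = (\<Sum>i<N. \<Sum>j<N. \<Sum>k<N. ?t i j k)"
    by (rule sum.cong[OF refl], rule sum.swap)
  also have "\<dots> = (\<Sum>j<N. \<Sum>i<N. \<Sum>k<N. ?t i j k)"
    by (rule sum.swap)
  also have "\<dots> = (\<Sum>j<N. \<Sum>k<N. \<Sum>i<N. ?t i j k)"
    by (rule sum.cong[OF refl], rule sum.swap)
  also have "\<dots> = (\<Sum>j<N. \<Sum>k<N. cnj (ent B j k) * (\<Sum>i<N. cnj (ent A i j) * ent C i k))"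
    by (simp only: sum_distrib_left mult_ac)
  also have "Re \<dots> = inner B (adj A * C)"
    by (subst inner_fmat_Re[OF disjI1[OF N(2)]])
      (simp only: ent_mult[OF disjI2[OF N(3)]] ent_adj)
  finally show ?thesis .
qed

lemma inner_adj_adj: "inner (adj A) (adj B) = inner A B"
proof -
  obtain N where N: "supp N A" "supp N B" using common_supp[of "{A, B}"] by auto
  have "inner (adj A) (adj B) = (\<Sum>i<N. \<Sum>j<N. Re (cnj (ent A j i) * ent B j i))"
    using N by (simp add: inner_fmat_eq[of N] ent_adj)
  also have "\<dots> = (\<Sum>j<N. \<Sum>i<N. Re (cnj (ent A j i) * ent B j i))"
    by (rule sum.swap)
  also have "\<dots> = inner A B"
    by (simp only: inner_fmat_eq[OF disjI1[OF N(1)]])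
  finally show ?thesis .
qed

lemma inner_mult_right: "inner (A * B) C = inner A (C * adj B)"
  by (metis adj_mult adj_simps(1) inner_adj_adj inner_mult_left)

lemma norm_adj [simp]: "norm (adj A) = norm A"
  by (simp add: norm_eq_sqrt_inner inner_adj_adj)

instance fmat :: real_normed_algebra
proof
  fix A B :: fmat
  obtain N where N: "supp N A" "supp N B" using common_supp[of "{A, B}"] by auto
  have "(cmod (ent (A * B) i k))\<^sup>2 \<le> (\<Sum>j<N. (cmod (ent A i j))\<^sup>2) * (\<Sum>j<N. (cmod (ent B j k))\<^sup>2)" for i k
  proof -
    have "cmod (ent (A * B) i k) \<le> (\<Sum>j<N. cmod (ent A i j) * cmod (ent B j k))"
      using N by (simp add: ent_mult[of N]) (metis (no_types, lifting) norm_mult norm_sum sum.cong)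
    then have "(cmod (ent (A * B) i k))\<^sup>2 \<le> (\<Sum>j<N. cmod (ent A i j) * cmod (ent B j k))\<^sup>2"
      by (intro power_mono) auto
    also have "\<dots> \<le> (\<Sum>j<N. (cmod (ent A i j))\<^sup>2) * (\<Sum>j<N. (cmod (ent B j k))\<^sup>2)"
      by (rule Cauchy_Schwarz_ineq_sum)
    finally show ?thesis .
  qed
  then have "(norm (A * B))\<^sup>2 \<le> (\<Sum>i<N. \<Sum>k<N. (\<Sum>j<N. (cmod (ent A i j))\<^sup>2) * (\<Sum>j<N. (cmod (ent B j k))\<^sup>2))"
    using N by (simp add: norm_fmat_sq[of N] supp_mult sum_mono)
  also have "\<dots> = (\<Sum>i<N. \<Sum>j<N. (cmod (ent A i j))\<^sup>2) * (\<Sum>k<N. \<Sum>j<N. (cmod (ent B j k))\<^sup>2)"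
    by (simp add: sum_product)
  also have "\<dots> = (norm A)\<^sup>2 * (norm B)\<^sup>2"
    by (subst (2) sum.swap) (simp only: norm_fmat_sq[OF N(1)] norm_fmat_sq[OF N(2)])
  finally show "norm (A * B) \<le> norm A * norm B"
    by (metis mult_nonneg_nonneg norm_ge_zero power2_le_imp_le power_mult_distrib)
qed

definition idm :: "nat \<Rightarrow> fmat" where "idm n = mkfm n (\<lambda>i j. if i = j then 1 else 0)"

lemma supp_idm [simp]: "supp n (idm n)" by (simp add: idm_def)

lemma ent_idm: "ent (idm n) i j = (if i = j \<and> i < n then 1 else 0)"
  by (auto simp: idm_def ent_mkfm)

lemma adj_idm [simp]: "adj (idm n) = idm n"
  by (auto intro!: fmat_eqI simp: ent_adj ent_idm)

lemma idm_mult: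
  assumes "\<And>i j. n \<le> i \<Longrightarrow> ent A i j = 0"
  shows "idm n * A = A"
proof (rule fmat_eqI)
  fix i k
  have "ent (idm n * A) i k = (\<Sum>j<n. ent (idm n) i j * ent A j k)"
    by (rule ent_mult) simp
  also have "\<dots> = (\<Sum>j<n. if i = j then ent A j k else 0)"
    by (rule sum.cong) (auto simp: ent_idm)
  also have "\<dots> = ent A i k" using assms by (auto simp: not_less)
  finally show "ent (idm n * A) i k = ent A i k" .
qed

lemma mult_idm:
  assumes "\<And>i j. n \<le> j \<Longrightarrow> ent A i j = 0"
  shows "A * idm n = A"
proof -
  have "idm n * adj A = adj A" using assms by (intro idm_mult) (simp add: ent_adj)
  then have "adj (idm n * adj A) = adj (adj A)" by (simp only:)
  then show ?thesis by simp
qed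

lemma norm_idm_sq: "(norm (idm n))\<^sup>2 = real n"
proof -
  have "(\<Sum>j<n. (cmod (ent (idm n) i j))\<^sup>2) = 1" if "i < n" for i
  proof -
    have "(\<Sum>j<n. (cmod (ent (idm n) i j))\<^sup>2) = (\<Sum>j<n. if j = i then 1 else 0)"
      using that by (intro sum.cong) (auto simp: ent_idm)
    then show ?thesis using that by simp
  qed
  then show ?thesis by (simp add: norm_fmat_sq[of n])
qed

subsection \<open>Operator bounds and projections\<close>

text \<open>The spectral norm bound, tested on matrices instead of vectors: left multiplication by
  \<open>Z\<close> acts on each column separately, so its norm for the Frobenius norm is the
  spectral norm of \<open>Z\<close>.\<close>

definition opb :: "real \<Rightarrow> fmat \<Rightarrow> bool" where
  "opb c Z \<longleftrightarrow> 0 \<le> c \<and> (\<forall>Y. norm (Z * Y) \<le> c * norm Y)"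

lemma opb_onorm: "opb (onorm ((*) Z)) Z"
  unfolding opb_def by (simp add: onorm bounded_linear_mult_right onorm_pos_le)

lemma opb_mono: "opb c Z \<Longrightarrow> c \<le> c' \<Longrightarrow> opb c' Z"
  unfolding opb_def by (meson mult_right_mono norm_ge_zero order_trans)

lemma opb_add: "opb a A \<Longrightarrow> opb b B \<Longrightarrow> opb (a + b) (A + B)"
  unfolding opb_def by (auto simp: algebra_simps intro: order_trans[OF norm_triangle_ineq] add_mono)

lemma opb_adj:
  assumes "opb c Z" shows "opb c (adj Z)"
proof -
  have "norm (adj Z * Y) \<le> c * norm Y" for Y
  proof (cases "adj Z * Y = 0")
    case False
    have "(norm (adj Z * Y))\<^sup>2 = inner Y (Z * (adj Z * Y))"
      by (simp add: power2_norm_eq_inner inner_mult_left)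
    also have "\<dots> \<le> norm Y * norm (Z * (adj Z * Y))" by (rule norm_cauchy_schwarz)
    also have "\<dots> \<le> norm Y * (c * norm (adj Z * Y))"
      using assms by (intro mult_left_mono) (auto simp: opb_def)
    finally show ?thesis using False by (simp add: power2_eq_square mult.commute)
  qed (use assms in \<open>auto simp: opb_def\<close>)
  then show ?thesis using assms by (auto simp: opb_def)
qed

lemma opb_right:
  assumes "opb c Z" shows "norm (Y * Z) \<le> c * norm Y"
  using opb_adj[OF assms] unfolding opb_def by (metis adj_mult norm_adj)

definition proj :: "fmat \<Rightarrow> bool" where "proj P \<longleftrightarrow> P * P = P \<and> adj P = P"

lemma projD:
  assumes "proj P"
  shows "P * P = P" "adj P = P" "P * (P * Y) = P * Y" "Y * P * P = Y * P"
  using assms by (simp_all only: proj_def mult.assoc[of Y P P] mult.assoc[of P P Y, symmetric])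

lemma proj_pythagoras:
  assumes "proj P"
  shows "(norm Y)\<^sup>2 = (norm (P * Y))\<^sup>2 + (norm (Y - P * Y))\<^sup>2"
proof -
  have 0: "inner (P * Y) (Y - P * Y) = 0"
    using assms by (simp add: inner_mult_left projD right_diff_distrib)
  have "(norm (P * Y + (Y - P * Y)))\<^sup>2 = (norm (P * Y))\<^sup>2 + (norm (Y - P * Y))\<^sup>2"
    unfolding power2_norm_eq_inner inner_add_left inner_add_right
    using 0 by (simp only: inner_commute[of "Y - P * Y" "P * Y"])
  then show ?thesis by simp
qed

lemma opb_proj: assumes "proj P" shows "opb 1 P"
  unfolding opb_def
proof safe
  fix Y
  have "(norm (P * Y))\<^sup>2 \<le> (norm Y)\<^sup>2" using proj_pythagoras[OF assms, of Y] by simp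
  then show "norm (P * Y) \<le> 1 * norm Y" by simp
qed simp

lemma norm_compl_le: assumes "proj P" shows "norm (Y - P * Y) \<le> norm Y"
proof -
  have "(norm (Y - P * Y))\<^sup>2 \<le> (norm Y)\<^sup>2" using proj_pythagoras[OF assms, of Y] by simp
  then show ?thesis by simp
qed

lemma norm_proj_le: "proj P \<Longrightarrow> norm (P * Y) \<le> norm Y" "proj P \<Longrightarrow> norm (Y * P) \<le> norm Y"
  using opb_proj opb_right[OF opb_proj] unfolding opb_def by auto

lemma norm_compl_right_le: assumes "proj P" shows "norm (Y - Y * P) \<le> norm Y"
proof -
  have "adj (Y - Y * P) = adj Y - P * adj Y" using assms by (simp add: projD)
  then show ?thesis using norm_compl_le[OF assms, of "adj Y"] by (metis norm_adj)
qed

lemma inner_proj_le: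
  assumes "proj P" "opb c Z"
  shows "inner Z (P * Y) \<le> c * norm P * norm (P * Y)"
proof -
  have "inner Z (P * Y) = inner (P * Z) (P * Y)"
    using assms by (simp add: inner_mult_left projD)
  also have "\<dots> \<le> norm (P * Z) * norm (P * Y)" by (rule norm_cauchy_schwarz)
  also have "\<dots> \<le> c * norm P * norm (P * Y)"
    using opb_right[OF assms(2), of P] by (intro mult_right_mono) auto
  finally show ?thesis .
qed

section \<open>One step of Riemannian gradient descent\<close>

lemma mult_self_le:
  fixes x C :: real
  assumes "x * x \<le> x * C" "0 \<le> C"
  shows "x \<le> C"
proof (rule ccontr)
  assume "\<not> x \<le> C"
  then have "x * C < x * x" using assms(2) by (intro mult_strict_left_mono) auto
  then show False using assms(1) by simp
qed

text \<open>By duality with the operator norm this bounds the nuclear norm of \<open>X\<close> by \<open>N\<close>.\<close>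

definition nuc_le :: "real \<Rightarrow> fmat \<Rightarrow> bool" where
  "nuc_le N X \<longleftrightarrow> (\<forall>c Z. opb c Z \<longrightarrow> inner Z X \<le> N * c)"

lemma opb_uminus: "opb c Z \<Longrightarrow> opb c (- Z)"
  by (simp add: opb_def)

lemma nuc_le_abs: "nuc_le N X \<Longrightarrow> opb c Z \<Longrightarrow> \<bar>inner Z X\<bar> \<le> N * c"
  unfolding nuc_le_def using opb_uminus[of c Z] by (metis abs_le_iff inner_minus_left)

text \<open>One projection \<open>P\<close> suffices for row and column space because the iterates
  are Hermitian; see \<open>svd_projections\<close>.\<close>

definition PT :: "fmat \<Rightarrow> fmat \<Rightarrow> fmat" where "PT P X = P * X + X * P - P * X * P"

lemma PT_add: "PT P (X + Y) = PT P X + PT P Y"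
  and PT_diff: "PT P (X - Y) = PT P X - PT P Y"
  and PT_scaleR: "PT P (c *\<^sub>R X) = c *\<^sub>R PT P X"
  by (simp_all add: PT_def algebra_simps)

lemma PT_idem: "proj P \<Longrightarrow> PT P (PT P X) = PT P X"
  by (simp add: PT_def algebra_simps projD mult.assoc)

lemma adj_PT: "proj P \<Longrightarrow> adj (PT P X) = PT P (adj X)"
  by (simp add: PT_def projD mult.assoc)

lemma supp_PT: "supp d P \<Longrightarrow> supp d X \<Longrightarrow> supp d (PT P X)"
  unfolding PT_def by (intro supp_simps supp_mult)

lemma inner_PT:
  assumes "proj P"
  shows "inner (PT P X) Y = inner X (PT P Y)"
proof -
  have "inner (P * X * P) Y = inner X (P * Y * P)"
    using assms inner_mult_right[of "P * X" P Y] inner_mult_left[of P X "Y * P"]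
    by (simp add: projD mult.assoc)
  moreover have "inner (P * X) Y = inner X (P * Y)" "inner (X * P) Y = inner X (Y * P)"
    using assms inner_mult_left[of P X Y] inner_mult_right[of X P Y] by (simp_all add: projD)
  ultimately show ?thesis by (simp add: PT_def inner_add_left inner_add_right inner_diff_left inner_diff_right)
qed

text \<open>A tangent vector is \<open>P * Y\<close> plus \<open>(Y - P * Y) * P\<close>, two pieces
  of rank at most r, and each has nuclear norm at most sqrt r times its Frobenius norm. This is the
  origin of the constant 2 sqrt r of the cone.\<close>

lemma nuc_le_PT:
  assumes P: "proj P" "(norm P)\<^sup>2 \<le> r" and Y: "PT P Y = Y"
  shows "nuc_le (2 * sqrt r * norm Y) Y"
  unfolding nuc_le_def
proof safe
  fix c Z assume Z: "opb c Z"
  then have c: "0 \<le> c" by (simp add: opb_def)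
  have nP: "norm P \<le> sqrt r" using P(2) by (simp add: real_le_rsqrt)
  have 1: "inner Z (P * Y) \<le> c * norm P * norm (P * Y)" by (rule inner_proj_le[OF P(1) Z])
  have "inner Z ((Y - P * Y) * P) = inner (adj Z) (P * adj (Y - P * Y))"
    using P(1) by (metis adj_mult inner_adj_adj projD(2))
  also have "\<dots> \<le> c * norm P * norm (P * adj (Y - P * Y))"
    by (rule inner_proj_le[OF P(1) opb_adj[OF Z]])
  finally have 2: "inner Z ((Y - P * Y) * P) \<le> c * norm P * norm (P * adj (Y - P * Y))" .
  have "norm (P * adj (Y - P * Y)) \<le> norm Y"
    using norm_proj_le(1)[OF P(1), of "adj (Y - P * Y)"] norm_compl_le[OF P(1), of Y] by (metis norm_adj order_trans)
  then have 3: "c * norm P * norm (P * adj (Y - P * Y)) \<le> c * norm P * norm Y"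
    "c * norm P * norm (P * Y) \<le> c * norm P * norm Y"
    using c norm_proj_le(1)[OF P(1), of Y] by (auto intro!: mult_left_mono)
  have "Y = P * Y + (Y - P * Y) * P" using Y by (simp add: PT_def algebra_simps)
  then have "inner Z Y = inner Z (P * Y) + inner Z ((Y - P * Y) * P)" by (metis inner_add_right)
  also have "\<dots> \<le> c * norm P * norm Y + c * norm P * norm Y" using 1 2 3 by linarith
  also have "\<dots> = norm P * (2 * c * norm Y)" by simp
  also have "\<dots> \<le> sqrt r * (2 * c * norm Y)" using nP c by (intro mult_right_mono) auto
  finally show "inner Z Y \<le> 2 * sqrt r * norm Y * c" by (simp add: mult_ac)
qed

lemma norm_gram_eq: "norm (adj K * K) = norm (K * adj K)"
proof -
  have "inner (adj K * K) (adj K * K) = inner (K * adj K) (K * adj K)"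
    by (simp add: inner_mult_left[of "adj K" K] inner_mult_right[of K "adj K"] mult.assoc)
  then show ?thesis by (simp add: norm_eq_sqrt_inner)
qed

text \<open>For a positive semidefinite matrix the nuclear norm is the trace, here the squared norm
  of \<open>K\<close>. Written as the inner product of \<open>Q\<close> with
  \<open>adj K * K\<close>, it is bounded by Cauchy-Schwarz.\<close>

lemma nuc_le_gram:
  assumes Q: "proj Q" "(norm Q)\<^sup>2 \<le> r" and K: "K * Q = K"
  shows "nuc_le (sqrt r * norm (K * adj K)) (K * adj K)"
  unfolding nuc_le_def
proof safe
  fix c Z assume Z: "opb c Z"
  then have c: "0 \<le> c" by (simp add: opb_def)
  have nQ: "norm Q \<le> sqrt r" using Q(2) by (simp add: real_le_rsqrt)
  have "inner Z (K * adj K) = inner (Z * K) K" by (simp add: inner_mult_right)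
  also have "\<dots> \<le> norm (Z * K) * norm K" by (rule norm_cauchy_schwarz)
  also have "\<dots> \<le> c * norm K * norm K" using Z by (intro mult_right_mono) (auto simp: opb_def)
  finally have 1: "inner Z (K * adj K) \<le> c * (norm K * norm K)" by (simp add: mult.assoc)
  have "norm K * norm K = inner (K * Q) K" by (simp add: K power2_norm_eq_inner[symmetric] power2_eq_square)
  also have "\<dots> = inner Q (adj K * K)" by (rule inner_mult_left)
  also have "\<dots> \<le> norm Q * norm (adj K * K)" by (rule norm_cauchy_schwarz)
  also have "\<dots> \<le> sqrt r * norm (K * adj K)" unfolding norm_gram_eq using nQ by (intro mult_right_mono) auto
  finally have "c * (norm K * norm K) \<le> c * (sqrt r * norm (K * adj K))" using c by (rule mult_left_mono)
  with 1 show "inner Z (K * adj K) \<le> sqrt r * norm (K * adj K) * c" by (simp add: mult_ac)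
qed

text \<open>With \<open>a\<close> equal to d/m, \<open>sform\<close> is the Euclidean inner product
  of two sampled vectors and \<open>sgram\<close> is the sampling map followed by its adjoint.
  Carrying only \<open>a\<close> keeps the square root of d/m out of the estimates.\<close>

definition sform :: "real \<Rightarrow> nat \<Rightarrow> (nat \<Rightarrow> fmat) \<Rightarrow> fmat \<Rightarrow> fmat \<Rightarrow> real" where
  "sform a m S X Y = a * (\<Sum>i<m. inner (S i) X * inner (S i) Y)"

definition sgram :: "real \<Rightarrow> nat \<Rightarrow> (nat \<Rightarrow> fmat) \<Rightarrow> fmat \<Rightarrow> fmat" where
  "sgram a m S X = a *\<^sub>R (\<Sum>i<m. inner (S i) X *\<^sub>R S i)"

lemma inner_sgram: "inner V (sgram a m S X) = sform a m S V X"
  by (simp add: sgram_def sform_def inner_sum_right mult.commute inner_commute[of V])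

lemma sform_simps:
  "sform a m S (X + Y) Z = sform a m S X Z + sform a m S Y Z"
  "sform a m S Z (X + Y) = sform a m S Z X + sform a m S Z Y"
  "sform a m S (X - Y) Z = sform a m S X Z - sform a m S Y Z"
  "sform a m S Z (X - Y) = sform a m S Z X - sform a m S Z Y"
  "sform a m S (c *\<^sub>R X) Z = c * sform a m S X Z"
  "sform a m S Z (c *\<^sub>R X) = c * sform a m S Z X"
  by (simp_all add: sform_def inner_add_right inner_diff_right algebra_simps sum.distrib
      sum_subtractf sum_distrib_left)

lemma sform_nonneg: "0 \<le> a \<Longrightarrow> 0 \<le> sform a m S X X"
  by (simp add: sform_def sum_nonneg)

lemma sform_commute: "sform a m S X Y = sform a m S Y X"
  by (simp add: sform_def mult.commute)

lemma sgram_add: "sgram a m S (X + Y) = sgram a m S X + sgram a m S Y"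
  by (simp add: sgram_def inner_add_right scaleR_left_distrib sum.distrib scaleR_right_distrib)

lemma sform_cauchy:
  assumes "0 \<le> a"
  shows "sform a m S X Y \<le> sqrt (sform a m S X X) * sqrt (sform a m S Y Y)"
proof -
  have "(\<Sum>i<m. inner (S i) X * inner (S i) Y)\<^sup>2
      \<le> (\<Sum>i<m. (inner (S i) X)\<^sup>2) * (\<Sum>i<m. (inner (S i) Y)\<^sup>2)"
    by (rule Cauchy_Schwarz_ineq_sum)
  then have "a\<^sup>2 * (\<Sum>i<m. inner (S i) X * inner (S i) Y)\<^sup>2
      \<le> a\<^sup>2 * ((\<Sum>i<m. (inner (S i) X)\<^sup>2) * (\<Sum>i<m. (inner (S i) Y)\<^sup>2))"
    by (rule mult_left_mono) simp
  then have "(sform a m S X Y)\<^sup>2 \<le> sform a m S X X * sform a m S Y Y"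
    by (simp add: sform_def power_mult_distrib power2_eq_square mult_ac)
  then show ?thesis
    by (metis real_sqrt_mult real_le_rsqrt)
qed

text \<open>The condition is on the nuclear norm and not on the rank: this covers tangent vectors by
  \<open>nuc_le_PT\<close> and the normal error by \<open>nuc_le_gram\<close>, and it is the form
  that duality can test.\<close>

definition rip :: "nat \<Rightarrow> real \<Rightarrow> real \<Rightarrow> real \<Rightarrow> nat \<Rightarrow> (nat \<Rightarrow> fmat) \<Rightarrow> bool" where
  "rip d r \<delta> a m S \<longleftrightarrow> (\<forall>X. supp d X \<longrightarrow> adj X = X \<longrightarrow> nuc_le (2 * sqrt r * norm X) X \<longrightarrow>
     \<bar>sform a m S X X - (norm X)\<^sup>2\<bar> \<le> \<delta> * (norm X)\<^sup>2)"

definition tangent :: "nat \<Rightarrow> fmat \<Rightarrow> fmat set" where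
  "tangent d P = {Y. supp d Y \<and> adj Y = Y \<and> PT P Y = Y}"

lemma tangent_add: "X \<in> tangent d P \<Longrightarrow> Y \<in> tangent d P \<Longrightarrow> X + Y \<in> tangent d P"
  and tangent_diff: "X \<in> tangent d P \<Longrightarrow> Y \<in> tangent d P \<Longrightarrow> X - Y \<in> tangent d P"
  and tangent_scaleR: "X \<in> tangent d P \<Longrightarrow> c *\<^sub>R X \<in> tangent d P"
  by (auto simp: tangent_def PT_add PT_diff PT_scaleR)

lemma PT_tangent:
  "proj P \<Longrightarrow> supp d P \<Longrightarrow> supp d X \<Longrightarrow> adj X = X \<Longrightarrow> PT P X \<in> tangent d P"
  by (simp add: tangent_def supp_PT adj_PT PT_idem)

section \<open>The gradient step under the restricted isometry property\<close>

locale rgd_geometry =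
  fixes d :: nat and r \<delta> a :: real and m :: nat and S :: "nat \<Rightarrow> fmat" and P :: fmat
  assumes a: "0 \<le> a" and rip: "rip d r \<delta> a m S"
    and S: "\<And>i. i < m \<Longrightarrow> supp d (S i) \<and> adj (S i) = S i"
    and P: "proj P" "supp d P" "(norm P)\<^sup>2 \<le> r"
    and \<delta>: "0 \<le> \<delta>" "\<delta> < 1"
begin

abbreviation "q \<equiv> sform a m S"
abbreviation "Ast \<equiv> sgram a m S"

lemma Ast_herm: "supp d (Ast X)" "adj (Ast X) = Ast X"
  using S by (auto simp: sgram_def adj_sum intro!: supp_simps supp_sum)

lemma tangent_rip: "Y \<in> tangent d P \<Longrightarrow> \<bar>q Y Y - (norm Y)\<^sup>2\<bar> \<le> \<delta> * (norm Y)\<^sup>2"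
  using rip nuc_le_PT[OF P(1,3)] unfolding rip_def tangent_def by auto

lemma tangent_polarization:
  assumes X: "X \<in> tangent d P" and Y: "Y \<in> tangent d P"
  shows "\<bar>q X Y - inner X Y\<bar> \<le> \<delta> * norm X * norm Y"
proof (cases "X = 0 \<or> Y = 0")
  case True
  then show ?thesis by (auto simp: sform_def)
next
  case False
  \<comment> \<open>Both vectors are scaled to the same norm first, so that the parallelogram
    identity yields a product of norms and not a sum of squares.\<close>
  define U V where "U = norm Y *\<^sub>R X" and "V = norm X *\<^sub>R Y"
  have UV: "U \<in> tangent d P" "V \<in> tangent d P" using X Y by (auto simp: U_def V_def tangent_scaleR)
  have n: "norm U = norm X * norm Y" "norm V = norm X * norm Y" by (auto simp: U_def V_def)
  have q4: "4 * q U V = q (U + V) (U + V) - q (U - V) (U - V)"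
    by (simp add: sform_simps sform_commute[of a m S V U])
  have i4: "4 * inner U V = (norm (U + V))\<^sup>2 - (norm (U - V))\<^sup>2"
    by (simp add: power2_norm_eq_inner inner_add_left inner_add_right inner_diff_left inner_diff_right inner_commute[of V U])
  have p: "(norm (U + V))\<^sup>2 + (norm (U - V))\<^sup>2 = 2 * (norm U)\<^sup>2 + 2 * (norm V)\<^sup>2"
    by (simp add: power2_norm_eq_inner inner_add_left inner_add_right inner_diff_left inner_diff_right)
  have "\<bar>4 * q U V - 4 * inner U V\<bar> \<le> \<delta> * (norm (U + V))\<^sup>2 + \<delta> * (norm (U - V))\<^sup>2"
    using tangent_rip[OF tangent_add[OF UV]] tangent_rip[OF tangent_diff[OF UV]]
    unfolding q4 i4 by linarith
  also have "\<dots> = \<delta> * (2 * (norm U)\<^sup>2 + 2 * (norm V)\<^sup>2)"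
    unfolding p[symmetric] by (simp add: algebra_simps)
  also have "\<dots> = 4 * \<delta> * (norm X * norm Y)\<^sup>2" by (simp add: n)
  finally have "\<bar>q U V - inner U V\<bar> \<le> \<delta> * (norm X * norm Y)\<^sup>2" by linarith
  moreover have "q U V - inner U V = norm X * norm Y * (q X Y - inner X Y)"
    by (simp add: U_def V_def sform_simps algebra_simps)
  ultimately have "norm X * norm Y * \<bar>q X Y - inner X Y\<bar> \<le> norm X * norm Y * (\<delta> * norm X * norm Y)"
    by (simp add: abs_mult power2_eq_square mult_ac)
  then show ?thesis using False by simp
qed

text \<open>The step size is the reciprocal of a Rayleigh quotient of the sampling form on a tangent
  vector, so the isometry keeps it near 1.\<close>

lemma step_size_bounds:
  assumes Y: "Y \<in> tangent d P" "Y \<noteq> 0"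
  shows "1 / (1 + \<delta>) \<le> (norm Y)\<^sup>2 / q Y Y" "(norm Y)\<^sup>2 / q Y Y \<le> 1 / (1 - \<delta>)"
proof -
  have n: "0 < (norm Y)\<^sup>2" using Y by simp
  have "(1 - \<delta>) * (norm Y)\<^sup>2 \<le> q Y Y" "q Y Y \<le> (1 + \<delta>) * (norm Y)\<^sup>2"
    using tangent_rip[OF Y(1)] by (auto simp: abs_le_iff algebra_simps)
  moreover have "0 < (1 - \<delta>) * (norm Y)\<^sup>2" using n \<delta> by simp
  ultimately show "1 / (1 + \<delta>) \<le> (norm Y)\<^sup>2 / q Y Y" "(norm Y)\<^sup>2 / q Y Y \<le> 1 / (1 - \<delta>)"
    using \<delta> by (auto simp: field_simps)
qed

text \<open>On the tangent space the compressed sampling operator is \<delta>-close to the identity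
  as a bilinear form. Testing the residual \<open>V\<close> against itself separates the error of
  the step size from that of the isometry; each costs \<delta> / (1 - \<delta>).\<close>

lemma tangent_contraction:
  assumes Y: "Y \<in> tangent d P" and \<alpha>: "1 / (1 + \<delta>) \<le> \<alpha>" "\<alpha> \<le> 1 / (1 - \<delta>)"
  shows "norm (Y - \<alpha> *\<^sub>R PT P (Ast Y)) \<le> 2 * \<delta> / (1 - \<delta>) * norm Y"
proof -
  define V where "V = Y - \<alpha> *\<^sub>R PT P (Ast Y)"
  have V: "V \<in> tangent d P"
    unfolding V_def by (intro tangent_diff Y tangent_scaleR PT_tangent P Ast_herm)
  have "0 < 1 / (1 + \<delta>)" using \<delta> by simp
  then have a0: "0 \<le> \<alpha>" using \<alpha> by linarith
  have "\<delta> / (1 - \<delta>) = 1 / (1 - \<delta>) - 1" using \<delta> by (simp add: field_simps)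
  then have a1: "\<alpha> - 1 \<le> \<delta> / (1 - \<delta>)" using \<alpha> by linarith
  have "1 - 1 / (1 + \<delta>) \<le> \<delta> / (1 - \<delta>)" using \<delta> by (simp add: field_simps)
  then have a2: "1 - \<alpha> \<le> \<delta> / (1 - \<delta>)" using \<alpha> by linarith
  have "\<alpha> * \<delta> \<le> 1 / (1 - \<delta>) * \<delta>" using \<alpha> \<delta> by (intro mult_right_mono) auto
  then have a3: "\<alpha> * \<delta> \<le> \<delta> / (1 - \<delta>)" by simp
  have PV: "PT P V = V" using V by (simp add: tangent_def)
  have "(norm V)\<^sup>2 = inner V Y - \<alpha> * inner V (PT P (Ast Y))"
    unfolding power2_norm_eq_inner by (subst (2) V_def) (simp add: inner_diff_right)
  also have "inner V (PT P (Ast Y)) = q V Y"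
    by (simp add: inner_PT[OF P(1), symmetric] PV inner_sgram)
  also have "inner V Y - \<alpha> * q V Y = (1 - \<alpha>) * inner V Y - \<alpha> * (q V Y - inner V Y)"
    by (simp add: algebra_simps)
  also have "\<dots> \<le> \<bar>1 - \<alpha>\<bar> * \<bar>inner V Y\<bar> + \<alpha> * \<bar>q V Y - inner V Y\<bar>"
  proof -
    have "(1 - \<alpha>) * inner V Y \<le> \<bar>1 - \<alpha>\<bar> * \<bar>inner V Y\<bar>" by (metis abs_ge_self abs_mult)
    moreover have "- (\<alpha> * (q V Y - inner V Y)) \<le> \<alpha> * \<bar>q V Y - inner V Y\<bar>"
      using a0 by (metis abs_ge_minus_self abs_mult abs_of_nonneg)
    ultimately show ?thesis by linarith
  qed
  also have "\<dots> \<le> \<delta> / (1 - \<delta>) * (norm V * norm Y) + \<alpha> * (\<delta> * norm V * norm Y)"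
    using a0 a1 a2 tangent_polarization[OF V Y] Cauchy_Schwarz_ineq2[of V Y]
    by (intro add_mono mult_mono mult_left_mono) auto
  also have "\<dots> \<le> \<delta> / (1 - \<delta>) * (norm V * norm Y) + \<delta> / (1 - \<delta>) * (norm V * norm Y)"
    using mult_right_mono[OF a3, of "norm V * norm Y"] by (simp add: mult.assoc)
  finally have "norm V * norm V \<le> norm V * (2 * \<delta> / (1 - \<delta>) * norm Y)"
    by (simp add: power2_eq_square mult_ac)
  then have "norm V \<le> 2 * \<delta> / (1 - \<delta>) * norm Y"
    using \<delta> by (rule_tac mult_self_le) auto
  then show ?thesis by (simp add: V_def)
qed

lemma norm_PT_Ast_le:
  assumes N: "supp d N" "adj N = N" "nuc_le (2 * sqrt r * norm N) N"
  shows "norm (PT P (Ast N)) \<le> (1 + \<delta>) * norm N"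
proof -
  define V where "V = PT P (Ast N)"
  have V: "V \<in> tangent d P" unfolding V_def by (intro PT_tangent P Ast_herm)
  have PV: "PT P V = V" using V by (simp add: tangent_def)
  have qV: "q V V \<le> (1 + \<delta>) * (norm V)\<^sup>2"
    using tangent_rip[OF V] by (auto simp: abs_le_iff algebra_simps)
  have "\<bar>q N N - (norm N)\<^sup>2\<bar> \<le> \<delta> * (norm N)\<^sup>2" using rip N unfolding rip_def by blast
  then have qN: "q N N \<le> (1 + \<delta>) * (norm N)\<^sup>2" by (auto simp: abs_le_iff algebra_simps)
  have "(norm V)\<^sup>2 = q V N"
    unfolding power2_norm_eq_inner
    by (subst (2) V_def) (simp add: inner_PT[OF P(1), symmetric] PV inner_sgram)
  also have "\<dots> \<le> sqrt (q V V) * sqrt (q N N)" by (rule sform_cauchy[OF a])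
  also have "\<dots> \<le> sqrt ((1 + \<delta>) * (norm V)\<^sup>2) * sqrt ((1 + \<delta>) * (norm N)\<^sup>2)"
    using qV qN \<delta> a sform_nonneg by (intro mult_mono real_sqrt_le_mono) auto
  also have "\<dots> = (1 + \<delta>) * norm V * norm N"
    using \<delta> by (simp add: real_sqrt_mult)
  finally have "norm V * norm V \<le> norm V * ((1 + \<delta>) * norm N)"
    by (simp add: power2_eq_square mult_ac)
  then have "norm V \<le> (1 + \<delta>) * norm N" using \<delta> by (rule_tac mult_self_le) auto
  then show ?thesis by (simp add: V_def)
qed

text \<open>The noise is controlled in spectral norm only. Duality against the projected noise
  itself, a tangent vector, converts this into a Frobenius bound; here sqrt r enters the final
  error.\<close>

lemma norm_PT_opb:
  assumes E: "opb l E"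
  shows "norm (PT P E) \<le> 2 * sqrt r * l"
proof -
  define V where "V = PT P E"
  have PV: "PT P V = V" unfolding V_def by (rule PT_idem[OF P(1)])
  have "(norm V)\<^sup>2 = inner E V"
    unfolding power2_norm_eq_inner by (subst (1) V_def) (simp add: inner_PT[OF P(1)] PV)
  also have "\<dots> \<le> 2 * sqrt r * norm V * l"
    using nuc_le_PT[OF P(1,3) PV] E unfolding nuc_le_def by blast
  finally have "norm V * norm V \<le> norm V * (2 * sqrt r * l)" by (simp add: power2_eq_square mult_ac)
  moreover have "0 \<le> l" "0 \<le> r" using E order_trans[OF zero_le_power2 P(3)] by (auto simp: opb_def)
  ultimately have "norm V \<le> 2 * sqrt r * l" by (rule_tac mult_self_le) auto
  then show ?thesis by (simp add: V_def)
qed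

text \<open>The part of \<open>\<rho>\<close> normal to the tangent space at \<open>X\<close> is \<open>(I-P)(\<rho>-X) \<rho>\<^sup>+ (\<rho>-X)(I-P)\<close>, with
  \<open>\<rho>\<^sup>+\<close> written \<open>R\<close> below, so it is quadratic in \<open>\<rho>-X\<close>.\<close>

lemma gradient_step_error:
  assumes X: "supp d X" "adj X = X" "P * X = X"
    and \<rho>: "supp d \<rho>" "\<rho> = K * adj K" "K * Q = K" "proj Q" "(norm Q)\<^sup>2 \<le> r"
    and R: "\<rho> * R * \<rho> = \<rho>" "opb (1 / s) R" "0 < s"
    and E: "opb l E"
    and \<alpha>: "1 / (1 + \<delta>) \<le> \<alpha>" "\<alpha> \<le> 1 / (1 - \<delta>)"
  shows "norm (X + \<alpha> *\<^sub>R PT P (Ast (\<rho> - X) + E) - \<rho>)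
    \<le> 2 * \<delta> / (1 - \<delta>) * norm (X - \<rho>) + 2 / (1 - \<delta>) * ((norm (X - \<rho>))\<^sup>2 / s) + 2 / (1 - \<delta>) * (sqrt r * l)"
proof -
  define D where "D = \<rho> - X"
  define N where "N = (K - P * K) * adj (K - P * K)"
  have XP: "X * P = X" using X P(1) by (metis adj_mult projD(2))
  have adjR: "adj \<rho> = \<rho>" unfolding \<rho>(2) by simp
  \<comment> \<open>As \<open>P * X = X\<close>, the two-sided complement of \<open>P\<close> sees
    only \<rho> in \<open>D\<close>, and \<rho> is \<open>K * adj K\<close>. So the normal part is a
    Gram matrix, to which \<open>nuc_le_gram\<close> applies.\<close>
  have Neq: "N = D - PT P D"
    unfolding N_def D_def PT_def \<rho>(2) using X XP P(1) by (simp add: projD algebra_simps)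
  have suppN: "supp d N" "adj N = N"
    unfolding Neq using X \<rho>(1) P adjR by (auto simp: D_def adj_PT PT_diff intro!: supp_simps supp_PT)
  have "nuc_le (sqrt r * norm N) N"
    unfolding N_def by (rule nuc_le_gram[OF \<rho>(4,5)]) (simp add: \<rho>(3) algebra_simps)
  moreover have r0: "0 \<le> r" using order_trans[OF zero_le_power2 P(3)] by simp
  then have "sqrt r * norm N * c \<le> 2 * sqrt r * norm N * c" if "0 \<le> c" for c using that by simp
  ultimately have nucN: "nuc_le (2 * sqrt r * norm N) N"
    unfolding nuc_le_def by (meson opb_def order_trans)
  \<comment> \<open>The complement of \<open>P\<close> kills \<open>X\<close>, so both copies of
    \<open>D\<close> may be replaced by \<rho>, and \<open>\<rho> * R * \<rho> = \<rho>\<close>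
    collapses the product to the normal part.\<close>
  have "(D - P * D) * (R * (D - D * P)) = \<rho> * R * \<rho> - P * (\<rho> * R * \<rho>) - (\<rho> * R * \<rho>) * P + P * (\<rho> * R * \<rho>) * P"
    using X XP by (simp add: D_def algebra_simps)
  also have "\<dots> = N" unfolding R(1) Neq using X XP by (simp add: D_def PT_def algebra_simps)
  finally have N2: "N = (D - P * D) * (R * (D - D * P))" by simp
  have "norm N \<le> norm (D - P * D) * norm (R * (D - D * P))" unfolding N2 by (rule norm_mult_ineq)
  also have "\<dots> \<le> norm D * (1 / s * norm D)"
  proof (intro mult_mono norm_compl_le P)
    have "norm (R * (D - D * P)) \<le> 1 / s * norm (D - D * P)" using R(2) by (simp add: opb_def)
    also have "\<dots> \<le> 1 / s * norm D"
      using norm_compl_right_le[OF P(1), of D] R(3) by (intro mult_left_mono) auto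
    finally show "norm (R * (D - D * P)) \<le> 1 / s * norm D" .
  qed auto
  finally have nN: "norm N \<le> (norm D)\<^sup>2 / s" by (simp add: power2_eq_square)
  have "0 < 1 / (1 + \<delta>)" using \<delta> by simp
  then have a0: "0 \<le> \<alpha>" using \<alpha> by linarith
  define Y where "Y = PT P D"
  have Y: "Y \<in> tangent d P"
    unfolding Y_def D_def using X \<rho>(1) adjR by (intro PT_tangent P supp_simps) auto
  have "norm Y \<le> norm D"
  proof -
    have "inner Y Y = inner D Y" unfolding Y_def by (metis PT_idem P(1) inner_PT)
    then have "norm Y * norm Y \<le> norm D * norm Y"
      using norm_cauchy_schwarz[of D Y] by (metis power2_eq_square power2_norm_eq_inner)
    then show ?thesis by (cases "Y = 0") auto
  qed
  note nYD = this
  have DYN: "D = Y + N" by (simp add: Neq Y_def)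
  have "X + \<alpha> *\<^sub>R PT P (Ast D + E) - \<rho>
      = - (Y - \<alpha> *\<^sub>R PT P (Ast Y)) - N + \<alpha> *\<^sub>R PT P (Ast N) + \<alpha> *\<^sub>R PT P E"
  proof -
    have "X - \<rho> = - Y - N" using DYN by (simp add: D_def algebra_simps)
    then show ?thesis
      by (simp add: DYN sgram_add PT_add scaleR_right_distrib algebra_simps)
  qed
  also have "norm \<dots> \<le> norm (Y - \<alpha> *\<^sub>R PT P (Ast Y)) + norm N + \<alpha> * norm (PT P (Ast N)) + \<alpha> * norm (PT P E)"
    using norm_triangle_ineq4[of "- (Y - \<alpha> *\<^sub>R PT P (Ast Y))" N]
      norm_triangle_ineq[of "- (Y - \<alpha> *\<^sub>R PT P (Ast Y)) - N" "\<alpha> *\<^sub>R PT P (Ast N)"]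
      norm_triangle_ineq[of "- (Y - \<alpha> *\<^sub>R PT P (Ast Y)) - N + \<alpha> *\<^sub>R PT P (Ast N)" "\<alpha> *\<^sub>R PT P E"] a0
    by (simp add: norm_minus_commute)
  also have "\<dots> \<le> 2 * \<delta> / (1 - \<delta>) * norm D + norm N + 1 / (1 - \<delta>) * ((1 + \<delta>) * norm N)
      + 1 / (1 - \<delta>) * (2 * sqrt r * l)"
  proof (intro add_mono mult_mono \<alpha> norm_PT_opb E norm_PT_Ast_le suppN nucN order_refl)
    have "norm (Y - \<alpha> *\<^sub>R PT P (Ast Y)) \<le> 2 * \<delta> / (1 - \<delta>) * norm Y"
      by (rule tangent_contraction[OF Y \<alpha>])
    also have "\<dots> \<le> 2 * \<delta> / (1 - \<delta>) * norm D"
      using \<delta> \<open>norm Y \<le> norm D\<close> by (intro mult_left_mono) auto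
    finally show "norm (Y - \<alpha> *\<^sub>R PT P (Ast Y)) \<le> 2 * \<delta> / (1 - \<delta>) * norm D" .
  qed (use \<delta> in auto)
  \<comment> \<open>The two contributions of \<open>N\<close> combine, since 1 + (1 + \<delta>) / (1
    - \<delta>) = 2 / (1 - \<delta>).\<close>
  also have "\<dots> = 2 * \<delta> / (1 - \<delta>) * norm D + 2 / (1 - \<delta>) * norm N + 2 / (1 - \<delta>) * (sqrt r * l)"
    using \<delta> by (simp add: field_simps)
  also have "\<dots> \<le> 2 * \<delta> / (1 - \<delta>) * norm D + 2 / (1 - \<delta>) * ((norm D)\<^sup>2 / s) + 2 / (1 - \<delta>) * (sqrt r * l)"
    using nN \<delta> by (intro add_mono order_refl mult_left_mono) auto
  finally show ?thesis unfolding D_def by (simp add: norm_minus_commute)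
qed

end

text \<open>Expanding the assumed inequality bounds the squared norm of \<open>D\<close> by twice
  its inner product with \<open>A - \<rho>\<close>. Since \<open>D\<close> splits into two pieces of
  rank at most r, only the spectral norm of \<open>A - \<rho>\<close> enters, although its Frobenius
  norm may be far larger.\<close>

lemma best_approx_spectral:
  assumes A: "supp d A" "norm (N - A) \<le> norm (\<rho> - A)" 
    and E: "opb e (A - \<rho>)"
    and P: "proj P" "(norm P)\<^sup>2 \<le> r" "P * N = N"
    and Q: "proj Q" "(norm Q)\<^sup>2 \<le> r" "\<rho> * Q = \<rho>"
  shows "norm (N - \<rho>) \<le> 4 * sqrt r * e"
proof -
  define D where "D = N - \<rho>"
  have "(norm (D - (A - \<rho>)))\<^sup>2 \<le> (norm (A - \<rho>))\<^sup>2"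
    using A(2) by (simp add: D_def norm_minus_commute)
  then have 1: "(norm D)\<^sup>2 \<le> 2 * inner (A - \<rho>) D"
    unfolding power2_norm_eq_inner by (simp add: inner_diff_left inner_diff_right inner_commute)
  have e: "0 \<le> e" using E by (simp add: opb_def)
  have nP: "norm P \<le> sqrt r" "norm Q \<le> sqrt r" using P(2) Q(2) by (auto simp: real_le_rsqrt)
  have r: "0 \<le> r" using order_trans[OF zero_le_power2 P(2)] by simp
  \<comment> \<open>Off the range of \<open>P\<close> only \<rho> survives in \<open>D\<close>, and
    there right multiplication by \<open>Q\<close> changes nothing.\<close>
  have D2: "D = P * D + (D - P * D) * Q"
  proof -
    have "D - P * D = - (\<rho> - P * \<rho>)" using P(3) by (simp add: D_def algebra_simps)
    then have "(D - P * D) * Q = D - P * D" by (simp only: minus_mult_left[symmetric] left_diff_distrib mult.assoc Q(3))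
    then show ?thesis by simp
  qed
  have a: "inner (A - \<rho>) (P * D) \<le> e * norm P * norm (P * D)" by (rule inner_proj_le[OF P(1) E])
  also have "\<dots> \<le> e * sqrt r * norm D"
    using e nP norm_proj_le(1)[OF P(1), of D] r by (intro mult_mono) auto
  finally have a: "inner (A - \<rho>) (P * D) \<le> e * sqrt r * norm D" .
  have "inner (A - \<rho>) ((D - P * D) * Q) = inner (adj (A - \<rho>)) (Q * adj (D - P * D))"
    using Q(1) by (metis adj_mult inner_adj_adj projD(2))
  also have "\<dots> \<le> e * norm Q * norm (Q * adj (D - P * D))"
    by (rule inner_proj_le[OF Q(1) opb_adj[OF E]])
  also have "\<dots> \<le> e * sqrt r * norm D"
  proof -
    have "norm (Q * adj (D - P * D)) \<le> norm (adj (D - P * D))" by (rule norm_proj_le(1)[OF Q(1)])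
    also have "\<dots> \<le> norm D" using norm_compl_le[OF P(1), of D] by (metis norm_adj)
    finally show ?thesis using e nP r by (intro mult_mono) auto
  qed
  finally have b: "inner (A - \<rho>) ((D - P * D) * Q) \<le> e * sqrt r * norm D" .
  have "inner (A - \<rho>) D = inner (A - \<rho>) (P * D) + inner (A - \<rho>) ((D - P * D) * Q)"
    by (subst D2) (rule inner_add_right)
  then have "(norm D)\<^sup>2 \<le> norm D * (4 * sqrt r * e)" using 1 a b by (simp add: mult_ac)
  then show ?thesis unfolding D_def[symmetric] using e r
    by (rule_tac mult_self_le) (auto simp: power2_eq_square)
qed

section \<open>Embedding matrices of all shapes\<close>

definition fmat_of :: "complex mat \<Rightarrow> fmat" where
  "fmat_of A = mkfm (max (dim_row A) (dim_col A))
     (\<lambda>i j. if i < dim_row A \<and> j < dim_col A then A $$ (i, j) else 0)"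

lemma ent_emb: "ent (fmat_of A) i j = (if i < dim_row A \<and> j < dim_col A then A $$ (i, j) else 0)"
  by (auto simp: fmat_of_def ent_mkfm)

lemma supp_emb: "A \<in> carrier_mat d d \<Longrightarrow> supp d (fmat_of A)"
  by (auto simp: supp_def ent_emb)

lemma emb_inject: "A \<in> carrier_mat n m \<Longrightarrow> B \<in> carrier_mat n m \<Longrightarrow> fmat_of A = fmat_of B \<Longrightarrow> A = B"
proof (rule eq_matI)
  fix i j assume "A \<in> carrier_mat n m" "B \<in> carrier_mat n m" "fmat_of A = fmat_of B" "i < dim_row B" "j < dim_col B"
  then have "ent (fmat_of A) i j = ent (fmat_of B) i j" by simp
  then show "A $$ (i, j) = B $$ (i, j)" using \<open>A \<in> _\<close> \<open>B \<in> _\<close> \<open>i < _\<close> \<open>j < _\<close> by (simp add: ent_emb)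
qed auto

lemma ent_mult_cols:
  assumes "\<And>j. N \<le> j \<Longrightarrow> ent A i j = 0"
  shows "ent (A * B) i k = (\<Sum>j<N. ent A i j * ent B j k)"
proof -
  have "ent (A * B) i k = (\<Sum>j<bd A. ent A i j * ent B j k)"
    by (rule ent_mult) (simp add: supp_bd)
  also have "\<dots> = (\<Sum>j<N. ent A i j * ent B j k)"
    by (rule sum_lessThan_extend) (use assms suppD[OF supp_bd] in auto)
  finally show ?thesis .
qed

lemma emb_mult: "dim_col A = dim_row B \<Longrightarrow> fmat_of (A * B) = fmat_of A * fmat_of B"
proof (rule fmat_eqI)
  fix i k assume d: "dim_col A = dim_row B"
  have "ent (fmat_of A * fmat_of B) i k = (\<Sum>j<dim_col A. ent (fmat_of A) i j * ent (fmat_of B) j k)"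
    by (rule ent_mult_cols) (simp add: ent_emb)
  also have "\<dots> = ent (fmat_of (A * B)) i k"
    using d by (auto simp: ent_emb scalar_prod_def atLeast0LessThan intro!: sum.cong)
  finally show "ent (fmat_of (A * B)) i k = ent (fmat_of A * fmat_of B) i k" by simp
qed

lemma emb_add: "A \<in> carrier_mat n m \<Longrightarrow> B \<in> carrier_mat n m \<Longrightarrow> fmat_of (A + B) = fmat_of A + fmat_of B"
  and emb_diff: "A \<in> carrier_mat n m \<Longrightarrow> B \<in> carrier_mat n m \<Longrightarrow> fmat_of (A - B) = fmat_of A - fmat_of B"
  and emb_smult: "fmat_of (complex_of_real c \<cdot>\<^sub>m A) = c *\<^sub>R fmat_of A"
  and emb_one: "fmat_of (1\<^sub>m n) = idm n"
  by (auto intro!: fmat_eqI simp: ent_emb ent_idm scaleR_conv_of_real)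

lemma mat_adjoint_dim [simp]: "dim_row (mat_adjoint A) = dim_col A" "dim_col (mat_adjoint A) = dim_row A"
  by (auto simp: mat_adjoint_def)

lemma mat_adjoint_index:
  "i < dim_col A \<Longrightarrow> j < dim_row A \<Longrightarrow> mat_adjoint A $$ (i, j) = conjugate (A $$ (j, i))"
  by (simp add: mat_adjoint_def mat_of_rows_index)

lemma emb_adjoint: "fmat_of (mat_adjoint A) = adj (fmat_of A)"
  by (auto intro!: fmat_eqI simp: ent_emb ent_adj mat_adjoint_index)

lemma mat_adjoint_carrier [intro]: "A \<in> carrier_mat n m \<Longrightarrow> mat_adjoint A \<in> carrier_mat m n"
  by auto

lemma hermitian_mat_emb: "hermitian_mat d A \<Longrightarrow> supp d (fmat_of A)" "hermitian_mat d A \<Longrightarrow> adj (fmat_of A) = fmat_of A"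
  by (auto simp: hermitian_mat_def emb_adjoint[symmetric] supp_emb)

lemma frob_norm_emb: "frob_norm A = norm (fmat_of A)"
proof -
  let ?N = "max (dim_row A) (dim_col A)"
  have "(norm (fmat_of A))\<^sup>2 = (\<Sum>i<?N. \<Sum>j<?N. (cmod (ent (fmat_of A) i j))\<^sup>2)"
    by (rule norm_fmat_sq) (auto simp: supp_def ent_emb)
  also have "\<dots> = (\<Sum>(i, j)\<in>{..<?N} \<times> {..<?N}. (cmod (ent (fmat_of A) i j))\<^sup>2)"
    by (rule sum.cartesian_product)
  also have "\<dots> = (\<Sum>ij\<in>{..<dim_row A} \<times> {..<dim_col A}. (cmod (A $$ ij))\<^sup>2)"
    by (rule sum.mono_neutral_cong_right) (auto simp: ent_emb split: if_splits)
  finally show ?thesis unfolding frob_norm_def L2_set_def by (metis norm_ge_zero real_sqrt_unique)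
qed

lemma inner_emb_trace:
  assumes "hermitian_mat d S" "X \<in> carrier_mat d d"
  shows "Re (mat_trace (S * X)) = inner (fmat_of S) (fmat_of X)"
proof -
  have S: "S \<in> carrier_mat d d" "mat_adjoint S = S" using assms by (auto simp: hermitian_mat_def)
  have e: "S $$ (i, j) = cnj (S $$ (j, i))" if "i < d" "j < d" for i j
    using mat_adjoint_index[of i S j] S that by auto
  have "mat_trace (S * X) = (\<Sum>i<d. \<Sum>j<d. S $$ (i, j) * X $$ (j, i))"
    using assms S by (auto simp: mat_trace_def scalar_prod_def atLeast0LessThan intro!: sum.cong)
  also have "\<dots> = (\<Sum>j<d. \<Sum>i<d. S $$ (i, j) * X $$ (j, i))" by (rule sum.swap)
  also have "\<dots> = (\<Sum>i<d. \<Sum>j<d. cnj (ent (fmat_of S) i j) * ent (fmat_of X) i j)"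
  proof (intro sum.cong refl)
    fix j i assume "j \<in> {..<d}" "i \<in> {..<d}"
    then show "S $$ (i, j) * X $$ (j, i) = cnj (ent (fmat_of S) j i) * ent (fmat_of X) j i"
      using assms S(1) by (subst e) (auto simp: ent_emb)
  qed
  finally show ?thesis using inner_fmat_Re[of d "fmat_of S" "fmat_of X"] supp_emb[OF S(1)] by simp
qed

section \<open>Spectral calculus\<close>

definition diagf :: "nat \<Rightarrow> (nat \<Rightarrow> real) \<Rightarrow> fmat" where
  "diagf d l = mkfm d (\<lambda>i j. if i = j then complex_of_real (l i) else 0)"

lemma ent_diagf: "ent (diagf d l) i j = (if i = j \<and> i < d then complex_of_real (l i) else 0)"
  by (auto simp: diagf_def ent_mkfm)

lemma supp_diagf [simp]: "supp d (diagf d l)" by (simp add: diagf_def)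

lemma adj_diagf [simp]: "adj (diagf d l) = diagf d l"
  by (auto intro!: fmat_eqI simp: ent_adj ent_diagf)

lemma diagf_one: "diagf d (\<lambda>_. 1) = idm d"
  by (auto intro!: fmat_eqI simp: ent_idm ent_diagf)

lemma emb_mat_diag: "fmat_of (mat_diag d (\<lambda>i. complex_of_real (l i))) = diagf d l"
  by (auto intro!: fmat_eqI simp: ent_emb ent_diagf mat_diag_def)

lemma ent_diagf_mult: "ent (diagf d l * Y) i k = (if i < d then l i *\<^sub>R ent Y i k else 0)"
proof -
  have "ent (diagf d l * Y) i k = (\<Sum>j<d. ent (diagf d l) i j * ent Y j k)"
    by (rule ent_mult) simp
  also have "\<dots> = (\<Sum>j<d. if i = j then l i *\<^sub>R ent Y i k else 0)"
    by (rule sum.cong) (auto simp: ent_diagf scaleR_conv_of_real)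
  also have "\<dots> = (if i < d then l i *\<^sub>R ent Y i k else 0)" by simp
  finally show ?thesis .
qed

lemma ent_mult_diagf: "ent (Y * diagf d l) i k = (if k < d then l k *\<^sub>R ent Y i k else 0)"
proof -
  have "ent (adj (diagf d l * adj Y)) i k = (if k < d then l k *\<^sub>R ent Y i k else 0)"
    unfolding ent_adj by (simp add: ent_diagf_mult ent_adj)
  then show ?thesis by simp
qed

lemma diagf_mult: "diagf d a * diagf d b = diagf d (\<lambda>i. a i * b i)"
  by (auto intro!: fmat_eqI simp: ent_diagf_mult ent_diagf scaleR_conv_of_real)

lemma diagf_diff: "diagf d a - diagf d b = diagf d (\<lambda>i. a i - b i)"
  by (auto intro!: fmat_eqI simp: ent_diagf)

lemma diagf_cong: "(\<And>i. i < d \<Longrightarrow> a i = b i) \<Longrightarrow> diagf d a = diagf d b"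
  by (auto intro!: fmat_eqI simp: ent_diagf)

definition colsq :: "fmat \<Rightarrow> nat \<Rightarrow> real" where "colsq A k = (\<Sum>i<bd A. (cmod (ent A i k))\<^sup>2)"

lemma colsq_nonneg: "0 \<le> colsq A k" by (simp add: colsq_def sum_nonneg)

lemma norm_mult_diagf: "(norm (A * diagf d l))\<^sup>2 = (\<Sum>k<d. (l k)\<^sup>2 * colsq A k)"
proof -
  define N where "N = max d (bd A)"
  have s: "supp N A" "supp N (diagf d l)"
    using supp_mono[OF supp_bd] supp_mono[OF supp_diagf] by (auto simp: N_def)
  have "(norm (A * diagf d l))\<^sup>2 = (\<Sum>i<N. \<Sum>k<N. (cmod (ent (A * diagf d l) i k))\<^sup>2)"
    by (rule norm_fmat_sq[OF supp_mult[OF s]])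
  also have "\<dots> = (\<Sum>i<N. \<Sum>k<N. if k < d then (l k)\<^sup>2 * (cmod (ent A i k))\<^sup>2 else 0)"
    by (intro sum.cong refl) (simp add: ent_mult_diagf power_mult_distrib)
  also have "\<dots> = (\<Sum>k<N. \<Sum>i<N. if k < d then (l k)\<^sup>2 * (cmod (ent A i k))\<^sup>2 else 0)"
    by (rule sum.swap)
  also have "\<dots> = (\<Sum>k<d. \<Sum>i<N. (l k)\<^sup>2 * (cmod (ent A i k))\<^sup>2)"
    by (rule sum.mono_neutral_cong_right) (auto simp: N_def)
  also have "\<dots> = (\<Sum>k<d. (l k)\<^sup>2 * colsq A k)"
  proof (rule sum.cong[OF refl])
    fix k
    have "(\<Sum>i<N. (cmod (ent A i k))\<^sup>2) = colsq A k"
      unfolding colsq_def by (rule sum_lessThan_extend) (use suppD[OF s(1)] suppD[OF supp_bd] in auto)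
    then show "(\<Sum>i<N. (l k)\<^sup>2 * (cmod (ent A i k))\<^sup>2) = (l k)\<^sup>2 * colsq A k"
      by (simp add: sum_distrib_left[symmetric])
  qed
  finally show ?thesis .
qed

lemma colsq_diag: "k < d \<Longrightarrow> colsq A k = (norm (A * diagf d (\<lambda>i. if i = k then 1 else 0)))\<^sup>2"
proof -
  assume k: "k < d"
  have "(\<Sum>i<d. (if i = k then 1 else 0)\<^sup>2 * colsq A i) = (\<Sum>i<d. if i = k then colsq A i else 0)"
    by (rule sum.cong) auto
  then show ?thesis using k by (simp add: norm_mult_diagf)
qed

lemma norm_diagf: "(norm (diagf d l))\<^sup>2 = (\<Sum>k<d. (l k)\<^sup>2)"
proof -
  have "(norm (diagf d l))\<^sup>2 = (\<Sum>i<d. \<Sum>j<d. (cmod (ent (diagf d l) i j))\<^sup>2)"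
    by (rule norm_fmat_sq) simp
  also have "\<dots> = (\<Sum>i<d. \<Sum>j<d. if i = j then (l i)\<^sup>2 else 0)"
    by (intro sum.cong refl) (auto simp: ent_diagf)
  finally show ?thesis by simp
qed

lemma opb_diagf:
  assumes "0 \<le> c" "\<And>i. i < d \<Longrightarrow> \<bar>l i\<bar> \<le> c" shows "opb c (diagf d l)"
  unfolding opb_def
proof safe
  fix Y
  have "(norm (adj Y * diagf d l))\<^sup>2 \<le> (\<Sum>k<d. c\<^sup>2 * colsq (adj Y) k)"
    unfolding norm_mult_diagf
    by (intro sum_mono mult_right_mono colsq_nonneg) (use assms in \<open>auto simp: abs_le_square_iff[symmetric]\<close>)
  also have "\<dots> = c\<^sup>2 * (norm (adj Y * idm d))\<^sup>2"
    by (simp add: norm_mult_diagf diagf_one[symmetric] sum_distrib_left)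
  also have "\<dots> \<le> c\<^sup>2 * (norm (adj Y))\<^sup>2"
  proof -
    have "proj (idm d)" by (simp add: proj_def idm_mult ent_idm)
    then show ?thesis by (intro mult_left_mono power_mono norm_proj_le) auto
  qed
  finally have "(norm (adj Y * diagf d l))\<^sup>2 \<le> (c * norm Y)\<^sup>2" by (simp add: power_mult_distrib)
  then have "norm (adj Y * diagf d l) \<le> c * norm Y" by (rule power2_le_imp_le) (use assms in simp)
  moreover have "norm (adj Y * diagf d l) = norm (diagf d l * Y)" by (metis adj_diagf adj_mult norm_adj)
  ultimately show "norm (diagf d l * Y) \<le> c * norm Y" by simp
qed (use assms in auto)

definition unitary :: "nat \<Rightarrow> fmat \<Rightarrow> bool" where
  "unitary d U \<longleftrightarrow> supp d U \<and> adj U * U = idm d \<and> U * adj U = idm d"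

definition spec :: "nat \<Rightarrow> fmat \<Rightarrow> (nat \<Rightarrow> real) \<Rightarrow> fmat" where
  "spec d U l = U * diagf d l * adj U"

context
  fixes d U
  assumes U: "unitary d U"
begin

lemma unitary_opb: "opb 1 U" "opb 1 (adj U)"
proof -
  have "proj (idm d)" by (simp add: proj_def idm_mult ent_idm)
  have "norm (U * Y) \<le> 1 * norm Y" for Y
  proof -
    have "(norm (U * Y))\<^sup>2 = inner Y (idm d * Y)"
      using U by (simp add: power2_norm_eq_inner inner_mult_left unitary_def mult.assoc[symmetric])
    also have "\<dots> \<le> norm Y * norm (idm d * Y)" by (rule norm_cauchy_schwarz)
    also have "\<dots> \<le> norm Y * norm Y" by (intro mult_left_mono norm_proj_le \<open>proj (idm d)\<close>) auto
    finally show ?thesis by (simp add: power2_eq_square[symmetric])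
  qed
  then show "opb 1 U" by (simp add: opb_def)
  then show "opb 1 (adj U)" by (rule opb_adj)
qed

lemma norm_unitary_le: "norm (U * Y) \<le> norm Y" "norm (adj U * Y) \<le> norm Y"
  "norm (Y * U) \<le> norm Y" "norm (Y * adj U) \<le> norm Y"
  using unitary_opb opb_right[OF unitary_opb(1)] opb_right[OF unitary_opb(2)] by (auto simp: opb_def)

lemma unitary_cancel: "adj U * (U * Y) = idm d * Y"
  using U by (simp add: unitary_def mult.assoc[symmetric])

lemma idm_diagf [simp]: "idm d * diagf d l = diagf d l" "diagf d l * idm d = diagf d l"
  "idm d * (diagf d l * Y) = diagf d l * Y"
  by (auto simp: diagf_one[symmetric] diagf_mult mult.assoc[symmetric])

lemma spec_mult: "spec d U a * spec d U b = spec d U (\<lambda>i. a i * b i)"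
  by (simp add: spec_def mult.assoc unitary_cancel diagf_mult[of d a b, symmetric])

lemma adj_spec [simp]: "adj (spec d U a) = spec d U a"
  by (simp add: spec_def mult.assoc)

lemma supp_spec [simp]: "supp d (spec d U a)"
  using U unfolding spec_def unitary_def by (intro supp_mult) auto

lemma spec_diff: "spec d U a - spec d U b = spec d U (\<lambda>i. a i - b i)"
  unfolding spec_def diagf_diff[of d a b, symmetric] by (simp add: algebra_simps)

lemma spec_cong: "(\<And>i. i < d \<Longrightarrow> a i = b i) \<Longrightarrow> spec d U a = spec d U b"
  using diagf_cong[of d a b] by (simp add: spec_def)

lemma norm_spec: "(norm (spec d U a))\<^sup>2 = (\<Sum>k<d. (a k)\<^sup>2)"
proof -
  have "norm (spec d U a) \<le> norm (diagf d a)"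
    unfolding spec_def using norm_unitary_le(4)[of "U * diagf d a"] norm_unitary_le(1)[of "diagf d a"] by linarith
  moreover have "adj U * spec d U a * U = diagf d a"
    using U by (simp add: spec_def mult.assoc unitary_cancel) (simp add: unitary_def)
  then have "norm (diagf d a) = norm (adj U * spec d U a * U)" by simp
  then have "norm (diagf d a) \<le> norm (spec d U a)"
    using norm_unitary_le(3)[of "adj U * spec d U a"] norm_unitary_le(2)[of "spec d U a"] by linarith
  ultimately show ?thesis using norm_diagf[of d a] by simp
qed

lemma opb_spec:
  assumes "0 \<le> c" "\<And>i. i < d \<Longrightarrow> \<bar>a i\<bar> \<le> c" shows "opb c (spec d U a)"
  unfolding opb_def
proof safe
  fix Y
  have "norm (spec d U a * Y) \<le> norm (diagf d a * (adj U * Y))"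
    unfolding spec_def mult.assoc by (rule norm_unitary_le)
  also have "\<dots> \<le> c * norm (adj U * Y)" using opb_diagf[OF assms] by (simp add: opb_def)
  also have "\<dots> \<le> c * norm Y" using assms(1) norm_unitary_le by (intro mult_left_mono) auto
  finally show "norm (spec d U a * Y) \<le> c * norm Y" .
qed (use assms in auto)

lemma proj_spec: "proj (spec d U (\<lambda>i. if p i then 1 else 0))"
  unfolding proj_def by (auto simp: spec_mult intro: spec_cong)

lemma norm_proj_spec: "(norm (spec d U (\<lambda>i. if p i then 1 else 0)))\<^sup>2 = real (card {i. i < d \<and> p i})"
proof -
  have "(norm (spec d U (\<lambda>i. if p i then 1 else 0)))\<^sup>2 = (\<Sum>i<d. if p i then 1 else 0)"
    unfolding norm_spec by (rule sum.cong) auto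
  then show ?thesis by (simp add: sum.If_cases Int_def)
qed

text \<open>Let \<open>q k\<close> be the squared length of \<open>Q\<close> applied to the k-th
  eigenvector. These weights lie in [0,1] and sum to at most r, so \<open>Q\<close> captures no more
  energy of the matrix than its r largest squared eigenvalues. What \<open>Q\<close> misses cannot
  be reduced by any \<rho> that \<open>Q\<close> fixes.\<close>

lemma eckart_young:
  assumes l: "\<And>i j. i \<le> j \<Longrightarrow> j < d \<Longrightarrow> \<bar>l j\<bar> \<le> \<bar>l i\<bar>"
    and Q: "proj Q" "(norm Q)\<^sup>2 \<le> real r" "Q * \<rho> = \<rho>"
  shows "norm (spec d U (\<lambda>i. if i < r then l i else 0) - spec d U l) \<le> norm (\<rho> - spec d U l)"
proof -
  define q where "q k = colsq (Q * U) k" for k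
  have q1: "q k \<le> 1" if "k < d" for k
  proof -
    have "q k = (norm (Q * (U * diagf d (\<lambda>i. if i = k then 1 else 0))))\<^sup>2"
      unfolding q_def colsq_diag[OF that] by (simp add: mult.assoc)
    also have "\<dots> \<le> (norm (diagf d (\<lambda>i. if i = k then 1 else 0)))\<^sup>2"
      using norm_proj_le(1)[OF Q(1)] norm_unitary_le(1) by (meson norm_ge_zero order_trans power_mono)
    also have "\<dots> = (\<Sum>i<d. if i = k then 1 else 0)" unfolding norm_diagf by (rule sum.cong) auto
    finally show ?thesis using that by simp
  qed
  have q0: "0 \<le> q k" for k by (simp add: q_def colsq_nonneg)
  have "(\<Sum>k<d. q k) = (norm (Q * U * diagf d (\<lambda>_. 1)))\<^sup>2" by (simp add: norm_mult_diagf q_def)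
  also have "\<dots> \<le> (norm Q)\<^sup>2"
  proof -
    have "proj (idm d)" by (simp add: proj_def idm_mult ent_idm)
    then have "norm (Q * U * idm d) \<le> norm Q"
      using norm_proj_le(2) norm_unitary_le(3) order_trans by blast
    then show ?thesis by (simp add: diagf_one power_mono)
  qed
  finally have qs: "(\<Sum>k<d. q k) \<le> r" using Q(2) by simp
  have key: "(\<Sum>k<d. (l k)\<^sup>2 * q k) \<le> (\<Sum>k<d. if k < r then (l k)\<^sup>2 else 0)"
  proof (cases "r < d")
    case False
    then have "(\<Sum>k<d. (l k)\<^sup>2 * q k) \<le> (\<Sum>k<d. (l k)\<^sup>2)"
      by (intro sum_mono) (use q0 q1 mult_left_mono[of _ 1] in fastforce)
    also have "\<dots> = (\<Sum>k<d. if k < r then (l k)\<^sup>2 else 0)" using False by (intro sum.cong) auto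
    finally show ?thesis .
  next
    case True
    \<comment> \<open>The first discarded square serves as threshold. After subtracting it the
      comparison is termwise: kept terms are nonnegative and largest at \<open>q k = 1\<close>, the
      others nonpositive and largest at \<open>q k = 0\<close>.\<close>
    define t where "t = (l r)\<^sup>2"
    have "((l k)\<^sup>2 - t) * q k \<le> (if k < r then (l k)\<^sup>2 - t else 0)" if "k < d" for k
    proof (cases "k < r")
      case k: True
      then have "t \<le> (l k)\<^sup>2" unfolding t_def using l[of k r] True by (simp add: abs_le_square_iff)
      then show ?thesis using k q1[OF that] mult_left_mono[of "q k" 1 "(l k)\<^sup>2 - t"] by simp
    next
      case k: False
      then have "(l k)\<^sup>2 \<le> t" unfolding t_def using l[of r k] that by (simp add: abs_le_square_iff)
      then show ?thesis using k q0[of k] by (simp add: mult_nonpos_nonneg)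
    qed
    then have "(\<Sum>k<d. ((l k)\<^sup>2 - t) * q k) \<le> (\<Sum>k<d. if k < r then (l k)\<^sup>2 - t else 0)"
      by (intro sum_mono) auto
    moreover have "(\<Sum>k<d. if k < r then (l k)\<^sup>2 - t else 0)
        = (\<Sum>k<d. if k < r then (l k)\<^sup>2 else 0) - (\<Sum>k<d. if k < r then t else 0)"
      unfolding sum_subtractf[symmetric] by (rule sum.cong) auto
    moreover have "(\<Sum>k<d. if k < r then t else 0) = r * t"
    proof -
      have "{..<d} \<inter> {k. k < r} = {..<r}" using True by auto
      then show ?thesis by (simp add: sum.If_cases)
    qed
    moreover have "(\<Sum>k<d. ((l k)\<^sup>2 - t) * q k) = (\<Sum>k<d. (l k)\<^sup>2 * q k) - t * (\<Sum>k<d. q k)"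
      by (simp add: algebra_simps sum_subtractf sum_distrib_left)
    moreover have "t * (\<Sum>k<d. q k) \<le> t * r" using qs by (intro mult_left_mono) (auto simp: t_def)
    ultimately show ?thesis by (simp add: mult.commute)
  qed
  let ?M = "spec d U l"
  have "(norm (Q * ?M))\<^sup>2 \<le> (norm (Q * U * diagf d l))\<^sup>2"
    unfolding spec_def using norm_unitary_le(4)[of "Q * U * diagf d l"] by (simp add: mult.assoc power_mono)
  also have "\<dots> \<le> (\<Sum>k<d. if k < r then (l k)\<^sup>2 else 0)"
    using key by (simp add: norm_mult_diagf q_def)
  finally have 1: "(norm (Q * ?M))\<^sup>2 \<le> (\<Sum>k<d. if k < r then (l k)\<^sup>2 else 0)" .
  have "(norm (spec d U (\<lambda>i. if i < r then l i else 0) - ?M))\<^sup>2 = (\<Sum>k<d. (l k)\<^sup>2 - (if k < r then (l k)\<^sup>2 else 0))"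
    unfolding spec_diff norm_spec by (rule sum.cong) auto
  also have "\<dots> = (norm ?M)\<^sup>2 - (\<Sum>k<d. if k < r then (l k)\<^sup>2 else 0)"
    by (simp add: sum_subtractf norm_spec)
  also have "\<dots> \<le> (norm ?M)\<^sup>2 - (norm (Q * ?M))\<^sup>2" using 1 by simp
  also have "\<dots> = (norm (?M - Q * ?M))\<^sup>2" using proj_pythagoras[OF Q(1), of ?M] by simp
  also have "norm (?M - Q * ?M) = norm ((\<rho> - ?M) - Q * (\<rho> - ?M))"
    using Q(3) by (simp add: right_diff_distrib norm_minus_commute)
  also have "(\<dots>)\<^sup>2 \<le> (norm (\<rho> - ?M))\<^sup>2" by (intro power_mono norm_compl_le Q) auto
  finally show ?thesis by (rule power2_le_imp_le) simp
qed

end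

text \<open>\<open>U\<close> is recovered as \<open>X * V * D\<close>, and by Hermitian symmetry
  \<open>V\<close> as \<open>X * U * D\<close>, so each range projection fixes the other factor and
  the two agree. For the same reason a projection \<open>P\<^sub>0\<close> fixing \<open>X\<close>
  dominates \<open>U * adj U\<close>; hence any decomposition the algorithm picks gives a projection
  of no larger rank.\<close>

lemma svd_projections:
  assumes X: "X = U * diagf s l * adj V" "adj X = X" and l: "\<And>i. i < s \<Longrightarrow> l i \<noteq> 0"
    and U: "adj U * U = idm s" "U * idm s = U" and V: "adj V * V = idm s" "V * idm s = V"
    and P: "proj P\<^sub>0" "P\<^sub>0 * X = X"
  shows "V * adj V = U * adj U" "proj (U * adj U)" "U * adj U * X = X" "norm (U * adj U) \<le> norm P\<^sub>0"
proof -
  define D where "D = diagf s (\<lambda>i. 1 / l i)"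
  have dd: "diagf s l * D = idm s"
    unfolding D_def diagf_mult diagf_one[symmetric] using l by (intro diagf_cong) auto
  have i1: "adj U * (U * Y) = idm s * Y" "adj V * (V * Y) = idm s * Y" for Y
    using U V by (simp_all add: mult.assoc[symmetric])
  have i2: "idm s * (diagf s l * Y) = diagf s l * Y" "diagf s l * (D * Y) = idm s * Y" "idm s * D = D" for Y
    using dd by (simp_all add: mult.assoc[symmetric] diagf_one[symmetric] diagf_mult D_def)
  have i3: "idm s * adj U = adj U" "idm s * adj V = adj V" using U V by (metis adj_idm adj_mult)+
  have i4: "idm s * (adj U * Y) = adj U * Y" "idm s * (adj V * Y) = adj V * Y" for Y
    using i3 by (simp_all add: mult.assoc[symmetric])
  have X': "X = V * diagf s l * adj U" using X by (metis adj_diagf adj_mult adj_simps(1) mult.assoc)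
  have XV: "X * V * D = U" using U V dd by (simp add: X(1) mult.assoc i2)
  have XU: "X * U * D = V" using U V dd by (subst X') (simp add: mult.assoc i2)
  show P1: "proj (U * adj U)" by (simp add: proj_def mult.assoc i1 i3 i4)
  have P2: "proj (V * adj V)" by (simp add: proj_def mult.assoc i1 i3 i4)
  show PX: "U * adj U * X = X" by (simp add: X(1) mult.assoc i1 i2)
  have PVX: "V * adj V * X = X" by (subst (1 2) X') (simp add: mult.assoc i1 i2)
  have "V * adj V * U = U" using PVX by (metis XV mult.assoc)
  then have a: "V * adj V * (U * adj U) = U * adj U" by (simp add: mult.assoc[symmetric])
  have "U * adj U * V = V" using PX by (metis XU mult.assoc)
  then have b: "U * adj U * (V * adj V) = V * adj V" by (simp add: mult.assoc[symmetric])
  from a have "adj (V * adj V * (U * adj U)) = U * adj U" using P1 by (simp add: projD)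
  then show "V * adj V = U * adj U" using b by (simp add: mult.assoc)
  have "P\<^sub>0 * U = U" using P(2) by (metis XV mult.assoc)
  then have "P\<^sub>0 * (U * adj U) = U * adj U" by (simp add: mult.assoc[symmetric])
  then have "adj (P\<^sub>0 * (U * adj U)) = U * adj U" by simp
  then have "U * adj U * P\<^sub>0 = U * adj U" using P(1) by (simp add: projD mult.assoc)
  then show "norm (U * adj U) \<le> norm P\<^sub>0" using norm_proj_le(1)[OF P1, of P\<^sub>0] by simp
qed

lemma mat_diag_dims [simp]: "dim_row (mat_diag n f) = n" "dim_col (mat_diag n f) = n"
  by (simp_all add: mat_diag_def)

section \<open>The spectral theorem\<close>

text \<open>The direct sum of a 1 x 1 block and \<open>B\<close>, the shape reached after splitting
  off one eigenvector.\<close>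

definition bordered :: "complex \<Rightarrow> nat \<Rightarrow> fmat \<Rightarrow> fmat" where
  "bordered c n B = mkfm (Suc n) (\<lambda>i j. if i = 0 \<and> j = 0 then c else if i = 0 \<or> j = 0 then 0 else ent B (i - 1) (j - 1))"

lemma ent_bordered:
  "ent (bordered c n B) i j = (if i < Suc n \<and> j < Suc n then
     (if i = 0 \<and> j = 0 then c else if i = 0 \<or> j = 0 then 0 else ent B (i - 1) (j - 1)) else 0)"
  by (simp add: bordered_def ent_mkfm)

lemma supp_bordered [simp]: "supp (Suc n) (bordered c n B)"
  by (simp add: bordered_def)

lemma bordered_mult:
  assumes "supp n A \<or> supp n B"
  shows "bordered c n A * bordered c' n B = bordered (c * c') n (A * B)"
proof (rule fmat_eqI)
  fix i k
  have "ent (bordered c n A * bordered c' n B) i k = (\<Sum>j<Suc n. ent (bordered c n A) i j * ent (bordered c' n B) j k)"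
    by (rule ent_mult) simp
  also have "\<dots> = ent (bordered c n A) i 0 * ent (bordered c' n B) 0 k
      + (\<Sum>j<n. ent (bordered c n A) i (Suc j) * ent (bordered c' n B) (Suc j) k)"
    by (rule sum.lessThan_Suc_shift)
  also have "\<dots> = ent (bordered (c * c') n (A * B)) i k"
    by (auto simp: ent_bordered ent_mult[OF assms] intro!: sum.cong)
  finally show "ent (bordered c n A * bordered c' n B) i k = ent (bordered (c * c') n (A * B)) i k" .
qed

lemma adj_bordered: "adj (bordered c n A) = bordered (cnj c) n (adj A)"
  by (auto intro!: fmat_eqI simp: ent_adj ent_bordered)

lemma bordered_idm: "bordered 1 n (idm n) = idm (Suc n)"
  by (auto intro!: fmat_eqI simp: ent_bordered ent_idm)

lemma bordered_diagf: "bordered (complex_of_real e) n (diagf n l) = diagf (Suc n) (case_nat e l)"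
  by (auto intro!: fmat_eqI simp: ent_bordered ent_diagf split: nat.splits)

text \<open>Gram--Schmidt, started at an eigenvector, gives the unitary for one deflation step.\<close>

lemma deflation_step:
  assumes A: "supp (Suc n) A" "adj A = A"
  obtains W e B where "unitary (Suc n) W" "supp n B" "adj B = B"
    "A = W * bordered (complex_of_real e) n B * adj W"
proof -
  let ?n = "Suc n"
  define M where "M = mat ?n ?n (\<lambda>(i, j). ent A i j)"
  have M: "M \<in> carrier_mat ?n ?n" by (simp add: M_def)
  have embM: "fmat_of M = A"
    using suppD[OF A(1)] by (auto intro!: fmat_eqI simp: ent_emb M_def not_less)
  have "degree (char_poly M) = ?n" using degree_monic_char_poly[OF M] by simp
  then have "\<not> constant (poly (char_poly M))" by (simp add: constant_degree)
  then obtain e where "poly (char_poly M) e = 0" using fundamental_theorem_of_algebra by blast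
  then have "eigenvalue M e" using eigenvalue_root_char_poly[OF M] by simp
  from find_eigenvector[OF M this] obtain v where "eigenvector M v e" by blast
  then have v: "v \<in> carrier_vec ?n" "v \<noteq> 0\<^sub>v ?n" "M *\<^sub>v v = e \<cdot>\<^sub>v v"
    using M by (auto simp: eigenvector_def)
  interpret cof_vec_space ?n "TYPE(complex)" .
  define b where "b = basis_completion v"
  from basis_completion[OF v(1,2), folded b_def]
  have b: "distinct b" "\<not> lin_dep (set b)" "set b \<subseteq> carrier_vec ?n" "hd b = v" "length b = ?n" by auto
  define ws where "ws = gram_schmidt ?n b"
  from gram_schmidt_result[OF b(3,1,2) ws_def]
  have ws: "set ws \<subseteq> carrier_vec ?n" "corthogonal ws" "length ws = ?n" using b(5) by auto
  obtain bs where "b = v # bs" using b(4,5) by (cases b) auto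
  then have "hd ws = v" using gram_schmidt_hd[OF v(1), of bs] by (simp add: ws_def)
  then have ws0: "ws ! 0 = v" using ws(3) by (metis hd_conv_nth list.size(3) nat.distinct(1))
  have wsc: "ws ! j \<in> carrier_vec ?n" if "j < ?n" for j using ws(1,3) that by (metis nth_mem subsetD)
  define x where "x j = (\<Sum>i<?n. (cmod (ws ! j $ i))\<^sup>2)" for j
  have sp: "ws ! k \<bullet>c ws ! j = (\<Sum>i<?n. cnj (ws ! j $ i) * ws ! k $ i)" if "j < ?n" "k < ?n" for j k
    using wsc[OF that(1)] wsc[OF that(2)]
    by (simp add: scalar_prod_def atLeast0LessThan mult.commute conjugate_vec_def)
  have spx: "ws ! j \<bullet>c ws ! j = complex_of_real (x j)" if "j < ?n" for j
    unfolding sp[OF that that] x_def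
    by (simp add: complex_norm_square[symmetric] mult.commute)
  have x0: "0 < x j" if "j < ?n" for j
  proof -
    have "ws ! j \<bullet>c ws ! j \<noteq> 0" using corthogonalD[OF ws(2), of j j] ws(3) that by simp
    then have "x j \<noteq> 0" using spx[OF that] by auto
    then show ?thesis using sum_nonneg[of "{..<?n}" "\<lambda>i. (cmod (ws ! j $ i))\<^sup>2"] by (simp add: x_def)
  qed
  define w where "w i j = complex_of_real (1 / sqrt (x j)) * ws ! j $ i" for i j
  define Wm where "Wm = mat ?n ?n (\<lambda>(i, j). w i j)"
  define W where "W = fmat_of Wm"
  have Wm: "Wm \<in> carrier_mat ?n ?n" by (simp add: Wm_def)
  have entW: "ent W i j = (if i < ?n \<and> j < ?n then w i j else 0)" for i j
    by (auto simp: W_def ent_emb Wm_def)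
  have suppW: "supp ?n W" unfolding W_def by (rule supp_emb[OF Wm])
  have WW: "adj W * W = idm ?n"
  proof (rule fmat_eqI)
    fix j k
    have "ent (adj W * W) j k = (\<Sum>i<?n. ent (adj W) j i * ent W i k)"
      by (rule ent_mult) (simp add: suppW)
    also have "\<dots> = ent (idm ?n) j k"
    proof (cases "j < ?n \<and> k < ?n")
      case True
      have "(\<Sum>i<?n. ent (adj W) j i * ent W i k)
          = complex_of_real (1 / sqrt (x j)) * complex_of_real (1 / sqrt (x k)) * (ws ! k \<bullet>c ws ! j)"
        using True unfolding sp[OF conjunct1[OF True] conjunct2[OF True]] sum_distrib_left
        by (intro sum.cong) (auto simp: ent_adj entW w_def)
      also have "\<dots> = (if j = k then 1 else 0)"
      proof (cases "j = k")
        case jk: True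
        have "complex_of_real (1 / sqrt (x k)) * complex_of_real (1 / sqrt (x k)) * complex_of_real (x k)
            = complex_of_real (1 / sqrt (x k) * (1 / sqrt (x k)) * x k)" by (simp only: of_real_mult)
        also have "1 / sqrt (x k) * (1 / sqrt (x k)) * x k = 1" using x0[of k] True by simp
        finally show ?thesis using jk True by (simp add: spx)
      next
        case False
        then show ?thesis using corthogonalD[OF ws(2), of k j] ws(3) True by auto
      qed
      finally show ?thesis using True by (simp add: ent_idm)
    next
      case False
      then show ?thesis by (auto simp: ent_adj entW ent_idm intro!: sum.neutral)
    qed
    finally show "ent (adj W * W) j k = ent (idm ?n) j k" .
  qed
  have "mat_adjoint Wm * Wm = 1\<^sub>m ?n"
    by (rule emb_inject[of _ ?n ?n]) (use Wm WW in \<open>auto simp: emb_mult emb_adjoint emb_one W_def\<close>)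
  then have "Wm * mat_adjoint Wm = 1\<^sub>m ?n"
    using mat_mult_left_right_inverse[OF mat_adjoint_carrier[OF Wm] Wm] by simp
  then have "W * adj W = idm ?n" using Wm by (simp add: W_def emb_mult[symmetric] emb_adjoint[symmetric] emb_one)
  with WW suppW have UW: "unitary ?n W" by (simp add: unitary_def)
  define A' where "A' = adj W * A * W"
  have A': "supp ?n A'" "adj A' = A'" unfolding A'_def using A suppW by (auto intro!: supp_mult simp: mult.assoc)
  have AW0: "ent (A * W) i 0 = e * ent W i 0" for i
  proof (cases "i < ?n")
    case True
    have "ent (A * W) i 0 = (\<Sum>j<?n. ent A i j * ent W j 0)" by (rule ent_mult) (simp add: suppW)
    also have "\<dots> = complex_of_real (1 / sqrt (x 0)) * (\<Sum>j<?n. M $$ (i, j) * v $ j)"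
      unfolding sum_distrib_left using True by (intro sum.cong) (auto simp: entW w_def ws0 M_def)
    also have "(\<Sum>j<?n. M $$ (i, j) * v $ j) = (M *\<^sub>v v) $ i"
      using True M v(1) by (auto simp: scalar_prod_def atLeast0LessThan)
    also have "\<dots> = e * v $ i" using True v by simp
    finally show ?thesis using True by (simp add: entW w_def ws0)
  next
    case False
    then show ?thesis using suppD[OF supp_mult[OF A(1) suppW]] suppD[OF suppW] by simp
  qed
  \<comment> \<open>The first column of \<open>W\<close> is the normalized eigenvector, so the first
    column of \<open>A'\<close> is \<open>e\<close> times that of the identity.\<close>
  have A'0: "ent A' i 0 = (if i = 0 then e else 0)" for i
  proof -
    have "ent A' i 0 = (\<Sum>j<?n. ent (adj W) i j * ent (A * W) j 0)"
      unfolding A'_def mult.assoc by (rule ent_mult) (simp add: suppW)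
    also have "\<dots> = e * (\<Sum>j<?n. ent (adj W) i j * ent W j 0)"
      by (simp add: AW0 sum_distrib_left mult.left_commute del: sum.lessThan_Suc)
    also have "(\<Sum>j<?n. ent (adj W) i j * ent W j 0) = ent (adj W * W) i 0"
      by (rule ent_mult[symmetric]) (simp add: suppW)
    finally show ?thesis by (simp add: WW ent_idm)
  qed
  \<comment> \<open>Hermitian symmetry now clears the first row as well and makes the eigenvalue
    real.\<close>
  have sym: "ent A' i j = cnj (ent A' j i)" for i j using A'(2) by (metis ent_adj)
  have "cnj e = e" using sym[of 0 0] A'0[of 0] by simp
  then have e: "complex_of_real (Re e) = e" by (simp add: complex_eq_iff)
  define B where "B = mkfm n (\<lambda>i j. ent A' (Suc i) (Suc j))"
  have A'B: "A' = bordered (complex_of_real (Re e)) n B"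
  proof (rule fmat_eqI)
    fix i j
    show "ent A' i j = ent (bordered (complex_of_real (Re e)) n B) i j"
      using suppD[OF A'(1)] A'0[of i] A'0[of j] sym[of 0 j]
      by (cases i; cases j) (auto simp: ent_bordered B_def ent_mkfm e)
  qed
  have "supp n B" by (simp add: B_def)
  moreover have "adj B = B"
  proof (rule fmat_eqI)
    show "ent (adj B) i j = ent B i j" for i j
      using sym[of "Suc i" "Suc j"] by (auto simp: ent_adj B_def ent_mkfm)
  qed
  moreover have "A = W * A' * adj W"
  proof -
    have "W * A' * adj W = idm ?n * A * idm ?n"
      using UW by (simp add: A'_def unitary_def mult.assoc[symmetric]) (simp add: mult.assoc)
    then show ?thesis using A(1) by (simp add: idm_mult mult_idm suppD)
  qed
  ultimately show ?thesis using that UW A'B by metis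
qed

theorem hermitian_spectral:
  assumes "supp n A" "adj A = A"
  obtains U l where "unitary n U" "A = spec n U l"
  using assms
proof (induction n arbitrary: A thesis)
  case 0
  have "A = 0" using 0(2) by (auto intro!: fmat_eqI simp: supp_def)
  moreover have "idm 0 = 0" by (auto intro!: fmat_eqI simp: ent_idm)
  ultimately show ?case using 0(1)[of 0 "\<lambda>_. 0"] by (simp add: unitary_def spec_def)
next
  case (Suc n)
  obtain W e B where W: "unitary (Suc n) W" "supp n B" "adj B = B"
    "A = W * bordered (complex_of_real e) n B * adj W"
    by (rule deflation_step[OF Suc.prems(2,3)])
  obtain V l where V: "unitary n V" "B = spec n V l" by (rule Suc.IH[OF _ W(2,3)])
  have sV: "supp n V" using V by (simp add: unitary_def)
  define U where "U = W * bordered 1 n V"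
  have Vx: "bordered 1 n (adj V) * bordered 1 n V = idm (Suc n)" "bordered 1 n V * bordered 1 n (adj V) = idm (Suc n)"
    using V by (simp_all add: bordered_mult sV bordered_idm unitary_def)
  have sW: "W * idm (Suc n) = W" using W(1) by (auto intro!: mult_idm simp: unitary_def suppD)
  have s1: "idm (Suc n) * bordered 1 n V = bordered 1 n V" using suppD[OF supp_bordered] by (auto intro!: idm_mult)
  have aU: "adj U = bordered 1 n (adj V) * adj W" by (simp add: U_def adj_bordered)
  have "adj U * U = bordered 1 n (adj V) * ((adj W * W) * bordered 1 n V)" by (simp add: U_def adj_bordered mult.assoc)
  also have "\<dots> = idm (Suc n)" using W(1) by (simp add: unitary_def s1 Vx)
  finally have 1: "adj U * U = idm (Suc n)" .
  have "U * adj U = W * (bordered 1 n V * bordered 1 n (adj V)) * adj W" by (simp add: U_def adj_bordered mult.assoc)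
  also have "\<dots> = idm (Suc n)" using W(1) by (simp add: Vx sW) (simp add: unitary_def)
  finally have 2: "U * adj U = idm (Suc n)" .
  have "supp (Suc n) U" unfolding U_def using W(1) by (auto intro!: supp_mult simp: unitary_def)
  with 1 2 have U: "unitary (Suc n) U" by (simp add: unitary_def)
  have "bordered (complex_of_real e) n B = bordered 1 n V * diagf (Suc n) (case_nat e l) * bordered 1 n (adj V)"
    unfolding V(2) spec_def bordered_diagf[symmetric]
    using sV by (simp add: bordered_mult supp_mult)
  then have "A = spec (Suc n) U (case_nat e l)"
    unfolding W(4) spec_def aU by (simp add: U_def mult.assoc)
  with U show ?case by (rule Suc.prems(1))
qed

section \<open>Singular values and rank from the spectral decomposition\<close>

definition unemb :: "nat \<Rightarrow> nat \<Rightarrow> fmat \<Rightarrow> complex mat" where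
  "unemb n m A = mat n m (\<lambda>(i, j). ent A i j)"

lemma unemb_carrier [simp]: "unemb n m A \<in> carrier_mat n m"
  by (simp add: unemb_def)

lemma emb_unemb:
  assumes "\<And>i j. n \<le> i \<or> m \<le> j \<Longrightarrow> ent A i j = 0"
  shows "fmat_of (unemb n m A) = A"
  using assms by (auto intro!: fmat_eqI simp: ent_emb unemb_def not_less)

lemma char_poly_spec:
  assumes U: "unitary d U" and M: "M \<in> carrier_mat d d" "fmat_of M = spec d U l"
  shows "char_poly M = (\<Prod>i\<leftarrow>[0..<d]. [:- complex_of_real (l i), 1:])"
proof -
  define V where "V = unemb d d U"
  define D where "D = mat_diag d (\<lambda>i. complex_of_real (l i))"
  have V: "V \<in> carrier_mat d d" "fmat_of V = U" and D: "D \<in> carrier_mat d d"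
    using U suppD[of d U] by (auto simp: V_def D_def unitary_def intro!: emb_unemb)
  have eD: "fmat_of D = diagf d l" by (simp add: D_def emb_mat_diag)
  have "V * mat_adjoint V = 1\<^sub>m d" "mat_adjoint V * V = 1\<^sub>m d" "M = V * D * mat_adjoint V"
    using U V M D eD by (auto intro!: emb_inject[of _ d d]
        simp: emb_mult emb_adjoint emb_one unitary_def spec_def)
  then have "similar_mat M D"
    using V M D mat_adjoint_carrier[OF V(1)] similar_mat_witI[of V "mat_adjoint V" d M D]
    unfolding similar_mat_def by blast
  then have "char_poly M = char_poly D" by (rule char_poly_similar)
  also have "\<dots> = (\<Prod>a\<leftarrow>diag_mat D. [:- a, 1:])"
    by (rule char_poly_upper_triangular[OF D]) (auto simp: D_def mat_diag_def upper_triangular_def)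
  also have "diag_mat D = map (\<lambda>i. complex_of_real (l i)) [0..<d]"
    by (auto simp: diag_mat_def D_def mat_diag_def)
  finally show ?thesis by (simp add: comp_def)
qed

lemma singular_values_spec:
  assumes U: "unitary d U" and M: "M \<in> carrier_mat d d" "fmat_of M = spec d U l"
  shows "mset (singular_values M) = mset (map (\<lambda>i. \<bar>l i\<bar>) [0..<d])" "sorted_wrt (\<ge>) (singular_values M)"
proof -
  have "fmat_of (mat_adjoint M * M) = spec d U (\<lambda>i. (l i)\<^sup>2)"
    using M U by (simp add: emb_mult emb_adjoint spec_mult power2_eq_square)
  then have "char_poly (mat_adjoint M * M) = (\<Prod>i\<leftarrow>[0..<d]. [:- complex_of_real ((l i)\<^sup>2), 1:])"
    using M by (intro char_poly_spec[OF U]) auto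
  moreover have "proots (\<Prod>i\<leftarrow>xs. [:- complex_of_real ((l i)\<^sup>2), 1:]) = mset (map (\<lambda>i. complex_of_real ((l i)\<^sup>2)) xs)"
    for xs :: "nat list"
  proof (induction xs)
    case (Cons a xs)
    have "(\<Prod>i\<leftarrow>xs. [:- complex_of_real ((l i)\<^sup>2), 1:]) \<noteq> 0" by (auto simp: prod_list_zero_iff)
    then show ?case using Cons by (subst list.map, subst prod_list.Cons, subst proots_mult) (auto simp del: of_real_power)
  qed simp
  ultimately show "mset (singular_values M) = mset (map (\<lambda>i. \<bar>l i\<bar>) [0..<d])"
    by (simp add: singular_values_def image_mset.compositionality comp_def del: of_real_power)
  show "sorted_wrt (\<ge>) (singular_values M)"
    unfolding singular_values_def sorted_wrt_rev by simp
qed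

lemma spectral_norm_opb:
  assumes M: "hermitian_mat d M" and "0 < d" and lam: "spectral_norm M \<le> lam"
  shows "opb lam (fmat_of M)"
proof -
  obtain U l where U: "unitary d U" "fmat_of M = spec d U l"
    using hermitian_spectral[OF hermitian_mat_emb[OF M]] by metis
  have "M \<in> carrier_mat d d" using M by (simp add: hermitian_mat_def)
  note sv = singular_values_spec(1)[OF U(1) this U(2)]
  have "\<bar>l i\<bar> \<le> lam" if "i < d" for i
  proof -
    have "set_mset (mset (singular_values M)) = set_mset (mset (map (\<lambda>i. \<bar>l i\<bar>) [0..<d]))" by (simp only: sv)
    then have "\<bar>l i\<bar> \<in> set (singular_values M)" using that by auto
    then have "\<bar>l i\<bar> \<le> spectral_norm M" unfolding spectral_norm_def by (intro Max_ge) auto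
    then show ?thesis using lam by simp
  qed
  moreover from this[OF \<open>0 < d\<close>] have "0 \<le> lam" by simp
  ultimately show ?thesis unfolding U(2) by (intro opb_spec[OF U(1)])
qed

text \<open>Let \<open>B\<close> consist of the eigenvector columns with nonzero eigenvalue. Then
  \<open>M = B * C\<close> and \<open>B = M * C'\<close>, so both have the same column space, and
  the orthonormal columns of \<open>B\<close> are independent.\<close>

lemma rank_spec:
  assumes U: "unitary d U" and M: "M \<in> carrier_mat d d" "fmat_of M = spec d U l"
  shows "vec_space.rank d M = card {i. i < d \<and> l i \<noteq> 0}"
proof -
  interpret vec_space "TYPE(complex)" d .
  define idx where "idx = filter (\<lambda>i. l i \<noteq> 0) [0..<d]"
  define N where "N = length idx"
  have idx: "idx ! k < d" "l (idx ! k) \<noteq> 0" if "k < N" for k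
    using nth_mem[of k idx] that by (auto simp: idx_def N_def)
  have inj: "inj_on (\<lambda>k. idx ! k) {..<N}" using inj_on_nth[of idx "{..<N}"] by (auto simp: idx_def N_def)
  have img: "(\<lambda>k. idx ! k) ` {..<N} = {i. i < d \<and> l i \<noteq> 0}"
  proof -
    have "(\<lambda>k. idx ! k) ` {..<N} = set idx" by (auto simp: N_def in_set_conv_nth)
    then show ?thesis by (auto simp: idx_def)
  qed
  have sU: "supp d U" using U by (simp add: unitary_def)
  define B where "B = mat d N (\<lambda>(i, k). ent U i (idx ! k))"
  define E where "E = fmat_of B"
  have B: "B \<in> carrier_mat d N" by (simp add: B_def)
  have entE: "ent E i k = (if k < N then ent U i (idx ! k) else 0)" for i k
    using suppD[OF sU] by (auto simp: E_def ent_emb B_def)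
  have EE: "adj E * E = idm N"
  proof (rule fmat_eqI)
    fix j k
    have "ent (adj E * E) j k = (\<Sum>i<d. ent (adj E) j i * ent E i k)"
      by (rule ent_mult_cols) (simp add: ent_adj entE suppD[OF sU])
    also have "\<dots> = (if j < N \<and> k < N then \<Sum>i<d. ent (adj U) (idx ! j) i * ent U i (idx ! k) else 0)"
      by (auto simp: ent_adj entE)
    also have "(\<Sum>i<d. ent (adj U) (idx ! j) i * ent U i (idx ! k)) = ent (adj U * U) (idx ! j) (idx ! k)"
      by (rule ent_mult[symmetric]) (simp add: sU)
    also have "\<dots> = ent (idm d) (idx ! j) (idx ! k)" using U by (simp add: unitary_def)
    finally show "ent (adj E * E) j k = ent (idm N) j k"
      using idx inj_onD[OF inj, of j k] by (auto simp: ent_idm)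
  qed
  have spE: "spec d U l = E * diagf N (\<lambda>k. l (idx ! k)) * adj E"
  proof (rule fmat_eqI)
    fix a b
    have "ent (spec d U l) a b = (\<Sum>i<d. ent (U * diagf d l) a i * ent (adj U) i b)"
      unfolding spec_def by (rule ent_mult) (simp add: sU)
    also have "\<dots> = (\<Sum>i<d. l i *\<^sub>R ent U a i * cnj (ent U b i))"
      by (intro sum.cong) (auto simp: ent_mult_diagf ent_adj)
    also have "\<dots> = (\<Sum>i\<in>(\<lambda>k. idx ! k) ` {..<N}. l i *\<^sub>R ent U a i * cnj (ent U b i))"
      unfolding img by (rule sum.mono_neutral_right) auto
    also have "\<dots> = (\<Sum>k<N. l (idx ! k) *\<^sub>R ent U a (idx ! k) * cnj (ent U b (idx ! k)))"
      using inj by (simp add: sum.reindex)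
    also have "\<dots> = (\<Sum>k<N. ent (E * diagf N (\<lambda>k. l (idx ! k))) a k * ent (adj E) k b)"
      by (intro sum.cong) (auto simp: ent_mult_diagf ent_adj entE)
    also have "\<dots> = ent (E * diagf N (\<lambda>k. l (idx ! k)) * adj E) a b"
      by (rule ent_mult_cols[symmetric]) (simp add: ent_mult_diagf)
    finally show "ent (spec d U l) a b = ent (E * diagf N (\<lambda>k. l (idx ! k)) * adj E) a b" .
  qed
  define C where "C = mat_diag N (\<lambda>k. complex_of_real (l (idx ! k))) * mat_adjoint B"
  define C' where "C' = B * mat_diag N (\<lambda>k. complex_of_real (1 / l (idx ! k)))"
  have md: "mat_diag N f \<in> carrier_mat N N" for f :: "nat \<Rightarrow> complex" by simp
  have C: "C \<in> carrier_mat N d" "C' \<in> carrier_mat d N"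
    unfolding C_def C'_def using B md by (auto intro!: mult_carrier_mat)
  have eC: "fmat_of C = diagf N (\<lambda>k. l (idx ! k)) * adj E"
    using B md by (simp add: C_def emb_mult emb_mat_diag emb_adjoint E_def)
  have "fmat_of (B * C) = E * fmat_of C" using B C by (simp add: emb_mult E_def)
  then have "fmat_of M = fmat_of (B * C)" by (simp add: eC M(2) spE mult.assoc)
  then have MB: "M = B * C" using B C by (intro emb_inject[OF M(1)]) auto
  have EN: "E * idm N = E" by (rule mult_idm) (simp add: entE)
  have "fmat_of (M * C') = E * (diagf N (\<lambda>k. l (idx ! k)) * ((adj E * E) * diagf N (\<lambda>k. 1 / l (idx ! k))))"
    using M B C md by (simp add: emb_mult C'_def E_def[symmetric] spE mult.assoc emb_mat_diag del: of_real_divide)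
  also have "\<dots> = E * diagf N (\<lambda>k. 1)"
    unfolding EE diagf_one[symmetric] diagf_mult using idx by (intro arg_cong[where f = "(*) E"] diagf_cong) auto
  finally have BM: "B = M * C'"
    using EN by (intro emb_inject[OF B]) (use M C in \<open>auto simp: E_def diagf_one\<close>)
  have cs: "col_space M = col_space B"
  proof -
    have "M *\<^sub>v x \<in> col_space B" if "x \<in> carrier_vec d" for x
      unfolding col_space_eq[OF B] using that B C
      by (auto simp: MB assoc_mult_mat_vec[OF B C(1)] intro!: exI[of _ "C *\<^sub>v x"])
    moreover have "B *\<^sub>v x \<in> col_space M" if "x \<in> carrier_vec N" for x
      unfolding col_space_eq[OF M(1)] using that M C
      by (subst BM) (auto simp: assoc_mult_mat_vec[OF M(1) C(2)] intro!: exI[of _ "C' *\<^sub>v x"])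
    ultimately show ?thesis using M B by (auto simp: col_space_eq[OF B] col_space_eq[OF M(1)]) 
  qed
  have "rank M = rank B" unfolding rank_def using cs by (simp add: col_space_def)
  also have "rank B = N"
  proof (rule lin_indpt_full_rank[OF B])
    have BB: "mat_adjoint B * B = 1\<^sub>m N"
      by (rule emb_inject[of _ N N]) (use B EE in \<open>auto simp: emb_mult emb_adjoint emb_one E_def\<close>)
    have inv: "x = 0\<^sub>v N" if x: "x \<in> carrier_vec N" "B *\<^sub>v x = 0\<^sub>v d" for x
    proof -
      have "x = (mat_adjoint B * B) *\<^sub>v x" using x BB by simp
      also have "\<dots> = mat_adjoint B *\<^sub>v (B *\<^sub>v x)" by (rule assoc_mult_mat_vec) (use B x in auto)
      also have "\<dots> = 0\<^sub>v N" using x B by (intro eq_vecI) (auto simp: scalar_prod_def)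
      finally show ?thesis .
    qed
    show d: "distinct (cols B)"
    proof (rule ccontr)
      assume "\<not> distinct (cols B)"
      then obtain j k where jk: "j < N" "k < N" "j \<noteq> k" "col B j = col B k"
        using B by (auto simp: distinct_conv_nth)
      have "(1\<^sub>m N :: complex mat) $$ (j, j) = row (mat_adjoint B) j \<bullet> col B j"
        unfolding BB[symmetric] using B jk by simp
      also have "\<dots> = (1\<^sub>m N :: complex mat) $$ (j, k)"
        unfolding BB[symmetric] using B jk by simp
      finally show False using jk by simp
    qed
    show "lin_indpt (set (cols B))"
      using lin_depE[OF B _ d] inv by blast
  qed
  also have "N = card {i. i < d \<and> l i \<noteq> 0}"
    unfolding img[symmetric] using inj by (simp add: card_image)
  finally show ?thesis .
qed

section \<open>Convergence under the restricted isometry property\<close>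

lemma emb_mult_carrier:
  "A \<in> carrier_mat a b \<Longrightarrow> B \<in> carrier_mat b c \<Longrightarrow> fmat_of (A * B) = fmat_of A * fmat_of B"
  by (simp add: emb_mult)

lemma emb_gram:
  "U \<in> carrier_mat d n \<Longrightarrow> adj (fmat_of U) * fmat_of U = fmat_of (mat_adjoint U * U)"
  "U \<in> carrier_mat d n \<Longrightarrow> fmat_of U * adj (fmat_of U) = fmat_of (U * mat_adjoint U)"
  by (simp_all add: emb_mult emb_adjoint)

lemma filter_pos_takeWhile:
  fixes L :: "real list"
  shows "sorted_wrt (\<ge>) L \<Longrightarrow> filter (\<lambda>x. 0 < x) L = takeWhile (\<lambda>x. 0 < x) L"
proof (induction L)
  case (Cons a L)
  then show ?case by (cases "0 < a"; cases L) auto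
qed simp

lemma spec_eigenvalue:
  assumes U: "unitary d U" and i: "i < d"
  shows "ent (adj U * (spec d U l * U)) i i = complex_of_real (l i)"
proof -
  have "adj U * (spec d U l * U) = (adj U * U) * diagf d l * (adj U * U)"
    by (simp add: spec_def mult.assoc)
  also have "\<dots> = diagf d l" using U by (simp add: unitary_def diagf_one[symmetric] diagf_mult)
  finally show ?thesis using i by (simp add: ent_diagf)
qed

text \<open>Positivity makes the eigenvalues equal to the singular values, and the rank counts the
  nonzero ones; so the first r entries of the sorted list are exactly the positive
  eigenvalues.\<close>

lemma density_spectrum:
  assumes \<rho>: "density_mat d \<rho>" and r: "1 \<le> r" "vec_space.rank d \<rho> = r"
    and \<sigma>: "\<forall>i\<in>{1..r}. \<sigma> i = singular_values \<rho> ! (i - 1)"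
  obtains U l where "unitary d U" "fmat_of \<rho> = spec d U l" "\<And>i. i < d \<Longrightarrow> 0 \<le> l i"
    "card {i. i < d \<and> l i \<noteq> 0} = r" "0 < \<sigma> r" "\<sigma> r \<le> \<sigma> 1"
    "\<And>i. i < d \<Longrightarrow> l i \<noteq> 0 \<Longrightarrow> \<sigma> r \<le> l i" "\<And>i. i < d \<Longrightarrow> l i \<le> \<sigma> 1"
proof -
  have h: "hermitian_mat d \<rho>" and c: "\<rho> \<in> carrier_mat d d" using \<rho> by (auto simp: density_mat_def hermitian_mat_def)
  obtain U l where U: "unitary d U" "fmat_of \<rho> = spec d U l"
    using hermitian_spectral[OF hermitian_mat_emb[OF h]] by metis
  have sU: "supp d U" using U by (simp add: unitary_def)
  have l0: "0 \<le> l i" if i: "i < d" for i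
  proof -
    define v where "v = vec d (\<lambda>a. ent U a i)"
    have "(\<rho> *\<^sub>v v) \<bullet>c v = (\<Sum>a<d. (\<Sum>b<d. \<rho> $$ (a, b) * ent U b i) * cnj (ent U a i))"
      using c by (auto simp: v_def scalar_prod_def atLeast0LessThan conjugate_vec_def intro!: sum.cong)
    also have "\<dots> = (\<Sum>a<d. ent (adj U) i a * ent (fmat_of \<rho> * U) a i)"
    proof (rule sum.cong[OF refl])
      fix a assume a: "a \<in> {..<d}"
      have "ent (fmat_of \<rho> * U) a i = (\<Sum>b<d. ent (fmat_of \<rho>) a b * ent U b i)"
        by (rule ent_mult) (simp add: sU)
      also have "\<dots> = (\<Sum>b<d. \<rho> $$ (a, b) * ent U b i)"
        using c a by (intro sum.cong) (auto simp: ent_emb)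
      finally show "(\<Sum>b<d. \<rho> $$ (a, b) * ent U b i) * cnj (ent U a i) = ent (adj U) i a * ent (fmat_of \<rho> * U) a i"
        by (simp add: ent_adj mult.commute)
    qed
    also have "\<dots> = ent (adj U * (fmat_of \<rho> * U)) i i"
      by (rule ent_mult[symmetric]) (simp add: sU)
    also have "\<dots> = complex_of_real (l i)" using spec_eigenvalue[OF U(1) i] U(2) by simp
    finally have "Re ((\<rho> *\<^sub>v v) \<bullet>c v) = l i" by simp
    moreover have "v \<in> carrier_vec d" by (simp add: v_def)
    ultimately show ?thesis using \<rho> unfolding density_mat_def by metis
  qed
  have cr: "card {i. i < d \<and> l i \<noteq> 0} = r" using rank_spec[OF U(1) c U(2)] r by simp
  define L where "L = singular_values \<rho>"
  have mL: "mset L = mset (map (\<lambda>i. \<bar>l i\<bar>) [0..<d])" and sL: "sorted_wrt (\<ge>) L"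
    using singular_values_spec[OF U(1) c U(2)] by (simp_all add: L_def)
  have setL: "set L = (\<lambda>i. \<bar>l i\<bar>) ` {..<d}"
  proof -
    have "set_mset (mset L) = set_mset (mset (map (\<lambda>i. \<bar>l i\<bar>) [0..<d]))" by (simp only: mL)
    then show ?thesis by (auto simp: atLeast0LessThan)
  qed
  \<comment> \<open>In a nonincreasing list the positive entries form a prefix; its length is the
    rank, which locates \<open>\<sigma> r\<close> as the last positive entry.\<close>
  have len: "length (takeWhile (\<lambda>x. 0 < x) L) = r"
  proof -
    have "length (filter (\<lambda>x. 0 < x) L) = size (filter_mset (\<lambda>x. 0 < x) (mset L))" by (metis mset_filter size_mset)
    also have "\<dots> = length (filter (\<lambda>x. 0 < x) (map (\<lambda>i. \<bar>l i\<bar>) [0..<d]))" by (simp only: mL mset_filter[symmetric] size_mset)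
    also have "\<dots> = length (filter (\<lambda>i. l i \<noteq> 0) [0..<d])" by (simp add: filter_map comp_def)
    also have "\<dots> = r" unfolding cr[symmetric] using length_filter_conv_card[of "\<lambda>i. l i \<noteq> 0" "[0..<d]"] by (auto intro!: arg_cong[where f = card])
    finally show ?thesis using filter_pos_takeWhile[OF sL] by simp
  qed
  have lenL: "r \<le> length L" using len length_takeWhile_le by metis
  have \<sigma>r: "\<sigma> r = L ! (r - 1)" "\<sigma> 1 = L ! 0" using bspec[OF \<sigma>, of r] bspec[OF \<sigma>, of 1] r by (auto simp: L_def)
  have "0 < \<sigma> r"
  proof -
    have "takeWhile (\<lambda>x. 0 < x) L ! (r - 1) = L ! (r - 1)" using len r by (intro takeWhile_nth) auto
    moreover have "takeWhile (\<lambda>x. 0 < x) L ! (r - 1) \<in> set (takeWhile (\<lambda>x. 0 < x) L)" using len r by (intro nth_mem) auto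
    ultimately show ?thesis using set_takeWhileD \<sigma>r by metis
  qed
  moreover have sm: "L ! j \<le> L ! i" if "i \<le> j" "j < length L" for i j
    using sL that by (cases "i = j") (auto simp: sorted_wrt_iff_nth_less)
  have "\<sigma> r \<le> l i" if i: "i < d" "l i \<noteq> 0" for i
  proof -
    have "\<bar>l i\<bar> \<in> set (filter (\<lambda>x. 0 < x) L)" using i setL by auto
    then obtain k where k: "k < r" "takeWhile (\<lambda>x. 0 < x) L ! k = \<bar>l i\<bar>"
      using filter_pos_takeWhile[OF sL] len by (metis in_set_conv_nth)
    then have "L ! k = \<bar>l i\<bar>" using len by (metis takeWhile_nth)
    then show ?thesis using sm[of k "r - 1"] k lenL r l0[OF i(1)] by (simp add: \<sigma>r)
  qed
  moreover have "l i \<le> \<sigma> 1" if i: "i < d" for i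
  proof -
    have "\<bar>l i\<bar> \<in> set L" using i setL by auto
    then obtain k where "k < length L" "L ! k = \<bar>l i\<bar>" by (metis in_set_conv_nth)
    then show ?thesis unfolding \<sigma>r(2) using sm[of 0 k] l0[OF i] by simp
  qed
  moreover have "\<sigma> r \<le> \<sigma> 1" unfolding \<sigma>r using r lenL by (intro sm) auto
  ultimately show ?thesis using that U l0 cr by blast
qed

text \<open>\<open>K\<close> is a square root of \<open>\<rho>\<close>, \<open>Q\<close> the projection onto its range and \<open>R\<close> its pseudoinverse.\<close>

definition ground_truth :: "nat \<Rightarrow> nat \<Rightarrow> real \<Rightarrow> fmat \<Rightarrow> fmat \<Rightarrow> fmat \<Rightarrow> fmat \<Rightarrow> bool" where
  "ground_truth d r s \<rho> K Q R \<longleftrightarrow> supp d \<rho> \<and> \<rho> = K * adj K \<and> K * Q = K \<and> Q * \<rho> = \<rho> \<and> proj Q \<and> (norm Q)\<^sup>2 \<le> real r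
     \<and> \<rho> * R * \<rho> = \<rho> \<and> opb (1 / s) R \<and> 0 < s"

lemma density_ground_truth:
  assumes "density_mat d \<rho>" "1 \<le> r" "vec_space.rank d \<rho> = r"
    "\<forall>i\<in>{1..r}. \<sigma> i = singular_values \<rho> ! (i - 1)"
  shows "0 < \<sigma> r" "\<sigma> r \<le> \<sigma> 1" "norm (fmat_of \<rho>) \<le> sqrt (real r) * \<sigma> 1"
    "\<exists>K Q R. ground_truth d r (\<sigma> r) (fmat_of \<rho>) K Q R"
proof -
  obtain U l where U: "unitary d U" "fmat_of \<rho> = spec d U l" and l0: "\<And>i. i < d \<Longrightarrow> 0 \<le> l i"
    and cr: "card {i. i < d \<and> l i \<noteq> 0} = r" and s: "0 < \<sigma> r" "\<sigma> r \<le> \<sigma> 1"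
    and l1: "\<And>i. i < d \<Longrightarrow> l i \<noteq> 0 \<Longrightarrow> \<sigma> r \<le> l i" and l2: "\<And>i. i < d \<Longrightarrow> l i \<le> \<sigma> 1"
    by (rule density_spectrum[OF assms]) (rule that; assumption)
  show "0 < \<sigma> r" "\<sigma> r \<le> \<sigma> 1" by fact+
  have "(norm (fmat_of \<rho>))\<^sup>2 = (\<Sum>k<d. (l k)\<^sup>2)" unfolding U(2) by (rule norm_spec[OF U(1)])
  also have "\<dots> \<le> (\<Sum>k<d. if l k \<noteq> 0 then (\<sigma> 1)\<^sup>2 else 0)"
    using l0 l2 by (intro sum_mono) (auto intro!: power_mono)
  also have "\<dots> = real r * (\<sigma> 1)\<^sup>2" by (simp add: sum.If_cases cr[symmetric] Int_def)
  finally have "(norm (fmat_of \<rho>))\<^sup>2 \<le> (sqrt (real r) * \<sigma> 1)\<^sup>2" by (simp add: power_mult_distrib)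
  then show "norm (fmat_of \<rho>) \<le> sqrt (real r) * \<sigma> 1"
    by (rule power2_le_imp_le) (use s in simp)
  define K Q R where "K = spec d U (\<lambda>i. sqrt (l i))" and "Q = spec d U (\<lambda>i. if l i \<noteq> 0 then 1 else 0)"
    and "R = spec d U (\<lambda>i. if l i = 0 then 0 else 1 / l i)"
  have "\<rho>' * R * \<rho>' = \<rho>'" if "\<rho>' = spec d U l" for \<rho>'
    unfolding that R_def spec_mult[OF U(1)] by (rule spec_cong[OF U(1)]) auto
  moreover have "opb (1 / \<sigma> r) R"
    unfolding R_def
  proof (rule opb_spec[OF U(1)])
    show "\<bar>if l i = 0 then 0 else 1 / l i\<bar> \<le> 1 / \<sigma> r" if "i < d" for i
      using s(1) l0[OF that] l1[OF that] frac_le[of 1 1 "\<sigma> r" "l i"] by auto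
  qed (use s in auto)
  moreover have "fmat_of \<rho> = K * adj K"
    unfolding U(2) K_def adj_spec[OF U(1)] spec_mult[OF U(1)] by (rule spec_cong[OF U(1)]) (simp add: l0)
  moreover have "Q * fmat_of \<rho> = fmat_of \<rho>"
    unfolding U(2) Q_def spec_mult[OF U(1)] by (rule spec_cong[OF U(1)]) auto
  moreover have "K * Q = K"
    unfolding K_def Q_def spec_mult[OF U(1)] by (rule spec_cong[OF U(1)]) auto
  moreover have "proj Q" "(norm Q)\<^sup>2 \<le> real r"
    unfolding Q_def using proj_spec[OF U(1)] norm_proj_spec[OF U(1), of "\<lambda>i. l i \<noteq> 0"] cr by auto
  moreover have "supp d (fmat_of \<rho>)" unfolding U(2) using U(1) by simp
  ultimately show "\<exists>K Q R. ground_truth d r (\<sigma> r) (fmat_of \<rho>) K Q R"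
    unfolding ground_truth_def using s U(2) by blast
qed

text \<open>For a projection the squared Frobenius norm is the rank. Rank at most r is thus stated
  by a projection that fixes the matrix, the form in which all estimates use it.\<close>

definition low_rank :: "nat \<Rightarrow> nat \<Rightarrow> complex mat \<Rightarrow> bool" where
  "low_rank d r X \<longleftrightarrow> X \<in> carrier_mat d d \<and> adj (fmat_of X) = fmat_of X
     \<and> (\<exists>P. proj P \<and> (norm P)\<^sup>2 \<le> real r \<and> P * fmat_of X = fmat_of X)"

text \<open>Both facts hold however ties are resolved, because \<open>eckart_young\<close> asks only
  that the absolute eigenvalues be nonincreasing.\<close>

lemma hard_threshold_spec:
  assumes M: "M \<in> carrier_mat d d" and N: "hard_threshold r M N"
  shows "low_rank d r N" "proj Q \<Longrightarrow> (norm Q)\<^sup>2 \<le> real r \<Longrightarrow> Q * \<rho> = \<rho> \<Longrightarrow>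
    norm (fmat_of N - fmat_of M) \<le> norm (\<rho> - fmat_of M)"
proof -
  have dM: "dim_row M = d" using M by simp
  from N[unfolded hard_threshold_def Let_def dM]
  obtain U l where U: "U \<in> carrier_mat d d" "mat_adjoint U * U = 1\<^sub>m d"
    and l: "\<And>i j. i \<le> j \<Longrightarrow> j < d \<Longrightarrow> \<bar>l j\<bar> \<le> \<bar>l i :: real\<bar>"
    and MU: "M = U * mat_diag d (\<lambda>i. complex_of_real (l i)) * mat_adjoint U"
    and NU: "N = U * mat_diag d (\<lambda>i. if i < r then complex_of_real (l i) else 0) * mat_adjoint U"
    by blast
  define V where "V = fmat_of U"
  have "U * mat_adjoint U = 1\<^sub>m d"
    using mat_mult_left_right_inverse[OF mat_adjoint_carrier[OF U(1)] U(1) U(2)] .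
  then have V: "unitary d V"
    using supp_emb[OF U(1)] unfolding unitary_def V_def emb_gram[OF U(1)] U(2) by (simp add: emb_one)
  have sp: "fmat_of (U * mat_diag d (\<lambda>i. complex_of_real (a i)) * mat_adjoint U) = spec d V a" for a
  proof -
    have md: "mat_diag d (\<lambda>i. complex_of_real (a i)) \<in> carrier_mat d d" by simp
    have "dim_col (U * mat_diag d (\<lambda>i. complex_of_real (a i))) = d" using md U by simp
    then show ?thesis using U md
      by (simp add: emb_mult spec_def emb_mat_diag emb_adjoint V_def)
  qed
  have fM: "fmat_of M = spec d V l" unfolding MU by (rule sp)
  have "(\<lambda>i. if i < r then complex_of_real (l i) else 0) = (\<lambda>i. complex_of_real (if i < r then l i else 0))" by auto
  then have fN: "fmat_of N = spec d V (\<lambda>i. if i < r then l i else 0)" unfolding NU using sp[of "\<lambda>i. if i < r then l i else 0"] by simp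
  define P where "P = spec d V (\<lambda>i. if i < r then 1 else 0)"
  have "card {i. i < d \<and> i < r} \<le> card {..<r}" by (rule card_mono) auto
  then have "(norm P)\<^sup>2 \<le> real r" unfolding P_def norm_proj_spec[OF V] by simp
  moreover have "proj P" unfolding P_def by (rule proj_spec[OF V])
  moreover have "P * fmat_of N = fmat_of N"
    unfolding P_def fN spec_mult[OF V] by (rule spec_cong[OF V]) auto
  moreover have "N \<in> carrier_mat d d" unfolding NU using U by (intro mult_carrier_mat) auto
  ultimately show "low_rank d r N" unfolding low_rank_def using adj_spec[OF V] fN by metis
  show "norm (fmat_of N - fmat_of M) \<le> norm (\<rho> - fmat_of M)"
    if "proj Q" "(norm Q)\<^sup>2 \<le> real r" "Q * \<rho> = \<rho>"
    unfolding fM fN by (rule eckart_young[OF V l that])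
qed

locale pauli_samples =
  fixes d m :: nat and S :: "nat \<Rightarrow> complex mat"
  assumes S: "\<And>i. i < m \<Longrightarrow> hermitian_mat d (S i)" and d: "0 < d"
begin

abbreviation "Sf \<equiv> \<lambda>i. fmat_of (S i)"
abbreviation "sc \<equiv> real d / real m"

lemma sampling_map_index:
  "X \<in> carrier_mat d d \<Longrightarrow> i < m \<Longrightarrow> sampling_map d m S X $ i = sqrt sc * inner (Sf i) (fmat_of X)"
  using inner_emb_trace[OF S] by (simp add: sampling_map_def)

lemma sampling_adj_emb: "fmat_of (sampling_adj d m S y) = sqrt sc *\<^sub>R (\<Sum>i<m. y $ i *\<^sub>R Sf i)"
proof (rule fmat_eqI)
  fix a b
  have "ent (Sf i) a b = (if a < d \<and> b < d then S i $$ (a, b) else 0)" if "i < m" for i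
    using S[OF that] by (auto simp: ent_emb hermitian_mat_def)
  then show "ent (fmat_of (sampling_adj d m S y)) a b = ent (sqrt sc *\<^sub>R (\<Sum>i<m. y $ i *\<^sub>R Sf i)) a b"
    by (auto simp: ent_emb sampling_adj_def ent_sum scaleR_conv_of_real)
qed

lemma sampling_adj_carrier [simp]: "sampling_adj d m S y \<in> carrier_mat d d"
  by (simp add: sampling_adj_def)

lemma adj_sampling_adj: "adj (fmat_of (sampling_adj d m S y)) = fmat_of (sampling_adj d m S y)"
  unfolding sampling_adj_emb using hermitian_mat_emb(2)[OF S] by (simp add: adj_sum)

lemma hermitian_sampling_adj: "hermitian_mat d (sampling_adj d m S y)"
  unfolding hermitian_mat_def
proof
  show "mat_adjoint (sampling_adj d m S y) = sampling_adj d m S y"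
    by (rule emb_inject[of _ d d]) (auto simp: emb_adjoint adj_sampling_adj)
qed simp

lemma sqrt_sc: "sqrt sc *\<^sub>R (\<Sum>i<m. (sqrt sc * f i) *\<^sub>R Sf i) = sc *\<^sub>R (\<Sum>i<m. f i *\<^sub>R Sf i)"
proof -
  have "(\<Sum>i<m. (sqrt sc * f i) *\<^sub>R Sf i) = sqrt sc *\<^sub>R (\<Sum>i<m. f i *\<^sub>R Sf i)"
    by (simp add: scaleR_sum_right)
  then show ?thesis by (simp del: real_sqrt_divide)
qed

lemma sampling_adj_data:
  assumes \<rho>: "\<rho> \<in> carrier_mat d d" and z: "z \<in> carrier_vec m"
  shows "fmat_of (sampling_adj d m S (sampling_map d m S \<rho> + z))
    = sgram sc m Sf (fmat_of \<rho>) + fmat_of (sampling_adj d m S z)"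
proof -
  have "(\<Sum>i<m. (sampling_map d m S \<rho> + z) $ i *\<^sub>R Sf i)
      = (\<Sum>i<m. (sqrt sc * inner (Sf i) (fmat_of \<rho>)) *\<^sub>R Sf i + z $ i *\<^sub>R Sf i)"
    using z by (intro sum.cong) (auto simp: sampling_map_index[OF \<rho>] scaleR_left_distrib)
  then show ?thesis
    unfolding sampling_adj_emb sum.distrib by (simp only: scaleR_right_distrib sqrt_sc sgram_def)
qed

lemma sampling_adj_residual:
  assumes \<rho>: "\<rho> \<in> carrier_mat d d" and z: "z \<in> carrier_vec m" and X: "X \<in> carrier_mat d d"
  shows "fmat_of (sampling_adj d m S (sampling_map d m S \<rho> + z - sampling_map d m S X))
    = sgram sc m Sf (fmat_of \<rho> - fmat_of X) + fmat_of (sampling_adj d m S z)"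
proof -
  have dv: "dim_vec (sampling_map d m S X) = m" by (simp add: sampling_map_def)
  have "(\<Sum>i<m. (sampling_map d m S \<rho> + z - sampling_map d m S X) $ i *\<^sub>R Sf i)
      = (\<Sum>i<m. (sqrt sc * inner (Sf i) (fmat_of \<rho> - fmat_of X)) *\<^sub>R Sf i + z $ i *\<^sub>R Sf i)"
  proof (rule sum.cong[OF refl])
    fix i assume i: "i \<in> {..<m}"
    have "(sampling_map d m S \<rho> + z - sampling_map d m S X) $ i
        = sqrt sc * inner (Sf i) (fmat_of \<rho> - fmat_of X) + z $ i"
      using i z dv by (simp add: sampling_map_index[OF \<rho>] sampling_map_index[OF X] inner_diff_right right_diff_distrib)
    then show "(sampling_map d m S \<rho> + z - sampling_map d m S X) $ i *\<^sub>R Sf i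
        = (sqrt sc * inner (Sf i) (fmat_of \<rho> - fmat_of X)) *\<^sub>R Sf i + z $ i *\<^sub>R Sf i"
      by (simp only: scaleR_left_distrib)
  qed
  then show ?thesis
    unfolding sampling_adj_emb sum.distrib by (simp only: scaleR_right_distrib sqrt_sc sgram_def)
qed

lemma euclid_norm_sampling_map:
  assumes X: "X \<in> carrier_mat d d"
  shows "(euclid_norm (sampling_map d m S X))\<^sup>2 = sform sc m Sf (fmat_of X) (fmat_of X)"
proof -
  have "(euclid_norm (sampling_map d m S X))\<^sup>2 = (\<Sum>i<m. (sampling_map d m S X $ i)\<^sup>2)"
    by (simp add: euclid_norm_def L2_set_def sum_nonneg sampling_map_def)
  also have "\<dots> = (\<Sum>i<m. sc * (inner (Sf i) (fmat_of X) * inner (Sf i) (fmat_of X)))"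
    by (intro sum.cong) (auto simp: sampling_map_index[OF X] power_mult_distrib power2_eq_square[of "inner _ _"] simp del: real_sqrt_divide)
  finally show ?thesis by (simp add: sform_def sum_distrib_left)
qed

text \<open>With \<delta> = 1/20 the gradient step contracts by 2/19 + (40/19)/16 < 1/4 with noise
  factor 40/19. Thresholding doubles both, which leaves 1/2 and a noise factor below 5.\<close>

lemma rgd_step_error:
  assumes rip: "rip d r (1 / 20) sc m Sf"
    and gt: "ground_truth d r s (fmat_of \<rho>) K Q R" and \<rho>: "\<rho> \<in> carrier_mat d d"
    and z: "z \<in> carrier_vec m" "opb lam (fmat_of (sampling_adj d m S z))"
    and X: "low_rank d r X" and close: "norm (fmat_of X - fmat_of \<rho>) \<le> s / 16"
    and step: "rgd_step d m S (sampling_map d m S \<rho> + z) r X X'"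
  shows "low_rank d r X'"
    "norm (fmat_of X' - fmat_of \<rho>) \<le> 1 / 2 * norm (fmat_of X - fmat_of \<rho>) + 5 * (sqrt r * lam)"
proof -
  let ?y = "sampling_map d m S \<rho> + z"
  have gt': "supp d (fmat_of \<rho>)" "fmat_of \<rho> = K * adj K" "K * Q = K" "proj Q" "(norm Q)\<^sup>2 \<le> real r"
    "fmat_of \<rho> * R * fmat_of \<rho> = fmat_of \<rho>" "opb (1 / s) R" "0 < s"
    using gt by (auto simp: ground_truth_def)
  have Xc: "X \<in> carrier_mat d d" and Xa: "adj (fmat_of X) = fmat_of X" using X by (auto simp: low_rank_def)
  obtain P0 where P0: "proj P0" "(norm P0)\<^sup>2 \<le> real r" "P0 * fmat_of X = fmat_of X" using X by (auto simp: low_rank_def)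
  define G where "G = sampling_adj d m S (?y - sampling_map d m S X)"
  have Gc: "G \<in> carrier_mat d d" by (simp add: G_def)
  obtain U s' V where svd: "compact_svd X U s' V" and
    step': "hard_threshold r (X + complex_of_real ((frob_norm (tangent_proj (U * mat_adjoint U) (V * mat_adjoint V) G))\<^sup>2
      / (euclid_norm (sampling_map d m S (tangent_proj (U * mat_adjoint U) (V * mat_adjoint V) G)))\<^sup>2)
      \<cdot>\<^sub>m tangent_proj (U * mat_adjoint U) (V * mat_adjoint V) G) X'"
    using step unfolding rgd_step_def Let_def G_def by blast
  define n where "n = length s'"
  have Uc: "U \<in> carrier_mat d n" "mat_adjoint U * U = 1\<^sub>m n" and Vc: "V \<in> carrier_mat d n" "mat_adjoint V * V = 1\<^sub>m n"
    and s': "\<forall>x\<in>set s'. 0 < x" and XU: "X = U * mat_diag n (\<lambda>i. complex_of_real (s' ! i)) * mat_adjoint V"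
    using svd Xc unfolding compact_svd_def by (auto simp: n_def)
  define T where "T = tangent_proj (U * mat_adjoint U) (V * mat_adjoint V) G"
  define P where "P = fmat_of U * adj (fmat_of U)"
  have UU: "adj (fmat_of U) * fmat_of U = idm n" "adj (fmat_of V) * fmat_of V = idm n"
    unfolding emb_gram[OF Uc(1)] emb_gram[OF Vc(1)] Uc(2) Vc(2) emb_one by auto
  have UI: "fmat_of U * idm n = fmat_of U" "fmat_of V * idm n = fmat_of V"
    using Uc Vc by (auto intro!: mult_idm simp: ent_emb)
  have fX: "fmat_of X = fmat_of U * diagf n (\<lambda>i. s' ! i) * adj (fmat_of V)"
  proof -
    have md: "mat_diag n (\<lambda>i. complex_of_real (s' ! i)) \<in> carrier_mat n n" by simp
    have "dim_col (U * mat_diag n (\<lambda>i. complex_of_real (s' ! i))) = n" using md Uc by simp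
    then show ?thesis unfolding XU using Uc Vc md by (simp add: emb_mult emb_mat_diag emb_adjoint)
  qed
  have sn: "s' ! i \<noteq> 0" if "i < n" for i using s' nth_mem[of i s'] that by (fastforce simp: n_def)
  note pr = svd_projections[OF fX Xa sn UU(1) UI(1) UU(2) UI(2) P0(1,3)]
  have PV: "fmat_of V * adj (fmat_of V) = P" and P: "proj P" "P * fmat_of X = fmat_of X" "norm P \<le> norm P0"
    using pr by (auto simp: P_def)
  have nP: "(norm P)\<^sup>2 \<le> real r" using order_trans[OF power_mono[OF P(3) norm_ge_zero] P0(2)] .
  have uu: "U * mat_adjoint U \<in> carrier_mat d d" "V * mat_adjoint V \<in> carrier_mat d d"
    "fmat_of (U * mat_adjoint U) = P" "fmat_of (V * mat_adjoint V) = P"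
    using Uc Vc PV by (auto simp: emb_mult emb_adjoint P_def)
  have Psupp: "supp d P" using supp_emb[OF uu(1)] uu(3) by simp
  have Tc: "T \<in> carrier_mat d d" "fmat_of T = PT P (fmat_of G)"
  proof -
    have c: "U * mat_adjoint U * G \<in> carrier_mat d d" "G * (V * mat_adjoint V) \<in> carrier_mat d d"
      "U * mat_adjoint U * G * (V * mat_adjoint V) \<in> carrier_mat d d"
      using uu Gc by (auto intro!: mult_carrier_mat)
    have e: "fmat_of (U * mat_adjoint U * G) = P * fmat_of G" "fmat_of (G * (V * mat_adjoint V)) = fmat_of G * P"
      "fmat_of (U * mat_adjoint U * G * (V * mat_adjoint V)) = P * fmat_of G * P"
      using emb_mult_carrier[OF uu(1) Gc] emb_mult_carrier[OF Gc uu(2)] emb_mult_carrier[OF c(1) uu(2)]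
      unfolding uu(3,4) by auto
    show "T \<in> carrier_mat d d" unfolding T_def tangent_proj_def using c by (auto intro!: minus_carrier_mat)
    show "fmat_of T = PT P (fmat_of G)"
      unfolding T_def tangent_proj_def PT_def using c e
      by (subst emb_diff[of _ d d]) (auto simp: emb_add[of _ d d])
  qed
  define \<alpha> where "\<alpha> = (frob_norm T)\<^sup>2 / (euclid_norm (sampling_map d m S T))\<^sup>2"
  define W where "W = X + complex_of_real \<alpha> \<cdot>\<^sub>m T"
  have thr: "hard_threshold r W X'" using step' by (simp add: W_def \<alpha>_def T_def)
  have Wc: "W \<in> carrier_mat d d" and fW: "fmat_of W = fmat_of X + \<alpha> *\<^sub>R PT P (fmat_of G)"
    unfolding W_def using Xc Tc by (auto simp: emb_add[of _ d d] emb_smult)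
  have \<alpha>q: "\<alpha> = (norm (PT P (fmat_of G)))\<^sup>2 / sform sc m Sf (PT P (fmat_of G)) (PT P (fmat_of G))"
    unfolding \<alpha>_def euclid_norm_sampling_map[OF Tc(1)] frob_norm_emb Tc(2) ..
  interpret geo: rgd_geometry d "real r" "1 / 20" sc m Sf P
    by standard (use rip hermitian_mat_emb[OF S] P nP Psupp in auto)
  have Gt: "PT P (fmat_of G) \<in> tangent d P"
    unfolding G_def by (intro PT_tangent P Psupp supp_emb adj_sampling_adj) simp
  define E where "E = fmat_of (sampling_adj d m S z)"
  have fG: "fmat_of G = geo.Ast (fmat_of \<rho> - fmat_of X) + E"
    unfolding G_def E_def by (rule sampling_adj_residual[OF \<rho> z(1) Xc])
  \<comment> \<open>If the projected gradient vanishes, the step size is 0/0 = 0 and misses the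
    bounds. The step is then zero for every step size, so 1 may be put in its place.\<close>
  obtain \<beta> where \<beta>: "1 / (1 + 1 / 20) \<le> \<beta>" "\<beta> \<le> 1 / (1 - 1 / 20)" "fmat_of W = fmat_of X + \<beta> *\<^sub>R PT P (fmat_of G)"
  proof (cases "PT P (fmat_of G) = 0")
    case True
    then show ?thesis using that[of 1] fW by simp
  next
    case False
    show ?thesis using that[of \<alpha>] fW geo.step_size_bounds[OF Gt False] by (simp add: \<alpha>q)
  qed
  let ?e = "norm (fmat_of X - fmat_of \<rho>)"
  have "norm (fmat_of W - fmat_of \<rho>) \<le> 2 * (1 / 20) / (1 - 1 / 20) * ?e + 2 / (1 - 1 / 20) * (?e\<^sup>2 / s) + 2 / (1 - 1 / 20) * (sqrt r * lam)"
    unfolding \<beta>(3) fG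
    by (rule geo.gradient_step_error[OF supp_emb[OF Xc] Xa P(2) gt'(1-8)]) (use z \<beta> in \<open>auto simp: E_def\<close>)
  then have 1: "norm (fmat_of W - fmat_of \<rho>) \<le> 2 * (1 / 20) / (1 - 1 / 20) * ?e + 2 / (1 - 1 / 20) * (?e\<^sup>2 / s) + 2 / (1 - 1 / 20) * (sqrt r * lam)" .
  \<comment> \<open>Within distance s/16 of \<rho> the quadratic normal term is dominated by a
    linear one.\<close>
  have 2: "?e\<^sup>2 / s \<le> ?e / 16"
  proof -
    have "?e * ?e \<le> ?e * (s / 16)" using close by (intro mult_left_mono) auto
    then show ?thesis using gt'(8) by (simp add: power2_eq_square field_simps)
  qed
  have "2 * w \<le> 1 / 2 * e + 5 * l"
    if "w \<le> 2 * (1 / 20) / (1 - 1 / 20) * e + 2 / (1 - 1 / 20) * q + 2 / (1 - 1 / 20) * l" "q \<le> e / 16" "0 \<le> l" "0 \<le> e"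
    for w e q l :: real using that by simp
  from this[OF 1 2] have W: "2 * norm (fmat_of W - fmat_of \<rho>) \<le> 1 / 2 * ?e + 5 * (sqrt r * lam)"
    using z(2) by (simp add: opb_def)
  have Q\<rho>: "Q * fmat_of \<rho> = fmat_of \<rho>" using gt unfolding ground_truth_def by blast
  show "low_rank d r X'" by (rule hard_threshold_spec(1)[OF Wc thr])
  \<comment> \<open>\<rho> is itself a competitor of rank at most r for the best approximation of
    \<open>W\<close>, so the triangle inequality loses only a factor 2.\<close>
  have "norm (fmat_of X' - fmat_of \<rho>) \<le> norm (fmat_of X' - fmat_of W) + norm (fmat_of W - fmat_of \<rho>)"
    by (metis norm_triangle_ineq diff_add_cancel add_diff_eq)
  also have "\<dots> \<le> 2 * norm (fmat_of W - fmat_of \<rho>)"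
    using hard_threshold_spec(2)[OF Wc thr gt'(4,5) Q\<rho>] by (simp add: norm_minus_commute)
  finally show "norm (fmat_of X' - fmat_of \<rho>) \<le> 1 / 2 * ?e + 5 * (sqrt r * lam)" using W by simp
qed

text \<open>The ball of radius s/16 around \<rho>, where the step lemma applies, is carried along as
  an invariant. The constant 10 is the fixed point of e -> e/2 + 5.\<close>

theorem rgd_convergence:
  assumes rip: "rip d r (1 / 20) sc m Sf"
    and gt: "ground_truth d r s (fmat_of \<rho>) K Q R" and \<rho>: "\<rho> \<in> carrier_mat d d"
    and z: "z \<in> carrier_vec m" "opb lam (fmat_of (sampling_adj d m S z))"
    and init: "opb \<delta> (sgram sc m Sf (fmat_of \<rho>) - fmat_of \<rho>)"
    and small: "4 * sqrt r * (\<delta> + lam) \<le> s / 16" "160 * (sqrt r * lam) \<le> s"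
    and X0: "hard_threshold r (sampling_adj d m S (sampling_map d m S \<rho> + z)) X0"
    and it: "rgd_iterates d m S (sampling_map d m S \<rho> + z) r X0 X"
  shows "X k \<in> carrier_mat d d"
    "norm (fmat_of (X k) - fmat_of \<rho>) \<le> (1 / 2) ^ k * (4 * sqrt r * (\<delta> + lam)) + 10 * (sqrt r * lam)"
proof -
  let ?e = "\<lambda>k. norm (fmat_of (X k) - fmat_of \<rho>)" and ?B = "4 * sqrt r * (\<delta> + lam)" and ?l = "sqrt r * lam"
  have l0: "0 \<le> ?l" using z(2) by (simp add: opb_def)
  have gt': "fmat_of \<rho> = K * adj K" "K * Q = K" "proj Q" "(norm Q)\<^sup>2 \<le> real r"
    using gt by (auto simp: ground_truth_def)
  have \<rho>Q: "Q * fmat_of \<rho> = fmat_of \<rho>" using gt unfolding ground_truth_def by blast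
  have "adj (fmat_of \<rho>) = fmat_of \<rho>" unfolding gt'(1) by simp
  then have "adj (Q * fmat_of \<rho>) = fmat_of \<rho> * Q" using gt'(3) by (simp add: projD)
  then have \<rho>Q': "fmat_of \<rho> * Q = fmat_of \<rho>" unfolding \<rho>Q using gt'(1) by simp
  have XS: "X 0 = X0" "\<And>k. rgd_step d m S (sampling_map d m S \<rho> + z) r (X k) (X (Suc k))"
    using it by (auto simp: rgd_iterates_def)
  let ?A = "sampling_adj d m S (sampling_map d m S \<rho> + z)"
  have fA: "fmat_of ?A - fmat_of \<rho> = (sgram sc m Sf (fmat_of \<rho>) - fmat_of \<rho>) + fmat_of (sampling_adj d m S z)"
    using sampling_adj_data[OF \<rho> z(1)] by simp
  have AE: "opb (\<delta> + lam) (fmat_of ?A - fmat_of \<rho>)" unfolding fA by (rule opb_add[OF init z(2)])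
  have lr0: "low_rank d r (X 0)" unfolding XS by (rule hard_threshold_spec(1)[OF _ X0]) simp
  then obtain P where P: "proj P" "(norm P)\<^sup>2 \<le> real r" "P * fmat_of X0 = fmat_of X0"
    by (auto simp: low_rank_def XS)
  have e0: "?e 0 \<le> ?B" unfolding XS
    by (rule best_approx_spectral[OF supp_emb[OF sampling_adj_carrier] _ AE P gt'(3,4) \<rho>Q'])
      (rule hard_threshold_spec(2)[OF sampling_adj_carrier X0 gt'(3,4) \<rho>Q])
  have "low_rank d r (X k) \<and> ?e k \<le> s / 16 \<and> ?e k \<le> (1 / 2) ^ k * ?B + 10 * ?l" for k
  proof (induction k)
    case 0
    then show ?case using lr0 e0 small l0 by simp
  next
    case (Suc k)
    note st = rgd_step_error[OF rip gt \<rho> z conjunct1[OF Suc.IH] conjunct1[OF conjunct2[OF Suc.IH]] XS(2)]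
    \<comment> \<open>Half of s/16 plus 5 times s/160 is again s/16.\<close>
    have "?e (Suc k) \<le> s / 16" using st(2) Suc small by simp
    moreover have "?e (Suc k) \<le> 1 / 2 * ((1 / 2) ^ k * ?B + 10 * ?l) + 5 * ?l"
      by (rule order_trans[OF st(2) add_right_mono[OF mult_left_mono[OF conjunct2[OF conjunct2[OF Suc.IH]]]]]) simp
    then have "?e (Suc k) \<le> (1 / 2) ^ Suc k * ?B + 10 * ?l" by (simp add: algebra_simps)
    ultimately show ?case using st(1) by blast
  qed
  then show "X k \<in> carrier_mat d d" "?e k \<le> (1 / 2) ^ k * ?B + 10 * ?l"
    unfolding low_rank_def by blast+
qed

end

section \<open>Pauli matrices\<close>

lemma single_qubit_carrier: "P \<in> single_qubit_paulis \<Longrightarrow> P \<in> carrier_mat 2 2"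
  by (auto simp: single_qubit_paulis_def mat_of_rows_list_def)

lemma single_qubit_index:
  "mat_of_rows_list 2 [[a, b], [c, d]] $$ (0, 0) = a" "mat_of_rows_list 2 [[a, b], [c, d]] $$ (0, Suc 0) = b"
  "mat_of_rows_list 2 [[a, b], [c, d]] $$ (Suc 0, 0) = c" "mat_of_rows_list 2 [[a, b], [c, d]] $$ (Suc 0, Suc 0) = d"
  by (auto simp: mat_of_rows_list_def)

lemma less_2_iff: "i < 2 \<longleftrightarrow> i = 0 \<or> i = Suc 0" by auto

lemma single_qubit_herm: "P \<in> single_qubit_paulis \<Longrightarrow> i < 2 \<Longrightarrow> j < 2 \<Longrightarrow> P $$ (i, j) = cnj (P $$ (j, i))"
  by (auto simp: single_qubit_paulis_def less_2_iff single_qubit_index)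

lemma single_qubit_square:
  "P \<in> single_qubit_paulis \<Longrightarrow> i < 2 \<Longrightarrow> j < 2 \<Longrightarrow>
   P $$ (i, 0) * P $$ (0, j) + P $$ (i, Suc 0) * P $$ (Suc 0, j) = (if i = j then 1 else 0)"
  by (auto simp: single_qubit_paulis_def less_2_iff single_qubit_index)

lemma single_qubit_distinct:
  fixes a b c d a' b' c' d' :: complex
  shows "mat_of_rows_list 2 [[a, b], [c, d]] = mat_of_rows_list 2 [[a', b'], [c', d']] \<longleftrightarrow>
    a = a' \<and> b = b' \<and> c = c' \<and> d = d'"
  by (metis single_qubit_index)

lemma single_qubit_sum:
  assumes "i < 2" "j < 2" "k < 2" "l < 2"
  shows "(\<Sum>P\<in>single_qubit_paulis. P $$ (i, j) * P $$ (k, l)) = (if i = l \<and> j = k then 2 else 0)"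
proof -
  have c: "- \<i> \<noteq> \<i>" "\<i> \<noteq> - \<i>" "(1::complex) \<noteq> -1" "(-1::complex) \<noteq> 1" "\<i> \<noteq> 1" "1 \<noteq> \<i>" "- \<i> \<noteq> 1" "1 \<noteq> - \<i>"
    by (auto simp: complex_eq_iff)
  show ?thesis
    using assms unfolding less_2_iff single_qubit_paulis_def
    by (elim disjE) (simp_all add: single_qubit_distinct c single_qubit_index)
qed

lemma kronecker_carrier:
  "A \<in> carrier_mat a b \<Longrightarrow> B \<in> carrier_mat c d \<Longrightarrow> kronecker A B \<in> carrier_mat (a * c) (b * d)"
  by (auto simp: kronecker_def)

lemma kronecker_index:
  assumes "P \<in> carrier_mat 2 2" "W \<in> carrier_mat D D" "a < 2 * D" "b < 2 * D"
  shows "kronecker P W $$ (a, b) = P $$ (a div D, b div D) * W $$ (a mod D, b mod D)"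
  using assms by (simp add: kronecker_def)

lemma paulis_carrier: "W \<in> paulis n \<Longrightarrow> W \<in> carrier_mat (2 ^ n) (2 ^ n)"
proof (induction n arbitrary: W)
  case (Suc n)
  then show ?case using kronecker_carrier[OF single_qubit_carrier] by fastforce
qed auto

lemma div_less_2: "a < 2 * D \<Longrightarrow> a div D < (2::nat)"
  by (simp add: less_mult_imp_div_less mult.commute)

lemma sum_two_blocks:
  fixes f :: "nat \<Rightarrow> 'a::comm_monoid_add"
  shows "(\<Sum>j<2 * D. f j) = (\<Sum>j<D. f j) + (\<Sum>j<D. f (D + j))"
proof -
  have "(\<Sum>j<D + k. f j) = (\<Sum>j<D. f j) + (\<Sum>j<k. f (D + j))" for k
    by (induction k) (simp_all add: add.assoc)
  from this[of D] show ?thesis by (simp add: mult_2)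
qed

lemma paulis_herm: "W \<in> paulis n \<Longrightarrow> a < 2 ^ n \<Longrightarrow> b < 2 ^ n \<Longrightarrow> W $$ (a, b) = cnj (W $$ (b, a))"
proof (induction n arbitrary: W a b)
  case (Suc n)
  then obtain P V where PV: "P \<in> single_qubit_paulis" "V \<in> paulis n" "W = kronecker P V" by auto
  have ab: "a < 2 * 2 ^ n" "b < 2 * 2 ^ n" using Suc.prems by auto
  have "0 < (2::nat) ^ n" by simp
  then show ?case
    unfolding PV(3) kronecker_index[OF single_qubit_carrier[OF PV(1)] paulis_carrier[OF PV(2)] ab]
      kronecker_index[OF single_qubit_carrier[OF PV(1)] paulis_carrier[OF PV(2)] ab(2,1)]
    using single_qubit_herm[OF PV(1) div_less_2[OF ab(1)] div_less_2[OF ab(2)]]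
      Suc.IH[OF PV(2), of "a mod 2 ^ n" "b mod 2 ^ n"] by simp
qed auto

lemma paulis_square:
  "W \<in> paulis n \<Longrightarrow> a < 2 ^ n \<Longrightarrow> b < 2 ^ n \<Longrightarrow> (\<Sum>j<2 ^ n. W $$ (a, j) * W $$ (j, b)) = (if a = b then 1 else 0)"
proof (induction n arbitrary: W a b)
  case (Suc n)
  then obtain P V where PV: "P \<in> single_qubit_paulis" "V \<in> paulis n" "W = kronecker P V" by auto
  let ?D = "2 ^ n :: nat"
  have ab: "a < 2 * ?D" "b < 2 * ?D" using Suc.prems by auto
  note ki = kronecker_index[OF single_qubit_carrier[OF PV(1)] paulis_carrier[OF PV(2)]]
  have D: "0 < ?D" by simp
  let ?S = "\<Sum>j<?D. V $$ (a mod ?D, j) * V $$ (j, b mod ?D)"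
  have S: "?S = (if a mod ?D = b mod ?D then 1 else 0)" by (rule Suc.IH[OF PV(2)]) (use D in auto)
  have "(\<Sum>j<2 ^ Suc n. W $$ (a, j) * W $$ (j, b)) = (\<Sum>j<2 * ?D. W $$ (a, j) * W $$ (j, b))" by simp
  also have "\<dots> = (\<Sum>j<?D. W $$ (a, j) * W $$ (j, b)) + (\<Sum>j<?D. W $$ (a, ?D + j) * W $$ (?D + j, b))"
    by (rule sum_two_blocks)
  also have "(\<Sum>j<?D. W $$ (a, j) * W $$ (j, b)) = P $$ (a div ?D, 0) * P $$ (0, b div ?D) * ?S"
    unfolding sum_distrib_left PV(3) using ab by (intro sum.cong refl) (simp add: ki mult_ac)
  also have "(\<Sum>j<?D. W $$ (a, ?D + j) * W $$ (?D + j, b)) = P $$ (a div ?D, Suc 0) * P $$ (Suc 0, b div ?D) * ?S"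
    unfolding sum_distrib_left PV(3) using ab D by (intro sum.cong refl) (simp add: ki mult_ac)
  also have "P $$ (a div ?D, 0) * P $$ (0, b div ?D) * ?S + P $$ (a div ?D, Suc 0) * P $$ (Suc 0, b div ?D) * ?S
      = (if a div ?D = b div ?D then 1 else 0) * ?S"
    using single_qubit_square[OF PV(1) div_less_2[OF ab(1)] div_less_2[OF ab(2)]] by (simp only: distrib_right[symmetric])
  also have "\<dots> = (if a = b then 1 else 0)" unfolding S by (auto) (metis div_mult_mod_eq)
  finally show ?case .
qed auto

text \<open>The four single-qubit matrices are pairwise not proportional, so equal Kronecker
  products force equal first factors; a nonzero entry of that factor then determines the second.
  Thus sums over \<open>paulis\<close> factor over the qubits.\<close>

lemma kronecker_paulis_inj: "inj_on (\<lambda>(P, V). kronecker P V) (single_qubit_paulis \<times> paulis n)"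
proof (rule inj_onI, clarify)
  fix P V P' V' assume P: "P \<in> single_qubit_paulis" "P' \<in> single_qubit_paulis"
    and V: "V \<in> paulis n" "V' \<in> paulis n" and eq: "kronecker P V = kronecker P' V'"
  let ?D = "2 ^ n :: nat"
  have D: "0 < ?D" by simp
  have e: "P $$ (i, j) * V $$ (a, b) = P' $$ (i, j) * V' $$ (a, b)" if "i < 2" "j < 2" "a < ?D" "b < ?D" for i j a b
  proof -
    have l: "i * ?D + a < 2 * ?D" "j * ?D + b < 2 * ?D" using that by (auto simp: less_2_iff)
    show ?thesis
      using arg_cong[OF eq, of "\<lambda>M. M $$ (i * ?D + a, j * ?D + b)"] that
      unfolding kronecker_index[OF single_qubit_carrier[OF P(1)] paulis_carrier[OF V(1)] l]
        kronecker_index[OF single_qubit_carrier[OF P(2)] paulis_carrier[OF V(2)] l] by simp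
  qed
  have nz: "\<exists>a<?D. \<exists>b<?D. W $$ (a, b) \<noteq> 0" if "W \<in> paulis n" for W
  proof (rule ccontr)
    assume "\<not> (\<exists>a<?D. \<exists>b<?D. W $$ (a, b) \<noteq> 0)"
    then have "(\<Sum>j<?D. W $$ (0, j) * W $$ (j, 0)) = 0" using D by (intro sum.neutral) auto
    then show False using paulis_square[OF that D D] by simp
  qed
  obtain a b where ab: "a < ?D" "b < ?D" "V $$ (a, b) \<noteq> 0" using nz[OF V(1)] by blast
  obtain a' b' where ab': "a' < ?D" "b' < ?D" "V' $$ (a', b') \<noteq> 0" using nz[OF V(2)] by blast
  note ee = e[of 0 0 a b] e[of 0 "Suc 0" a b] e[of "Suc 0" 0 a b] e[of "Suc 0" "Suc 0" a b]
    e[of 0 0 a' b'] e[of 0 "Suc 0" a' b'] e[of "Suc 0" 0 a' b'] e[of "Suc 0" "Suc 0" a' b']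
  have PP: "P = P'"
    using P ee ab ab' unfolding single_qubit_paulis_def
    by (elim insertE emptyE) (simp_all add: single_qubit_index)
  have "\<exists>i<2. \<exists>j<2. P $$ (i, j) \<noteq> 0"
    using P(1) unfolding single_qubit_paulis_def
    by (auto simp: single_qubit_index less_2_iff ex_disj_distrib conj_disj_distribR)
  then obtain i j where ij: "i < 2" "j < 2" "P $$ (i, j) \<noteq> 0" by blast
  have "V = V'"
  proof (rule eq_matI)
    fix x y assume "x < dim_row V'" "y < dim_col V'"
    then have "x < ?D" "y < ?D" using paulis_carrier[OF V(2)] by auto
    then show "V $$ (x, y) = V' $$ (x, y)" using e[OF ij(1,2), of x y] ij(3) PP by simp
  qed (use paulis_carrier[OF V(1)] paulis_carrier[OF V(2)] in auto)
  with PP show "P = P' \<and> V = V'" by simp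
qed

text \<open>The sum of W tensor W over all Pauli matrices is d times the swap of the two factors.
  The identity is multiplicative over qubits, because quotient and remainder split the
  indices.\<close>

lemma paulis_complete:
  assumes "a < 2 ^ n" "b < 2 ^ n" "c < 2 ^ n" "e < 2 ^ n"
  shows "(\<Sum>W\<in>paulis n. W $$ (a, b) * W $$ (c, e)) = (if a = e \<and> b = c then 2 ^ n else 0)"
  using assms
proof (induction n arbitrary: a b c e)
  case (Suc n)
  let ?D = "2 ^ n :: nat"
  have D: "0 < ?D" by simp
  have l: "a < 2 * ?D" "b < 2 * ?D" "c < 2 * ?D" "e < 2 * ?D" using Suc.prems by auto
  have im: "paulis (Suc n) = (\<lambda>(P, V). kronecker P V) ` (single_qubit_paulis \<times> paulis n)" by auto
  have "(\<Sum>W\<in>paulis (Suc n). W $$ (a, b) * W $$ (c, e))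
      = (\<Sum>(P, V)\<in>single_qubit_paulis \<times> paulis n. kronecker P V $$ (a, b) * kronecker P V $$ (c, e))"
    unfolding im by (subst sum.reindex[OF kronecker_paulis_inj]) (simp add: case_prod_unfold comp_def)
  also have "\<dots> = (\<Sum>(P, V)\<in>single_qubit_paulis \<times> paulis n.
      (P $$ (a div ?D, b div ?D) * P $$ (c div ?D, e div ?D)) * (V $$ (a mod ?D, b mod ?D) * V $$ (c mod ?D, e mod ?D)))"
  proof (rule sum.cong[OF refl], clarify)
    fix P V assume PV: "P \<in> single_qubit_paulis" "V \<in> paulis n"
    show "kronecker P V $$ (a, b) * kronecker P V $$ (c, e) =
      (P $$ (a div ?D, b div ?D) * P $$ (c div ?D, e div ?D)) * (V $$ (a mod ?D, b mod ?D) * V $$ (c mod ?D, e mod ?D))"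
      using l by (simp only: kronecker_index[OF single_qubit_carrier[OF PV(1)] paulis_carrier[OF PV(2)]] mult_ac)
  qed
  also have "\<dots> = (\<Sum>P\<in>single_qubit_paulis. P $$ (a div ?D, b div ?D) * P $$ (c div ?D, e div ?D))
      * (\<Sum>V\<in>paulis n. V $$ (a mod ?D, b mod ?D) * V $$ (c mod ?D, e mod ?D))"
    unfolding sum_product by (rule sum.cartesian_product[symmetric])
  also have "\<dots> = (if a div ?D = e div ?D \<and> b div ?D = c div ?D then 2 else 0)
      * (if a mod ?D = e mod ?D \<and> b mod ?D = c mod ?D then 2 ^ n else 0)"
    using l D by (subst single_qubit_sum) (auto simp: div_less_2 Suc.IH)
  also have "\<dots> = (if a = e \<and> b = c then 2 ^ Suc n else 0)"
    by auto (metis div_mult_mod_eq)+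
  finally show ?case .
qed simp

lemma pauli_hermitian_mat:
  assumes W: "W \<in> paulis n" shows "hermitian_mat (2 ^ n) W"
proof -
  note c = paulis_carrier[OF W]
  have "mat_adjoint W = W"
  proof (rule eq_matI)
    fix a b assume ab: "a < dim_row W" "b < dim_col W"
    then have "mat_adjoint W $$ (a, b) = cnj (W $$ (b, a))" using c by (simp add: mat_adjoint_index)
    also have "\<dots> = W $$ (a, b)" using paulis_herm[OF W, of a b] ab c by simp
    finally show "mat_adjoint W $$ (a, b) = W $$ (a, b)" .
  qed (use c in auto)
  then show ?thesis using c by (simp add: hermitian_mat_def)
qed

lemma pauli_supp: "W \<in> paulis n \<Longrightarrow> supp (2 ^ n) (fmat_of W)"
  and pauli_adj: "W \<in> paulis n \<Longrightarrow> adj (fmat_of W) = fmat_of W"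
  using hermitian_mat_emb[OF pauli_hermitian_mat] by auto

lemma pauli_square: "W \<in> paulis n \<Longrightarrow> fmat_of W * fmat_of W = idm (2 ^ n)"
proof -
  assume W: "W \<in> paulis n"
  note c = paulis_carrier[OF W]
  have "W * W = 1\<^sub>m (2 ^ n)"
    using c paulis_square[OF W] by (intro eq_matI) (auto simp: scalar_prod_def atLeast0LessThan)
  then show ?thesis using c by (metis carrier_matD emb_mult emb_one)
qed

lemma pauli_opb: "W \<in> paulis n \<Longrightarrow> opb 1 (fmat_of W)"
  by (rule unitary_opb(1)[of "2 ^ n"]) (simp add: unitary_def pauli_supp pauli_adj pauli_square)

lemma pauli_inner_sum:
  assumes X: "supp (2 ^ n) X" "adj X = X"
  shows "(\<Sum>W\<in>paulis n. inner (fmat_of W) X *\<^sub>R fmat_of W) = 2 ^ n *\<^sub>R X"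
proof (rule fmat_eqI)
  fix a b
  let ?D = "2 ^ n :: nat"
  have Xh: "cnj (ent X i j) = ent X j i" for i j using X(2) by (metis ent_adj)
  have real: "complex_of_real (inner (fmat_of W) X) = (\<Sum>i<?D. \<Sum>j<?D. W $$ (j, i) * ent X i j)" if W: "W \<in> paulis n" for W
  proof -
    let ?z = "\<Sum>i<?D. \<Sum>j<?D. W $$ (j, i) * ent X i j"
    have "inner (fmat_of W) X = Re (\<Sum>i<?D. \<Sum>j<?D. cnj (ent (fmat_of W) i j) * ent X i j)"
      by (rule inner_fmat_Re) (simp add: X)
    also have "(\<Sum>i<?D. \<Sum>j<?D. cnj (ent (fmat_of W) i j) * ent X i j) = ?z"
    proof (intro sum.cong refl)
      fix i j assume "i \<in> {..<?D}" "j \<in> {..<?D}"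
      then show "cnj (ent (fmat_of W) i j) * ent X i j = W $$ (j, i) * ent X i j"
        using paulis_herm[OF W, of j i] paulis_carrier[OF W] by (simp add: ent_emb)
    qed
    finally have 1: "inner (fmat_of W) X = Re ?z" .
    have "cnj ?z = (\<Sum>i<?D. \<Sum>j<?D. W $$ (i, j) * ent X j i)"
      unfolding cnj_sum
    proof (intro sum.cong refl)
      fix i j assume "i \<in> {..<?D}" "j \<in> {..<?D}"
      then show "cnj (W $$ (j, i) * ent X i j) = W $$ (i, j) * ent X j i"
        using paulis_herm[OF W, of i j] by (simp add: Xh)
    qed
    also have "\<dots> = ?z" by (rule sum.swap)
    finally have "?z \<in> \<real>" by (simp add: Reals_cnj_iff)
    then show ?thesis unfolding 1 by (rule of_real_Re)
  qed
  show "ent (\<Sum>W\<in>paulis n. inner (fmat_of W) X *\<^sub>R fmat_of W) a b = ent (2 ^ n *\<^sub>R X) a b"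
  proof (cases "a < ?D \<and> b < ?D")
    case True
    have "ent (\<Sum>W\<in>paulis n. inner (fmat_of W) X *\<^sub>R fmat_of W) a b
        = (\<Sum>W\<in>paulis n. \<Sum>i<?D. \<Sum>j<?D. W $$ (j, i) * W $$ (a, b) * ent X i j)"
      unfolding ent_sum
    proof (rule sum.cong[OF refl])
      fix W assume W: "W \<in> paulis n"
      have "ent (inner (fmat_of W) X *\<^sub>R fmat_of W) a b = (\<Sum>i<?D. \<Sum>j<?D. W $$ (j, i) * ent X i j) * W $$ (a, b)"
        using True paulis_carrier[OF W] by (simp add: ent_emb scaleR_conv_of_real real[OF W])
      also have "\<dots> = (\<Sum>i<?D. \<Sum>j<?D. W $$ (j, i) * W $$ (a, b) * ent X i j)"
        unfolding sum_distrib_right by (intro sum.cong refl) (simp only: mult_ac)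
      finally show "ent (inner (fmat_of W) X *\<^sub>R fmat_of W) a b = \<dots>" .
    qed
    also have "\<dots> = (\<Sum>i<?D. \<Sum>W\<in>paulis n. \<Sum>j<?D. W $$ (j, i) * W $$ (a, b) * ent X i j)" by (rule sum.swap)
    also have "\<dots> = (\<Sum>i<?D. \<Sum>j<?D. \<Sum>W\<in>paulis n. W $$ (j, i) * W $$ (a, b) * ent X i j)"
      by (rule sum.cong[OF refl], rule sum.swap)
    also have "\<dots> = (\<Sum>i<?D. \<Sum>j<?D. if j = b then (if i = a then 2 ^ n * ent X i j else 0) else 0)"
      using True by (intro sum.cong refl) (simp add: sum_distrib_right[symmetric] paulis_complete)
    also have "\<dots> = 2 ^ n * ent X a b" using True by simp
    finally show ?thesis by (simp add: scaleR_conv_of_real)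
  next
    case False
    have "ent (\<Sum>W\<in>paulis n. inner (fmat_of W) X *\<^sub>R fmat_of W) a b = 0"
      unfolding ent_sum using False by (intro sum.neutral) (auto simp: suppD[OF pauli_supp] not_less)
    moreover have "ent X a b = 0" using False suppD[OF X(1)] by (auto simp: not_less)
    ultimately show ?thesis by simp
  qed
qed

text \<open>Divided by the number 4^n of Pauli matrices, the mean squared coefficient is the squared
  norm over d. So the sampling form scaled by d/m has the squared norm as its mean.\<close>

lemma pauli_parseval:
  assumes X: "supp (2 ^ n) X" "adj X = X"
  shows "(\<Sum>W\<in>paulis n. (inner (fmat_of W) X)\<^sup>2) = 2 ^ n * (norm X)\<^sup>2"
proof -
  have "(\<Sum>W\<in>paulis n. (inner (fmat_of W) X)\<^sup>2) = inner (\<Sum>W\<in>paulis n. inner (fmat_of W) X *\<^sub>R fmat_of W) X"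
    by (simp add: inner_sum_left power2_eq_square)
  also have "\<dots> = 2 ^ n * (norm X)\<^sup>2" unfolding pauli_inner_sum[OF X] by (simp add: power2_norm_eq_inner)
  finally show ?thesis .
qed

lemma card_single_qubit: "card single_qubit_paulis = 4"
proof -
  have c: "- \<i> \<noteq> \<i>" "\<i> \<noteq> - \<i>" "(1::complex) \<noteq> -1" "(-1::complex) \<noteq> 1" "\<i> \<noteq> 1" "1 \<noteq> \<i>" "- \<i> \<noteq> 1" "1 \<noteq> - \<i>"
    by (auto simp: complex_eq_iff)
  show ?thesis unfolding single_qubit_paulis_def by (simp add: single_qubit_distinct c)
qed

lemma card_paulis: "card (paulis n) = 4 ^ n"
proof (induction n)
  case (Suc n)
  have im: "paulis (Suc n) = (\<lambda>(P, V). kronecker P V) ` (single_qubit_paulis \<times> paulis n)" by auto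
  show ?case unfolding im card_image[OF kronecker_paulis_inj] by (simp add: card_cartesian_product card_single_qubit Suc)
qed simp

section \<open>Rademacher sums of Pauli matrices\<close>

definition signs :: "'a set \<Rightarrow> ('a \<Rightarrow> real) set" where "signs I = PiE I (\<lambda>_. {-1, 1})"

lemma card_signs: "finite I \<Longrightarrow> card (signs I) = 2 ^ card I"
  by (simp add: signs_def card_PiE numeral_2_eq_2)

lemma sum_signs_prod: "finite I \<Longrightarrow> (\<Sum>s\<in>signs I. \<Prod>i\<in>I. f i (s i)) = (\<Prod>i\<in>I. f i (-1) + f i (1::real) :: real)"
  unfolding signs_def by (subst prod_sum_PiE[symmetric]) auto

definition words :: "'a set \<Rightarrow> nat \<Rightarrow> 'a list set" where "words I k = {w. set w \<subseteq> I \<and> length w = k}"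

lemma sum_words_Suc: "(\<Sum>w\<in>words I (Suc k). f w) = (\<Sum>i\<in>I. \<Sum>w\<in>words I k. f (i # w))"
proof -
  have "words I (Suc k) = (\<lambda>(i, w). i # w) ` (I \<times> words I k)"
    by (auto simp: words_def length_Suc_conv image_iff)
  moreover have "inj_on (\<lambda>(i, w). i # w) (I \<times> words I k)" by (auto simp: inj_on_def)
  ultimately show ?thesis by (simp add: sum.reindex sum.cartesian_product case_prod_unfold comp_def)
qed

lemma words_0: "words I 0 = {[]}"
  by (auto simp: words_def)

lemma power_sum_words: "(\<Sum>i\<in>I. x i) ^ k = (\<Sum>w\<in>words I k. prod_list (map x w))"
  for x :: "'a \<Rightarrow> 'b::comm_semiring_1"
proof (induction k)
  case (Suc k)
  have "(\<Sum>i\<in>I. x i) ^ Suc k = (\<Sum>i\<in>I. x i) * (\<Sum>w\<in>words I k. prod_list (map x w))" by (simp add: Suc)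
  also have "\<dots> = (\<Sum>i\<in>I. \<Sum>w\<in>words I k. x i * prod_list (map x w))" by (rule sum_product)
  finally show ?case by (simp add: sum_words_Suc)
qed (simp add: words_0)

lemma funpow_sum_words:
  fixes W :: "'a \<Rightarrow> fmat"
  shows "((*) (\<Sum>i\<in>I. x i *\<^sub>R W i) ^^ k) Y = (\<Sum>w\<in>words I k. prod_list (map x w) *\<^sub>R foldr (\<lambda>i A. W i * A) w Y)"
proof (induction k)
  case (Suc k)
  then show ?case
    by (simp add: sum_words_Suc sum_distrib_left sum_distrib_right scaleR_sum_right)
qed (simp add: words_0)

lemma prod_list_signs:
  fixes s :: "'a \<Rightarrow> real"
  assumes "finite I" "set w \<subseteq> I"
  shows "prod_list (map s w) = (\<Prod>i\<in>I. s i ^ count_list w i)"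
  using assms(2)
proof (induction w)
  case (Cons a w)
  have "(\<Prod>i\<in>I. s i ^ count_list (a # w) i) = (\<Prod>i\<in>I. (if i = a then s i else 1) * s i ^ count_list w i)"
    by (rule prod.cong) auto
  also have "\<dots> = s a * (\<Prod>i\<in>I. s i ^ count_list w i)"
    using Cons.prems assms(1) by (simp add: prod.distrib prod.delta)
  finally show ?case using Cons by simp
qed simp

lemma sum_signs_word_nonneg:
  assumes "finite I" "set w \<subseteq> I"
  shows "0 \<le> (\<Sum>s\<in>signs I. prod_list (map s w))"
proof -
  have "(\<Sum>s\<in>signs I. prod_list (map s w)) = (\<Prod>i\<in>I. (- 1) ^ count_list w i + 1 ^ count_list w i)"
    unfolding prod_list_signs[OF assms] by (rule sum_signs_prod[OF assms(1)])
  also have "0 \<le> \<dots>" by (intro prod_nonneg) (simp add: minus_one_power_iff)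
  finally show ?thesis .
qed

lemma prod_list_map_mult: "prod_list (map (\<lambda>i. x i * y i) w) = prod_list (map x w) * prod_list (map y w)"
  for x y :: "'a \<Rightarrow> real"
  by (induction w) auto

lemma norm_foldr_mult_le:
  fixes W :: "'a \<Rightarrow> fmat"
  assumes "\<And>i. i \<in> I \<Longrightarrow> opb 1 (W i)" "set w \<subseteq> I"
  shows "norm (foldr (\<lambda>i A. W i * A) w Y) \<le> norm Y"
  using assms(2)
proof (induction w)
  case (Cons a w)
  then have "norm (W a * foldr (\<lambda>i A. W i * A) w Y) \<le> 1 * norm (foldr (\<lambda>i A. W i * A) w Y)"
    using assms(1)[of a] by (simp add: opb_def)
  then show ?case using Cons by simp
qed simp

text \<open>After averaging over the signs only the words with even multiplicities survive, with
  nonnegative weight, so contractions behave no worse than the number \<open>1\<close>.\<close>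

lemma matrix_moment_le_scalar_moment:
  fixes W :: "'a \<Rightarrow> fmat"
  assumes I: "finite I" and W: "\<And>i. i \<in> I \<Longrightarrow> opb 1 (W i)"
  shows "(\<Sum>s\<in>signs I. (norm (((*) (\<Sum>i\<in>I. (s i * a i) *\<^sub>R W i) ^^ k) Y))\<^sup>2)
    \<le> (norm Y)\<^sup>2 * (\<Sum>s\<in>signs I. (\<Sum>i\<in>I. s i * \<bar>a i\<bar>) ^ (2 * k))"
proof -
  let ?F = "\<lambda>w. foldr (\<lambda>i A. W i * A) w Y"
  let ?p = "\<lambda>x w. prod_list (map x w)"
  let ?w = "words I k"
  have "(norm (((*) (\<Sum>i\<in>I. (s i * a i) *\<^sub>R W i) ^^ k) Y))\<^sup>2
      = (\<Sum>w\<in>?w. \<Sum>v\<in>?w. ?p s (w @ v) * (?p a (w @ v) * inner (?F w) (?F v)))" for s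
    unfolding power2_norm_eq_inner funpow_sum_words inner_sum_left inner_sum_right
    by (subst sum.swap) (simp add: prod_list_map_mult inner_commute mult_ac)
  then have "(\<Sum>s\<in>signs I. (norm (((*) (\<Sum>i\<in>I. (s i * a i) *\<^sub>R W i) ^^ k) Y))\<^sup>2)
      = (\<Sum>s\<in>signs I. \<Sum>w\<in>?w. \<Sum>v\<in>?w. ?p s (w @ v) * (?p a (w @ v) * inner (?F w) (?F v)))" by simp
  also have "\<dots> = (\<Sum>w\<in>?w. \<Sum>v\<in>?w. (\<Sum>s\<in>signs I. ?p s (w @ v)) * (?p a (w @ v) * inner (?F w) (?F v)))"
    by (subst sum.swap, rule sum.cong[OF refl], subst sum.swap) (simp only: sum_distrib_right)
  also have "\<dots> \<le> (\<Sum>w\<in>?w. \<Sum>v\<in>?w. (\<Sum>s\<in>signs I. ?p s (w @ v)) * (?p (\<lambda>i. \<bar>a i\<bar>) (w @ v) * (norm Y)\<^sup>2))"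
  proof (intro sum_mono mult_left_mono sum_signs_word_nonneg I)
    fix w v assume wv: "w \<in> ?w" "v \<in> ?w"
    have abs: "\<bar>?p a u\<bar> = ?p (\<lambda>i. \<bar>a i\<bar>) u" for u by (induction u) (auto simp: abs_mult)
    have "\<bar>inner (?F w) (?F v)\<bar> \<le> norm (?F w) * norm (?F v)" by (rule Cauchy_Schwarz_ineq2)
    also have "\<dots> \<le> norm Y * norm Y"
      using wv by (intro mult_mono norm_foldr_mult_le[OF W]) (auto simp: words_def)
    finally have "\<bar>inner (?F w) (?F v)\<bar> \<le> (norm Y)\<^sup>2" by (simp add: power2_eq_square)
    then have "\<bar>?p a (w @ v)\<bar> * \<bar>inner (?F w) (?F v)\<bar> \<le> \<bar>?p a (w @ v)\<bar> * (norm Y)\<^sup>2"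
      by (rule mult_left_mono) simp
    then have "\<bar>?p a (w @ v) * inner (?F w) (?F v)\<bar> \<le> ?p (\<lambda>i. \<bar>a i\<bar>) (w @ v) * (norm Y)\<^sup>2"
      by (simp only: abs abs_mult)
    then show "?p a (w @ v) * inner (?F w) (?F v) \<le> ?p (\<lambda>i. \<bar>a i\<bar>) (w @ v) * (norm Y)\<^sup>2"
      by (rule order_trans[OF abs_ge_self])
    show "set (w @ v) \<subseteq> I" using wv by (auto simp: words_def)
  qed
  \<comment> \<open>With the bound uniform over words, the sum reassembles into the even moment of a
    scalar Rademacher sum.\<close>
  also have "\<dots> = (norm Y)\<^sup>2 * (\<Sum>s\<in>signs I. \<Sum>w\<in>?w. \<Sum>v\<in>?w. ?p (\<lambda>i. s i * \<bar>a i\<bar>) w * ?p (\<lambda>i. s i * \<bar>a i\<bar>) v)"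
  proof -
    have "(\<Sum>s\<in>signs I. \<Sum>w\<in>?w. \<Sum>v\<in>?w. ?p (\<lambda>i. s i * \<bar>a i\<bar>) w * ?p (\<lambda>i. s i * \<bar>a i\<bar>) v)
        = (\<Sum>w\<in>?w. \<Sum>v\<in>?w. \<Sum>s\<in>signs I. ?p s (w @ v) * ?p (\<lambda>i. \<bar>a i\<bar>) (w @ v))"
      by (subst sum.swap, rule sum.cong[OF refl], subst sum.swap) (simp add: prod_list_map_mult mult_ac)
    then show ?thesis by (simp add: sum_distrib_left sum_distrib_right mult_ac)
  qed
  also have "(\<Sum>s\<in>signs I. \<Sum>w\<in>?w. \<Sum>v\<in>?w. ?p (\<lambda>i. s i * \<bar>a i\<bar>) w * ?p (\<lambda>i. s i * \<bar>a i\<bar>) v)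
      = (\<Sum>s\<in>signs I. (\<Sum>i\<in>I. s i * \<bar>a i\<bar>) ^ (2 * k))"
    by (simp add: power_mult[of _ 2 k] mult.commute[of 2 k] power_mult power2_eq_square power_sum_words sum_product)
  finally show ?thesis .
qed

section \<open>Moments of scalar Rademacher sums\<close>

lemma exp_minus_le: "0 \<le> x \<Longrightarrow> exp (- x) \<le> 1 - x + x\<^sup>2" for x :: real
proof -
  assume x: "0 \<le> x"
  have "exp (- x) = 1 / exp x" by (simp add: exp_minus field_simps)
  also have "\<dots> \<le> 1 / (1 + x)" using x by (intro divide_left_mono exp_ge_add_one_self) auto
  also have "\<dots> \<le> 1 - x + x\<^sup>2"
  proof -
    have "(1 - x + x\<^sup>2) * (1 + x) = 1 + x ^ 3" by (simp add: algebra_simps power2_eq_square power3_eq_cube)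
    then show ?thesis using x by (simp add: divide_le_eq)
  qed
  finally show ?thesis .
qed

lemma exp_add_exp_minus_le: "exp x + exp (- x) \<le> 2 * exp (x\<^sup>2)" for x :: real
proof -
  have *: "exp x + exp (- x) \<le> 2 * exp (x\<^sup>2)" if x: "0 \<le> x" for x :: real
  proof (cases "x \<le> 1")
    case True
    have "exp x + exp (- x) \<le> 2 * (1 + x\<^sup>2)" using exp_bound[OF x True] exp_minus_le[OF x] by simp
    also have "\<dots> \<le> 2 * exp (x\<^sup>2)" by (intro mult_left_mono exp_ge_add_one_self) simp
    finally show ?thesis .
  next
    case False
    then have "exp x \<le> exp (x\<^sup>2)" "exp (- x) \<le> exp (x\<^sup>2)"
      using x mult_left_mono[of 1 x x] by (auto simp: power2_eq_square intro: order_trans[of _ 0])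
    then show ?thesis by linarith
  qed
  show ?thesis using *[of x] *[of "- x"] by (cases "0 \<le> x") auto
qed

lemma power_le_fact_exp: "0 \<le> y \<Longrightarrow> y ^ n \<le> fact n * exp y" for y :: real
proof -
  assume y: "0 \<le> y"
  have "y ^ n /\<^sub>R fact n \<le> (\<Sum>k. y ^ k /\<^sub>R fact k)"
    using sum_le_suminf[OF summable_exp_generic[of y], of "{n}"] y by simp
  then have "y ^ n / fact n \<le> exp y" by (simp add: exp_def divide_inverse mult.commute)
  then show ?thesis by (simp add: field_simps)
qed

text \<open>One term of the exponential series bounds the even power by (2k)! t^(-2k) times exp (t
  x) + exp (-t x), whose mean is controlled by independence of the signs.\<close>

lemma rademacher_moment:
  assumes I: "finite I" and k: "1 \<le> k"
  shows "(\<Sum>s\<in>signs I. (\<Sum>i\<in>I. s i * b i) ^ (2 * k)) \<le> 2 ^ card I * (2 * (4 * real k * exp 1 * (\<Sum>i\<in>I. (b i)\<^sup>2)) ^ k)"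
proof (cases "(\<Sum>i\<in>I. (b i)\<^sup>2) = 0")
  case True
  then have "b i = 0" if "i \<in> I" for i using I that by (simp add: sum_nonneg_eq_0_iff)
  then show ?thesis using k by (simp add: power_0_left)
next
  case False
  define \<sigma> where "\<sigma> = (\<Sum>i\<in>I. (b i)\<^sup>2)"
  have \<sigma>: "0 < \<sigma>" unfolding \<sigma>_def using False by (simp add: less_le sum_nonneg)
  \<comment> \<open>Chosen so that the moment generating function is at most exp k; together with
    (2k)! <= (2k)^(2k) this gives the base 4 k e.\<close>
  define t where "t = sqrt (k / \<sigma>)"
  have t: "0 < t" "t\<^sup>2 = k / \<sigma>" using k \<sigma> by (auto simp: t_def)
  have mgf: "(\<Sum>s\<in>signs I. exp (u * (\<Sum>i\<in>I. s i * b i))) \<le> 2 ^ card I * exp k" if u: "u\<^sup>2 = t\<^sup>2" for u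
  proof -
    have "(\<Sum>s\<in>signs I. exp (u * (\<Sum>i\<in>I. s i * b i))) = (\<Sum>s\<in>signs I. \<Prod>i\<in>I. exp (u * (s i * b i)))"
      using I by (simp add: sum_distrib_left exp_sum)
    also have "\<dots> = (\<Prod>i\<in>I. exp (u * (- 1 * b i)) + exp (u * (1 * b i)))"
      by (rule sum_signs_prod[OF I, of "\<lambda>i x. exp (u * (x * b i))"])
    also have "\<dots> \<le> (\<Prod>i\<in>I. 2 * exp ((u * b i)\<^sup>2))"
      by (intro prod_mono) (use exp_add_exp_minus_le[of "u * b _"] in \<open>auto simp: add.commute\<close>)
    also have "\<dots> = 2 ^ card I * exp (\<Sum>i\<in>I. (u * b i)\<^sup>2)" using I by (simp add: prod.distrib exp_sum)
    also have "(\<Sum>i\<in>I. (u * b i)\<^sup>2) = u\<^sup>2 * \<sigma>"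
      unfolding \<sigma>_def sum_distrib_left power_mult_distrib ..
    also have "u\<^sup>2 * \<sigma> = k" using \<sigma> by (simp add: u t(2))
    finally show ?thesis .
  qed
  have pt: "t ^ (2 * k) * x ^ (2 * k) \<le> fact (2 * k) * (exp (t * x) + exp (- t * x))" for x
  proof -
    have "t ^ (2 * k) * x ^ (2 * k) = \<bar>t * x\<bar> ^ (2 * k)" by (simp add: power_mult_distrib power_even_abs)
    also have "\<dots> \<le> fact (2 * k) * exp \<bar>t * x\<bar>" by (rule power_le_fact_exp) simp
    also have "\<dots> \<le> fact (2 * k) * (exp (t * x) + exp (- t * x))"
      by (intro mult_left_mono) (auto simp: abs_if)
    finally show ?thesis .
  qed
  have E: "t ^ (2 * k) * (\<Sum>s\<in>signs I. G s ^ (2 * k))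
      \<le> fact (2 * k) * ((\<Sum>s\<in>signs I. exp (t * G s)) + (\<Sum>s\<in>signs I. exp (- t * G s)))" for G :: "('a \<Rightarrow> real) \<Rightarrow> real"
  proof -
    have "t ^ (2 * k) * (\<Sum>s\<in>signs I. G s ^ (2 * k)) \<le> (\<Sum>s\<in>signs I. fact (2 * k) * (exp (t * G s) + exp (- t * G s)))"
      unfolding sum_distrib_left using pt by (rule sum_mono)
    also have "\<dots> = fact (2 * k) * ((\<Sum>s\<in>signs I. exp (t * G s)) + (\<Sum>s\<in>signs I. exp (- t * G s)))"
      by (simp only: sum_distrib_left sum.distrib distrib_left)
    finally show ?thesis .
  qed
  have "t ^ (2 * k) * (\<Sum>s\<in>signs I. (\<Sum>i\<in>I. s i * b i) ^ (2 * k))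
      \<le> fact (2 * k) * ((\<Sum>s\<in>signs I. exp (t * (\<Sum>i\<in>I. s i * b i))) + (\<Sum>s\<in>signs I. exp (- t * (\<Sum>i\<in>I. s i * b i))))"
    by (rule E)
  also have "\<dots> \<le> fact (2 * k) * (2 ^ card I * exp k + 2 ^ card I * exp k)"
    by (intro mult_left_mono add_mono mgf) auto
  also have "\<dots> \<le> real (2 * k) ^ (2 * k) * (2 * 2 ^ card I * exp k)"
    using fact_le_power[of "2 * k", where ?'a = real] by (intro mult_mono) (auto simp: algebra_simps)
  also have "\<dots> = 2 ^ card I * (2 * (4 * real k * exp 1 * real k) ^ k)"
  proof -
    have "(real (2 * k))\<^sup>2 = 4 * real k * real k" by (simp add: power2_eq_square)
    then have A: "real (2 * k) ^ (2 * k) = (4 * real k * real k) ^ k" by (simp only: power_mult)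
    have B: "exp (real k) = exp 1 ^ k" by (simp add: exp_of_nat_mult[symmetric])
    show ?thesis unfolding A B power_mult_distrib by (simp only: mult_ac)
  qed
  also have "\<dots> = t ^ (2 * k) * (2 ^ card I * (2 * (4 * real k * exp 1 * \<sigma>) ^ k))"
  proof -
    have A: "t ^ (2 * k) = (k / \<sigma>) ^ k" by (simp only: power_mult t(2))
    have "(k / \<sigma>) * (4 * real k * exp 1 * \<sigma>) = 4 * real k * exp 1 * real k" using \<sigma> by simp
    then have "(k / \<sigma>) ^ k * (4 * real k * exp 1 * \<sigma>) ^ k = (4 * real k * exp 1 * real k) ^ k"
      by (simp only: power_mult_distrib[symmetric])
    then show ?thesis unfolding A by (simp add: mult_ac)
  qed
  finally show ?thesis using t(1) unfolding \<sigma>_def[symmetric] by simp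
qed

text \<open>For self-adjoint \<open>Z\<close> the squared norm of Z^k Y is the inner product of Y
  with Z^(2k) Y, so Cauchy-Schwarz doubles the exponent. This is why only powers of two occur as
  exponents.\<close>

lemma self_adjoint_power_norm:
  assumes Z: "adj Z = Z"
  shows "norm Y * norm (Z * Y) ^ (2 ^ q) \<le> norm Y ^ (2 ^ q) * norm (((*) Z ^^ (2 ^ q)) Y)"
proof (cases "Y = 0")
  case False
  have shift: "inner (((*) Z ^^ j) A) B = inner A (((*) Z ^^ j) B)" for j A B
  proof (induction j arbitrary: B)
    case (Suc j)
    have "inner (((*) Z ^^ Suc j) A) B = inner (((*) Z ^^ j) A) (Z * B)" by (simp add: inner_mult_left Z)
    also have "\<dots> = inner A (((*) Z ^^ j) (Z * B))" by (rule Suc)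
    also have "((*) Z ^^ j) (Z * B) = ((*) Z ^^ Suc j) B" by (simp add: funpow_swap1)
    finally show ?case .
  qed simp
  show ?thesis
  proof (induction q)
    case (Suc q)
    let ?k = "2 ^ q :: nat"
    let ?f = "\<lambda>j. norm (((*) Z ^^ j) Y)"
    have "(?f ?k)\<^sup>2 = inner Y (((*) Z ^^ (?k + ?k)) Y)"
      unfolding power2_norm_eq_inner shift by (simp add: funpow_add)
    also have "\<dots> \<le> norm Y * ?f (2 * ?k)" unfolding mult_2[symmetric] by (rule norm_cauchy_schwarz)
    finally have 1: "(?f ?k)\<^sup>2 \<le> norm Y * ?f (2 * ?k)" .
    have "norm Y * (norm Y * norm (Z * Y) ^ (2 * ?k)) = (norm Y * norm (Z * Y) ^ ?k)\<^sup>2"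
      by (simp add: power_mult_distrib power2_eq_square mult_2 power_add)
    also have "\<dots> \<le> (norm Y ^ ?k * ?f ?k)\<^sup>2" using Suc by (intro power_mono) auto
    also have "\<dots> = norm Y ^ (2 * ?k) * (?f ?k)\<^sup>2" by (simp add: power_mult_distrib power_mult[symmetric] mult.commute)
    also have "\<dots> \<le> norm Y ^ (2 * ?k) * (norm Y * ?f (2 * ?k))" by (intro mult_left_mono 1) auto
    finally have "norm Y * (norm Y * norm (Z * Y) ^ (2 * ?k)) \<le> norm Y * (norm Y ^ (2 * ?k) * ?f (2 * ?k))"
      by (simp add: mult_ac)
    then show ?case using False by simp
  qed simp
qed simp

lemma onorm_mult_0: "onorm ((*) (0::fmat)) = 0"
proof -
  have "(*) (0::fmat) = (\<lambda>_. 0)" by auto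
  then show ?thesis by (simp add: onorm_zero)
qed

text \<open>The operator norm of a power of a self-adjoint matrix is the power of its operator norm,
  and the Frobenius norm dominates it. Started at \<open>idm d\<close>, the iteration produces the
  power itself, whose norm \<open>matrix_moment_le_scalar_moment\<close> can average.\<close>

lemma onorm_power_le:
  assumes Z: "adj Z = Z" "supp d Z"
  shows "onorm ((*) Z) ^ (2 ^ q) \<le> norm (((*) Z ^^ (2 ^ q)) (idm d))"
proof -
  let ?k = "2 ^ q :: nat"
  let ?N = "norm (((*) Z ^^ ?k) (idm d))"
  have k: "0 < ?k" by simp
  have eq: "((*) Z ^^ j) (idm d) * Y = ((*) Z ^^ j) (idm d * Y)" for j Y
    by (induction j) (simp_all add: mult.assoc)
  have ZI: "Z * (idm d * Y) = Z * Y" for Y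
    using mult_idm[of d Z] suppD[OF Z(2)] by (simp add: mult.assoc[symmetric])
  have P: "proj (idm d)" by (simp add: proj_def idm_mult ent_idm)
  have "norm (Z * Y) \<le> root ?k ?N * norm Y" for Y
  proof -
    let ?Y = "idm d * Y"
    have "norm (Z * ?Y) ^ ?k \<le> ?N * norm ?Y ^ ?k"
    proof (cases "?Y = 0")
      case False
      have "norm (((*) Z ^^ ?k) ?Y) \<le> ?N * norm ?Y"
        using norm_mult_ineq[of "((*) Z ^^ ?k) (idm d)" ?Y] by (simp add: eq projD(3)[OF P])
      then have "norm ?Y ^ ?k * norm (((*) Z ^^ ?k) ?Y) \<le> norm ?Y ^ ?k * (?N * norm ?Y)"
        by (rule mult_left_mono) simp
      then have "norm ?Y * norm (Z * ?Y) ^ ?k \<le> norm ?Y * (?N * norm ?Y ^ ?k)"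
        using self_adjoint_power_norm[OF Z(1), of ?Y q] by (simp add: mult_ac)
      then show ?thesis using False by simp
    qed (simp add: power_0_left)
    also have "\<dots> \<le> ?N * norm Y ^ ?k"
      by (intro mult_left_mono power_mono norm_proj_le(1)[OF P]) auto
    finally have "norm (Z * Y) ^ ?k \<le> ?N * norm Y ^ ?k" by (simp only: ZI)
    then have "root ?k (norm (Z * Y) ^ ?k) \<le> root ?k (?N * norm Y ^ ?k)" by simp
    then show ?thesis using k by (simp add: real_root_mult real_root_power_cancel)
  qed
  then have "onorm ((*) Z) \<le> root ?k ?N"
    by (intro onorm_bound) (auto simp: mult.commute)
  then have "onorm ((*) Z) ^ ?k \<le> root ?k ?N ^ ?k"
    by (intro power_mono onorm_pos_le bounded_linear_mult_right)
  then show ?thesis by (simp add: real_root_pow_pos2)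
qed

lemma power_of_two_between: "1 \<le> n \<Longrightarrow> \<exists>q. n \<le> 2 ^ q \<and> 2 ^ q \<le> 2 * (n::nat)"
proof (induction n rule: less_induct)
  case (less n)
  show ?case
  proof (cases "n = 1")
    case True
    then show ?thesis by (intro exI[of _ 0]) simp
  next
    case False
    then have "(n + 1) div 2 < n" "1 \<le> (n + 1) div 2" using less.prems by linarith+
    then obtain q where q: "(n + 1) div 2 \<le> 2 ^ q" "2 ^ q \<le> 2 * ((n + 1) div 2)"
      using less.IH[of "(n + 1) div 2"] by blast
    show ?thesis
    proof (cases "n \<le> 2 ^ q")
      case True
      have "2 ^ q \<le> n + 1" using q by linarith
      then show ?thesis using True less.prems by (intro exI[of _ q]) auto
    next
      case False
      then show ?thesis using q by (intro exI[of _ "Suc q"]) auto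
    qed
  qed
qed

text \<open>Passing to the Frobenius norm costs the dimension 2^n. At an exponent k between n and 2n
  this is at most a constant to the power k, so only sqrt n remains of it.\<close>

theorem rademacher_pauli:
  fixes W :: "'a \<Rightarrow> fmat"
  assumes I: "finite I" and n: "1 \<le> n"
    and W: "\<And>i. i \<in> I \<Longrightarrow> opb 1 (W i)" "\<And>i. i \<in> I \<Longrightarrow> adj (W i) = W i" "\<And>i. i \<in> I \<Longrightarrow> supp (2 ^ n) (W i)"
  shows "(\<Sum>s\<in>signs I. onorm ((*) (\<Sum>i\<in>I. (s i * a i) *\<^sub>R W i))) \<le> 2 ^ card I * (20 * sqrt (n * (\<Sum>i\<in>I. (a i)\<^sup>2)))"
proof (cases "(\<Sum>i\<in>I. (a i)\<^sup>2) = 0")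
  case True
  then have "a i = 0" if "i \<in> I" for i using I that by (simp add: sum_nonneg_eq_0_iff)
  then show ?thesis by (simp add: onorm_mult_0)
next
  case False
  define \<sigma> where "\<sigma> = (\<Sum>i\<in>I. (a i)\<^sup>2)"
  have \<sigma>: "0 < \<sigma>" unfolding \<sigma>_def using False by (simp add: less_le sum_nonneg)
  obtain q where q: "n \<le> 2 ^ q" "2 ^ q \<le> 2 * n" using power_of_two_between[OF n] by blast
  define k where "k = (2 ^ q :: nat)"
  have k: "1 \<le> k" "n \<le> k" "k \<le> 2 * n" using q by (auto simp: k_def)
  define Z where "Z s = (\<Sum>i\<in>I. (s i * a i) *\<^sub>R W i)" for s
  \<comment> \<open>From k <= 2n and e <= 3, 4 k e \<sigma> <= 24 n \<sigma> <= M^2 / 4; the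
    remaining factor 4^k absorbs 2 * 2^n.\<close>
  define M where "M = 10 * sqrt (n * \<sigma>)"
  have M: "0 < M" "M\<^sup>2 = 100 * (n * \<sigma>)" using \<sigma> n by (auto simp: M_def power_mult_distrib)
  have Z: "adj (Z s) = Z s" "supp (2 ^ n) (Z s)" for s
    using W by (auto simp: Z_def adj_sum intro!: supp_sum)
  have "(\<Sum>s\<in>signs I. onorm ((*) (Z s)) ^ (2 * k)) \<le> (\<Sum>s\<in>signs I. (norm (((*) (Z s) ^^ k) (idm (2 ^ n))))\<^sup>2)"
  proof (rule sum_mono)
    fix s
    have "(onorm ((*) (Z s)) ^ k)\<^sup>2 \<le> (norm (((*) (Z s) ^^ k) (idm (2 ^ n))))\<^sup>2"
      unfolding k_def by (intro power_mono onorm_power_le Z zero_le_power onorm_pos_le bounded_linear_mult_right)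
    then show "onorm ((*) (Z s)) ^ (2 * k) \<le> (norm (((*) (Z s) ^^ k) (idm (2 ^ n))))\<^sup>2"
      by (simp add: power_mult[symmetric] mult.commute)
  qed
  also have "\<dots> \<le> (norm (idm (2 ^ n)))\<^sup>2 * (\<Sum>s\<in>signs I. (\<Sum>i\<in>I. s i * \<bar>a i\<bar>) ^ (2 * k))"
    unfolding Z_def by (rule matrix_moment_le_scalar_moment[OF I W(1)])
  also have "\<dots> \<le> 2 ^ n * (2 ^ card I * (2 * (4 * real k * exp 1 * \<sigma>) ^ k))"
    using rademacher_moment[OF I k(1), of "\<lambda>i. \<bar>a i\<bar>"] by (simp add: norm_idm_sq \<sigma>_def)
  also have "\<dots> \<le> 2 ^ card I * M ^ (2 * k)"
  proof -
    have "exp 1 \<le> (3::real)" by (rule exp_le)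
    then have "real k * exp 1 \<le> real (2 * n) * 3" using k(3) by (intro mult_mono) auto
    then have "4 * real k * exp 1 * \<sigma> \<le> 24 * n * \<sigma>" using \<sigma> by (intro mult_right_mono) auto
    also have "\<dots> \<le> M\<^sup>2 / 4" using \<sigma> n by (simp add: M(2))
    finally have a: "(4 * real k * exp 1 * \<sigma>) ^ k \<le> (M\<^sup>2 / 4) ^ k" using \<sigma> by (intro power_mono) auto
    have "2 ^ n * (2::real) \<le> 2 ^ (n + 1)" by simp
    also have "\<dots> \<le> 2 ^ (2 * k)" using k n by (intro power_increasing) auto
    finally have b: "2 ^ n * (2::real) \<le> 4 ^ k" by (simp add: power_mult)
    have "2 ^ n * 2 * (4 * real k * exp 1 * \<sigma>) ^ k \<le> 4 ^ k * (M\<^sup>2 / 4) ^ k"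
      using a b \<sigma> by (intro mult_mono) auto
    also have "\<dots> = M ^ (2 * k)" by (simp add: power_mult_distrib[symmetric] power_mult)
    finally show ?thesis by (simp add: mult_ac)
  qed
  finally have mom: "(\<Sum>s\<in>signs I. onorm ((*) (Z s)) ^ (2 * k)) \<le> 2 ^ card I * M ^ (2 * k)" .
  \<comment> \<open>This replaces taking a root of the moment: beyond \<open>M\<close> the high
    power dominates, and on average it contributes at most one more \<open>M\<close>.\<close>
  have trunc: "x \<le> M + x ^ (2 * k) / M ^ (2 * k - 1)" if x: "0 \<le> x" for x
  proof (cases "x \<le> M")
    case True
    moreover have "0 \<le> x ^ (2 * k) / M ^ (2 * k - 1)" using x M by simp
    ultimately show ?thesis by linarith
  next
    case False
    have "x * M ^ (2 * k - 1) \<le> x * x ^ (2 * k - 1)" using False x M by (intro mult_left_mono power_mono) auto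
    also have "\<dots> = x ^ (2 * k)" using k by (metis Suc_diff_1 mult_pos_pos not_one_le_zero power_Suc zero_less_numeral neq0_conv)
    finally have "x \<le> x ^ (2 * k) / M ^ (2 * k - 1)" using M by (simp add: field_simps)
    then show ?thesis using M by simp
  qed
  have "(\<Sum>s\<in>signs I. onorm ((*) (Z s))) \<le> (\<Sum>s\<in>signs I. M + onorm ((*) (Z s)) ^ (2 * k) / M ^ (2 * k - 1))"
    by (intro sum_mono trunc onorm_pos_le bounded_linear_mult_right)
  also have "\<dots> = 2 ^ card I * M + (\<Sum>s\<in>signs I. onorm ((*) (Z s)) ^ (2 * k)) / M ^ (2 * k - 1)"
    using I by (simp add: sum.distrib card_signs sum_divide_distrib)
  also have "\<dots> \<le> 2 ^ card I * M + 2 ^ card I * M ^ (2 * k) / M ^ (2 * k - 1)"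
    using mom M by (intro add_left_mono divide_right_mono) auto
  also have "M ^ (2 * k) = M * M ^ (2 * k - 1)"
    using k by (metis Suc_diff_1 mult_pos_pos not_one_le_zero power_Suc zero_less_numeral neq0_conv)
  also have "2 ^ card I * M + 2 ^ card I * (M * M ^ (2 * k - 1)) / M ^ (2 * k - 1) = 2 ^ card I * (2 * M)"
    using M(1) by simp
  finally show ?thesis unfolding Z_def \<sigma>_def[symmetric] by (simp add: M_def)
qed

section \<open>Packing numbers and fat shattering\<close>

text \<open>A partial map \<open>y\<close> encodes a fat-shattered set \<open>dom y\<close> together with its thresholds.\<close>

definition shattered :: "('x \<Rightarrow> real) set \<Rightarrow> 'x set \<Rightarrow> real set \<Rightarrow> real \<Rightarrow> ('x \<Rightarrow> real option) set" where
  "shattered F X G e = {y. dom y \<subseteq> X \<and> ran y \<subseteq> G \<and>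
     (\<forall>B\<subseteq>dom y. \<exists>f\<in>F. \<forall>x\<in>dom y. if x \<in> B then the (y x) + e \<le> f x else f x \<le> the (y x) - e)}"

lemma shatteredD:
  assumes "y \<in> shattered F X G e" "B \<subseteq> dom y"
  obtains f where "f \<in> F" "\<And>x. x \<in> B \<Longrightarrow> the (y x) + e \<le> f x"
    "\<And>x. x \<in> dom y \<Longrightarrow> x \<notin> B \<Longrightarrow> f x \<le> the (y x) - e"
proof -
  have "\<exists>f\<in>F. \<forall>x\<in>dom y. if x \<in> B then the (y x) + e \<le> f x else f x \<le> the (y x) - e"
    using assms unfolding shattered_def by blast
  then obtain f where "f \<in> F" "\<forall>x\<in>dom y. if x \<in> B then the (y x) + e \<le> f x else f x \<le> the (y x) - e" by blast
  then show ?thesis using that[of f] assms(2) by (metis subsetD)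
qed

lemma shattered_low: "y \<in> shattered F X G e \<Longrightarrow> x \<in> dom y \<Longrightarrow> \<exists>f\<in>F. f x \<le> the (y x) - e"
  using shatteredD[of y F X G e "{}"] by auto

lemma shattered_high: "y \<in> shattered F X G e \<Longrightarrow> x \<in> dom y \<Longrightarrow> \<exists>f\<in>F. the (y x) + e \<le> f x"
  using shatteredD[of y F X G e "dom y"] by auto

lemma shattered_mono: "F \<subseteq> F' \<Longrightarrow> shattered F X G e \<subseteq> shattered F' X G e"
  unfolding shattered_def by blast

text \<open>A partial map with at most D points is coded by D slots, each empty or holding a pair of
  point and value.\<close>

lemma small_maps_card:
  fixes X :: "'x set" and G :: "'y set"
  assumes X: "finite X" and G: "finite G"
  shows "finite {y. dom y \<subseteq> X \<and> ran y \<subseteq> G \<and> card (dom y) \<le> D}"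
    "card {y. dom y \<subseteq> X \<and> ran y \<subseteq> G \<and> card (dom y) \<le> D} \<le> (card X * card G + 1) ^ D"
proof -
  define Op where "Op = insert None (Some ` (X \<times> G))"
  define g :: "('x \<times> 'y) option list \<Rightarrow> 'x \<Rightarrow> 'y option" where "g xs = map_of (map the (filter (\<lambda>z. z \<noteq> None) xs))" for xs
  have Op: "finite Op" "card Op = card X * card G + 1"
    unfolding Op_def using X G by (auto simp: card_insert_if card_image card_cartesian_product)
  have sub: "{y. dom y \<subseteq> X \<and> ran y \<subseteq> G \<and> card (dom y) \<le> D} \<subseteq> g ` {xs. set xs \<subseteq> Op \<and> length xs = D}"
  proof
    fix y assume y: "y \<in> {y. dom y \<subseteq> X \<and> ran y \<subseteq> G \<and> card (dom y) \<le> D}"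
    then have fd: "finite (dom y)" using X finite_subset by blast
    then obtain xs where xs: "set xs = dom y" "distinct xs" using finite_distinct_list by blast
    define zs where "zs = map (\<lambda>x. (x, the (y x))) xs"
    have len: "length zs \<le> D" using y xs by (simp add: zs_def distinct_card[symmetric])
    have "map_of zs = y"
    proof
      fix x show "map_of zs x = y x"
        unfolding zs_def map_of_map_restrict using xs
        by (cases "x \<in> dom y") (auto simp: restrict_map_def)
    qed
    moreover define os where "os = map Some zs @ replicate (D - length zs) None"
    have "map the (filter (\<lambda>z. z \<noteq> None) os) = zs" by (simp add: os_def filter_map comp_def)
    ultimately have "g os = y" by (simp add: g_def)
    moreover have "set zs \<subseteq> X \<times> G" using y xs by (auto simp: zs_def ran_def dom_def)
    then have "set os \<subseteq> Op" "length os = D" using len by (auto simp: os_def Op_def)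
    ultimately show "y \<in> g ` {xs. set xs \<subseteq> Op \<and> length xs = D}" by blast
  qed
  have fin: "finite {xs. set xs \<subseteq> Op \<and> length xs = D}" by (rule finite_lists_length_eq[OF Op(1)])
  show "finite {y. dom y \<subseteq> X \<and> ran y \<subseteq> G \<and> card (dom y) \<le> D}"
    using sub fin finite_surj by blast
  have "card {y. dom y \<subseteq> X \<and> ran y \<subseteq> G \<and> card (dom y) \<le> D} \<le> card {xs. set xs \<subseteq> Op \<and> length xs = D}"
    by (rule surj_card_le[OF fin sub])
  also have "\<dots> = (card X * card G + 1) ^ D" by (simp add: card_lists_length_eq[OF Op(1)] Op(2))
  finally show "card {y. dom y \<subseteq> X \<and> ran y \<subseteq> G \<and> card (dom y) \<le> D} \<le> (card X * card G + 1) ^ D" .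
qed

lemma finite_shattered:
  assumes "finite X" "finite G" shows "finite (shattered F X G e)"
proof (rule finite_subset)
  show "shattered F X G e \<subseteq> {y. dom y \<subseteq> X \<and> ran y \<subseteq> G \<and> card (dom y) \<le> card X}"
    using assms by (auto simp: shattered_def card_mono)
  show "finite {y. dom y \<subseteq> X \<and> ran y \<subseteq> G \<and> card (dom y) \<le> card X}" by (rule small_maps_card(1)[OF assms])
qed

text \<open>A map shattered by both halves extends to \<open>x\<close> by the separating threshold \<open>a\<close>, and the
  extension is shattered by neither half alone.\<close>

lemma shattered_split:
  assumes fin: "finite X" "finite G" and e: "0 < e" and x: "x \<in> X" "a \<in> G"
    and F: "F1 \<subseteq> F" "F2 \<subseteq> F" and F1: "\<And>f. f \<in> F1 \<Longrightarrow> a + e \<le> f x" and F2: "\<And>f. f \<in> F2 \<Longrightarrow> f x \<le> a - e"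
  shows "card (shattered F1 X G e) + card (shattered F2 X G e) \<le> card (shattered F X G e)"
proof -
  let ?s = "\<lambda>F. shattered F X G e"
  let ?u = "\<lambda>y :: _ \<Rightarrow> real option. y(x \<mapsto> a)"
  note fs = finite_shattered[OF fin]
  have none: "y x = None" if y: "y \<in> ?s F1" "y \<in> ?s F2" for y
  proof (rule ccontr)
    assume "y x \<noteq> None"
    then have x: "x \<in> dom y" by auto
    obtain f where f: "f \<in> F1" "f x \<le> the (y x) - e" using shatteredD[OF y(1), of "{}"] x by auto
    obtain g where g: "g \<in> F2" "the (y x) + e \<le> g x" using shatteredD[OF y(2), of "dom y"] x by auto
    show False using F1[OF f(1)] F2[OF g(1)] f(2) g(2) e by linarith
  qed
  have up: "?u y \<in> ?s F" if y: "y \<in> ?s F1" "y \<in> ?s F2" for y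
  proof -
    have nx: "x \<notin> dom y" using none[OF y] by auto
    have "\<exists>f\<in>F. \<forall>z\<in>dom (?u y). if z \<in> B then the (?u y z) + e \<le> f z else f z \<le> the (?u y z) - e" if B: "B \<subseteq> dom (?u y)" for B
    proof (cases "x \<in> B")
      case True
      have "B - {x} \<subseteq> dom y" using B by auto
      then obtain f where f: "f \<in> F1" "\<And>z. z \<in> B - {x} \<Longrightarrow> the (y z) + e \<le> f z"
        "\<And>z. z \<in> dom y \<Longrightarrow> z \<notin> B - {x} \<Longrightarrow> f z \<le> the (y z) - e"
        using shatteredD[OF y(1)] by blast
      show ?thesis using F(1) f F1[OF f(1)] True nx by (intro bexI[of _ f]) auto
    next
      case False
      then have "B \<subseteq> dom y" using B by auto
      then obtain f where f: "f \<in> F2" "\<And>z. z \<in> B \<Longrightarrow> the (y z) + e \<le> f z"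
        "\<And>z. z \<in> dom y \<Longrightarrow> z \<notin> B \<Longrightarrow> f z \<le> the (y z) - e"
        using shatteredD[OF y(2)] by blast
      show ?thesis using F(2) f F2[OF f(1)] False nx by (intro bexI[of _ f]) auto
    qed
    moreover have "dom (?u y) \<subseteq> X" using y(1) x by (auto simp: shattered_def)
    moreover have "ran y \<subseteq> G" using y(1) by (auto simp: shattered_def)
    then have "ran (?u y) \<subseteq> G" using x(2) none[OF y] by (simp add: ran_map_upd)
    ultimately show ?thesis unfolding shattered_def by blast
  qed
  have notin: "?u y \<notin> ?s F1 \<union> ?s F2" for y
  proof
    have x: "x \<in> dom (?u y)" by simp
    assume "?u y \<in> ?s F1 \<union> ?s F2"
    then show False
    proof
      assume y: "?u y \<in> ?s F1"
      obtain f where f: "f \<in> F1" "f x \<le> the (?u y x) - e" using shattered_low[OF y x] by (elim bexE)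
      then show False using F1[OF f(1)] e by simp
    next
      assume y: "?u y \<in> ?s F2"
      obtain f where f: "f \<in> F2" "the (?u y x) + e \<le> f x" using shattered_high[OF y x] by (elim bexE)
      then show False using F2[OF f(1)] e by simp
    qed
  qed
  have inj: "inj_on ?u (?s F1 \<inter> ?s F2)"
    by (rule inj_onI) (metis IntE fun_upd_triv fun_upd_upd none)
  have "card (?s F1) + card (?s F2) = card (?s F1 \<union> ?s F2) + card (?u ` (?s F1 \<inter> ?s F2))"
    using card_Un_Int[of "?s F1" "?s F2"] fs by (simp add: card_image[OF inj])
  also have "\<dots> = card ((?s F1 \<union> ?s F2) \<union> ?u ` (?s F1 \<inter> ?s F2))"
    using notin fs by (intro card_Un_disjoint[symmetric]) auto
  also have "\<dots> \<le> card (?s F)"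
    using up shattered_mono[OF F(1)] shattered_mono[OF F(2)] by (intro card_mono fs) blast
  finally show ?thesis .
qed

text \<open>If some pair of point and threshold has many functions on either side, the counts for
  both sides add by \<open>shattered_split\<close>, which doubles the power of two. If no pair did,
  deleting the small side of every pair would still leave two functions, and nothing could separate
  them. The factor 2 in the assumed cardinality guarantees these survivors.\<close>

lemma packing_shatters:
  assumes fin: "finite X" "finite G" and e: "0 < e" and N: "2 \<le> card X * card G"
    and sep: "\<And>f g. f \<in> F \<Longrightarrow> g \<in> F \<Longrightarrow> f \<noteq> g \<Longrightarrow>
      \<exists>x\<in>X. \<exists>a\<in>G. (a + e \<le> f x \<and> g x \<le> a - e) \<or> (a + e \<le> g x \<and> f x \<le> a - e)"
    and F: "finite F" "(2 * (card X * card G)) ^ k \<le> card F"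
  shows "2 ^ k \<le> card (shattered F X G e)"
  using sep F
proof (induction k arbitrary: F)
  case 0
  then have "F \<noteq> {}" by auto
  then have "Map.empty \<in> shattered F X G e" by (auto simp: shattered_def)
  then have "0 < card (shattered F X G e)" using finite_shattered[OF fin] by (auto simp: card_gt_0_iff)
  then show ?case by simp
next
  case (Suc k)
  define N where "N = card X * card G"
  define M where "M = (2 * N) ^ k"
  let ?hi = "\<lambda>p. {f \<in> F. snd p + e \<le> f (fst p)}" and ?lo = "\<lambda>p. {f \<in> F. f (fst p) \<le> snd p - e}"
  have N2: "2 \<le> N" using N by (simp add: N_def)
  have M: "1 \<le> M" using N2 by (simp add: M_def)
  have cF: "2 * N * M \<le> card F" using Suc.prems(3) by (simp add: M_def N_def)
  have "\<exists>p\<in>X \<times> G. M \<le> card (?hi p) \<and> M \<le> card (?lo p)"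
  proof (rule ccontr)
    assume *: "\<not> ?thesis"
    \<comment> \<open>A side with fewer than \<open>M\<close> functions; under the assumption to be
      refuted every pair has one.\<close>
    define B where "B p = (if card (?hi p) < M then ?hi p else ?lo p)" for p
    have B1: "B p \<subseteq> F" and B3: "?hi p \<subseteq> B p \<or> ?lo p \<subseteq> B p" for p by (auto simp: B_def)
    have B2: "card (B p) < M" if p: "p \<in> X \<times> G" for p
    proof (cases "card (?hi p) < M")
      case False
      then have "card (?lo p) < M" using p * by (meson not_le)
      then show ?thesis using False by (simp add: B_def)
    qed (simp add: B_def)
    define R where "R = (\<Union>p\<in>X \<times> G. B p)"
    have "card R \<le> (\<Sum>p\<in>X \<times> G. card (B p))" unfolding R_def using fin by (intro card_UN_le) auto
    also have "\<dots> \<le> (\<Sum>p\<in>X \<times> G. M)" using B2 by (intro sum_mono) (auto intro: less_imp_le)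
    also have "\<dots> = N * M" by (simp add: N_def card_cartesian_product)
    finally have cR: "card R \<le> N * M" .
    have "R \<subseteq> F" unfolding R_def using B1 by blast
    then have "card (F - R) = card F - card R" using Suc.prems(2) by (meson card_Diff_subset finite_subset)
    moreover have "2 \<le> N * M" using N2 M mult_le_mono[of 2 N 1 M] by simp
    ultimately have "2 \<le> card (F - R)" using cR cF by linarith
    then obtain T where "T \<subseteq> F - R" "card T = 2" by (meson obtain_subset_with_card_n)
    then obtain f g where fg: "f \<in> F - R" "g \<in> F - R" "f \<noteq> g"
      by (metis card_2_iff insert_subset)
    then obtain x a where xa: "x \<in> X" "a \<in> G" "(a + e \<le> f x \<and> g x \<le> a - e) \<or> (a + e \<le> g x \<and> f x \<le> a - e)"
      using Suc.prems(1)[of f g] by blast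
    have "B (x, a) \<subseteq> R" unfolding R_def using xa by blast
    then show False using B3[of "(x, a)"] xa fg by auto
  qed
  then obtain p where p: "p \<in> X \<times> G" "M \<le> card (?hi p)" "M \<le> card (?lo p)" by blast
  have ind: "2 ^ k \<le> card (shattered H X G e)" if "H \<subseteq> F" "M \<le> card H" for H
  proof (rule Suc.IH)
    show "finite H" using that(1) Suc.prems(2) by (rule finite_subset)
    show "(2 * (card X * card G)) ^ k \<le> card H" using that(2) by (simp add: M_def N_def)
    show "\<exists>x\<in>X. \<exists>a\<in>G. (a + e \<le> f x \<and> g x \<le> a - e) \<or> (a + e \<le> g x \<and> f x \<le> a - e)"
      if "f \<in> H" "g \<in> H" "f \<noteq> g" for f g
      using Suc.prems(1)[of f g] that \<open>H \<subseteq> F\<close> by blast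
  qed
  have "2 ^ Suc k \<le> card (shattered (?hi p) X G e) + card (shattered (?lo p) X G e)"
    using ind[of "?hi p"] ind[of "?lo p"] p by auto
  also have "\<dots> \<le> card (shattered F X G e)"
    by (rule shattered_split[OF fin e, of "fst p" "snd p"]) (use p in auto)
  finally show ?case .
qed

text \<open>A maximal separated subset of \<open>K\<close> is a cover. If it were too large it would
  shatter at least 2^k partial maps, but all shattered maps have at most \<open>D\<close> points and
  there are fewer of these.\<close>

theorem fat_shattering_cover:
  fixes K :: "('x \<Rightarrow> real) set"
  assumes X: "finite X" "2 \<le> card X" and e: "0 < e"
    and bd: "\<And>f x. f \<in> K \<Longrightarrow> x \<in> X \<Longrightarrow> \<bar>f x\<bar> \<le> b"
    and fat: "\<And>G y. y \<in> shattered K X G e \<Longrightarrow> card (dom y) \<le> D"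
    and L: "b / (2 * e) \<le> real L" and k: "(card X * (2 * L + 1) + 1) ^ D < 2 ^ k"
  obtains C where "finite C" "C \<subseteq> K" "card C < (2 * (card X * (2 * L + 1))) ^ k"
    "\<And>f. f \<in> K \<Longrightarrow> \<exists>g\<in>C. \<forall>x\<in>X. \<bar>f x - g x\<bar> \<le> 4 * e"
proof -
  define G where "G = (\<lambda>j. 2 * e * of_int j) ` {- int L..int L}"
  have "inj_on (\<lambda>j::int. 2 * e * of_int j) {- int L..int L}" using e by (auto simp: inj_on_def)
  then have G: "finite G" "card G = 2 * L + 1" by (simp_all add: G_def card_image)
  let ?N = "card X * (2 * L + 1)"
  have N: "2 \<le> card X * card G" using X(2) mult_le_mono[of 2 "card X" 1 "2 * L + 1"] by (simp add: G(2))
  define pack where "pack C \<longleftrightarrow> finite C \<and> C \<subseteq> K \<and> (\<forall>f\<in>C. \<forall>g\<in>C. f \<noteq> g \<longrightarrow> (\<exists>x\<in>X. 4 * e < \<bar>f x - g x\<bar>))" for C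
  have sep1: "\<exists>a\<in>G. a + e \<le> f x \<and> g x \<le> a - e"
    if fg: "f \<in> K" "g \<in> K" "x \<in> X" "4 * e < f x - g x" for f g x
  proof -
    \<comment> \<open>The first grid point at or above g x + e. With spacing 2e it lies below g x +
      3e, so a gap of more than 4e leaves margin e on both sides.\<close>
    define j where "j = \<lceil>(g x + e) / (2 * e)\<rceil>"
    have j1: "(g x + e) / (2 * e) \<le> of_int j" "of_int j < (g x + e) / (2 * e) + 1"
      unfolding j_def by (rule le_of_int_ceiling, linarith)
    have a: "g x + e \<le> 2 * e * of_int j" "2 * e * of_int j < g x + 3 * e"
      using j1 e by (auto simp: field_simps)
    have b1: "\<bar>2 * e * of_int j\<bar> \<le> b"
      using a bd[OF fg(1,3)] bd[OF fg(2,3)] fg(4) e by (auto simp: abs_le_iff)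
    have "\<bar>real_of_int j\<bar> \<le> b / (2 * e)" using b1 e by (simp add: abs_mult field_simps)
    then have "\<bar>real_of_int j\<bar> \<le> L" using L by linarith
    then have "\<bar>j\<bar> \<le> int L" by linarith
    then have "2 * e * of_int j \<in> G" unfolding G_def by (intro image_eqI[of _ _ j]) auto
    then show ?thesis using a fg(4) by (intro bexI[of _ "2 * e * of_int j"]) auto
  qed
  have small: "card C < (2 * ?N) ^ k" if C: "pack C" for C
  proof (rule ccontr)
    assume "\<not> card C < (2 * ?N) ^ k"
    then have c: "(2 * (card X * card G)) ^ k \<le> card C" by (simp add: G(2))
    have "2 ^ k \<le> card (shattered C X G e)"
    proof (rule packing_shatters[OF X(1) G(1) e N _ _ c])
      fix f g assume fg: "f \<in> C" "g \<in> C" "f \<noteq> g"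
      then obtain x where x: "x \<in> X" "4 * e < \<bar>f x - g x\<bar>" using C unfolding pack_def by blast
      have K: "f \<in> K" "g \<in> K" using C fg unfolding pack_def by auto
      show "\<exists>x\<in>X. \<exists>a\<in>G. (a + e \<le> f x \<and> g x \<le> a - e) \<or> (a + e \<le> g x \<and> f x \<le> a - e)"
      proof (cases "4 * e < f x - g x")
        case True
        then show ?thesis using sep1[OF K x(1)] x(1) by blast
      next
        case False
        then have "4 * e < g x - f x" using x(2) by linarith
        then show ?thesis using sep1[OF K(2,1) x(1)] x(1) by blast
      qed
    qed (use C in \<open>simp add: pack_def\<close>)
    also have "\<dots> \<le> card {y. dom y \<subseteq> X \<and> ran y \<subseteq> G \<and> card (dom y) \<le> D}"
    proof (rule card_mono[OF small_maps_card(1)[OF X(1) G(1)]], rule subsetI)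
      fix y assume y: "y \<in> shattered C X G e"
      then have "y \<in> shattered K X G e" using shattered_mono[of C K] C by (auto simp: pack_def)
      then have "card (dom y) \<le> D" by (rule fat)
      then show "y \<in> {y. dom y \<subseteq> X \<and> ran y \<subseteq> G \<and> card (dom y) \<le> D}" using y by (simp add: shattered_def)
    qed
    also have "\<dots> \<le> (?N + 1) ^ D" using small_maps_card(2)[OF X(1) G(1), of D] by (simp add: G(2))
    finally show False using k by simp
  qed
  have "\<exists>C. pack C \<and> (\<forall>C'. pack C' \<longrightarrow> card C' \<le> card C)"
    by (rule ex_has_greatest_nat[of pack "{}" card "(2 * ?N) ^ k"])
      (use small in \<open>auto simp: pack_def intro: less_imp_le\<close>)
  then obtain C where C: "pack C" "\<And>C'. pack C' \<Longrightarrow> card C' \<le> card C" by blast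
  have "\<exists>g\<in>C. \<forall>x\<in>X. \<bar>f x - g x\<bar> \<le> 4 * e" if f: "f \<in> K" for f
  proof (rule ccontr)
    assume *: "\<not> ?thesis"
    then have far: "\<forall>g\<in>C. \<exists>x\<in>X. 4 * e < \<bar>f x - g x\<bar>" by (auto simp: not_le)
    then have nf: "f \<notin> C" using e by force
    have "pack (insert f C)"
      using C(1) f far unfolding pack_def by (auto simp: abs_minus_commute)
    then have "card (insert f C) \<le> card C" by (rule C(2))
    then show False using nf C(1) by (simp add: pack_def)
  qed
  then show ?thesis using that[of C] C(1) small[OF C(1)] by (auto simp: pack_def)
qed

section \<open>Uniform independent samples\<close>

definition samples :: "nat \<Rightarrow> 'w set \<Rightarrow> (nat \<Rightarrow> 'w) set" where "samples m \<W> = PiE {..<m} (\<lambda>_. \<W>)"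

lemma finite_samples: "finite \<W> \<Longrightarrow> finite (samples m \<W>)"
  by (simp add: samples_def finite_PiE)

lemma card_samples: "card (samples m \<W>) = card \<W> ^ m"
  by (simp add: samples_def card_PiE)

lemma samples_mem: "S \<in> samples m \<W> \<Longrightarrow> i < m \<Longrightarrow> S i \<in> \<W>"
  by (auto simp: samples_def)

lemma sum_samples_prod:
  "finite \<W> \<Longrightarrow> (\<Sum>S\<in>samples m \<W>. \<Prod>i<m. h i (S i)) = (\<Prod>i<m. \<Sum>W\<in>\<W>. h i W :: real)"
  unfolding samples_def by (subst prod_sum_PiE) auto

lemma sum_samples_coordinate:
  assumes \<W>: "finite \<W>" and i: "i < m"
  shows "real (card \<W>) * (\<Sum>S\<in>samples m \<W>. h (S i)) = real (card (samples m \<W>)) * (\<Sum>W\<in>\<W>. h W)"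
proof -
  have "(\<Sum>S\<in>samples m \<W>. h (S i)) = (\<Sum>S\<in>samples m \<W>. \<Prod>j<m. if j = i then h (S j) else 1)"
    using i by (simp add: prod.delta)
  also have "\<dots> = (\<Prod>j<m. \<Sum>W\<in>\<W>. if j = i then h W else 1)"
    by (rule sum_samples_prod[OF \<W>, where h = "\<lambda>j W. if j = i then h W else 1"])
  also have "\<dots> = (\<Prod>j<m. if j = i then \<Sum>W\<in>\<W>. h W else real (card \<W>))"
    by (rule prod.cong) auto
  also have "\<dots> = (\<Sum>W\<in>\<W>. h W) * real (card \<W>) ^ (m - 1)"
    using i by (simp add: prod.remove[of "{..<m}" i] card_Diff_singleton)
  finally show ?thesis
    using i by (simp add: card_samples) (metis One_nat_def Suc_pred mult.assoc mult.commute power_Suc less_nat_zero_code not_gr_zero)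
qed

lemma exponential_markov:
  assumes \<W>: "finite \<W>" and h: "(\<Sum>W\<in>\<W>. exp (h W)) \<le> card \<W> * exp (u :: real)"
  shows "card {S \<in> samples m \<W>. m * u + t < (\<Sum>i<m. h (S i))} \<le> card (samples m \<W>) * exp (- t)"
proof -
  let ?A = "{S \<in> samples m \<W>. m * u + t < (\<Sum>i<m. h (S i))}"
  have "card ?A * exp (m * u + t) = (\<Sum>S\<in>?A. exp (m * u + t))" by simp
  also have "\<dots> \<le> (\<Sum>S\<in>?A. exp (\<Sum>i<m. h (S i)))" by (intro sum_mono) auto
  also have "\<dots> \<le> (\<Sum>S\<in>samples m \<W>. exp (\<Sum>i<m. h (S i)))"
    using finite_samples[OF \<W>] by (intro sum_mono2) auto
  also have "\<dots> = (\<Prod>i<m. \<Sum>W\<in>\<W>. exp (h W))"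
    unfolding exp_sum[OF finite_lessThan] by (rule sum_samples_prod[OF \<W>])
  also have "\<dots> \<le> (card \<W> * exp u) ^ m"
    using h by (simp add: power_mono sum_nonneg)
  also have "\<dots> = card (samples m \<W>) * exp (m * u)"
    by (simp add: power_mult_distrib card_samples exp_of_nat_mult)
  finally have "card ?A * exp (m * u + t) * exp (- (m * u + t)) \<le> card (samples m \<W>) * exp (m * u) * exp (- (m * u + t))"
    by (rule mult_right_mono) simp
  then show ?thesis by (simp add: mult.assoc exp_add[symmetric])
qed

text \<open>The multiplicative part \<open>\<eta> \<mu>\<close> of the allowed deviation makes the tail bound independent of
  the variance of \<open>g\<close>.\<close>

lemma chernoff_samples:
  assumes \<W>: "finite \<W>" "\<W> \<noteq> {}" and g: "\<And>W. W \<in> \<W> \<Longrightarrow> 0 \<le> g W \<and> g W \<le> b" and b: "0 < b"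
    and \<eta>: "0 < \<eta>" "\<eta> \<le> 1" and \<mu>: "\<mu> = (\<Sum>W\<in>\<W>. g W) / card \<W>"
  shows "card {S \<in> samples m \<W>. m * (\<eta> * \<mu> + \<tau>) < \<bar>(\<Sum>i<m. g (S i)) - m * \<mu>\<bar>}
    \<le> 2 * card (samples m \<W>) * exp (- (\<eta> * m * \<tau> / b))"
proof -
  \<comment> \<open>This keeps s g <= \<eta> <= 1, so the quadratic term of the exponential is at
    most \<eta> times the linear one and disappears into the allowed deviation \<eta> \<mu>.\<close>
  define s where "s = \<eta> / b"
  have s: "0 < s" using \<eta> b by (simp add: s_def)
  have N: "0 < card \<W>" using \<W> by (simp add: card_gt_0_iff)
  have x: "0 \<le> s * g W \<and> s * g W \<le> \<eta>" if "W \<in> \<W>" for W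
    using g[OF that] s b \<eta> by (auto simp: s_def field_simps)
  have x2: "(s * g W)\<^sup>2 \<le> \<eta> * (s * g W)" if "W \<in> \<W>" for W
    using x[OF that] unfolding power2_eq_square by (intro mult_right_mono) auto
  have \<mu>': "(\<Sum>W\<in>\<W>. g W) = card \<W> * \<mu>" using N \<mu> by simp
  have lin: "(\<Sum>W\<in>\<W>. 1 + c * (s * g W)) = card \<W> * (1 + c * (s * \<mu>))" for c
    by (simp add: sum.distrib sum_distrib_left[symmetric] \<mu>' algebra_simps)
  have "(\<Sum>W\<in>\<W>. exp (s * g W)) \<le> (\<Sum>W\<in>\<W>. 1 + (1 + \<eta>) * (s * g W))"
  proof (rule sum_mono)
    fix W assume W: "W \<in> \<W>"
    have "exp (s * g W) \<le> 1 + s * g W + (s * g W)\<^sup>2" using x[OF W] \<eta> by (intro exp_bound) auto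
    then show "exp (s * g W) \<le> 1 + (1 + \<eta>) * (s * g W)" using x2[OF W] by (simp add: algebra_simps)
  qed
  also have "\<dots> \<le> card \<W> * exp ((1 + \<eta>) * (s * \<mu>))" unfolding lin by (intro mult_left_mono exp_ge_add_one_self) auto
  finally have up: "card {S \<in> samples m \<W>. m * ((1 + \<eta>) * (s * \<mu>)) + s * m * \<tau> < (\<Sum>i<m. s * g (S i))}
      \<le> card (samples m \<W>) * exp (- (s * m * \<tau>))"
    by (rule exponential_markov[OF \<W>(1)])
  have "(\<Sum>W\<in>\<W>. exp (- (s * g W))) \<le> (\<Sum>W\<in>\<W>. 1 + (- (1 - \<eta>)) * (s * g W))"
  proof (rule sum_mono)
    fix W assume W: "W \<in> \<W>"
    have "exp (- (s * g W)) \<le> 1 - s * g W + (s * g W)\<^sup>2" using x[OF W] by (intro exp_minus_le) auto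
    then show "exp (- (s * g W)) \<le> 1 + (- (1 - \<eta>)) * (s * g W)" using x2[OF W] by (simp add: algebra_simps)
  qed
  also have "\<dots> \<le> card \<W> * exp ((- (1 - \<eta>)) * (s * \<mu>))" unfolding lin by (intro mult_left_mono exp_ge_add_one_self) auto
  finally have lo: "card {S \<in> samples m \<W>. m * ((- (1 - \<eta>)) * (s * \<mu>)) + s * m * \<tau> < (\<Sum>i<m. - (s * g (S i)))}
      \<le> card (samples m \<W>) * exp (- (s * m * \<tau>))"
    by (rule exponential_markov[OF \<W>(1)])
  let ?U = "{S \<in> samples m \<W>. m * ((1 + \<eta>) * (s * \<mu>)) + s * m * \<tau> < (\<Sum>i<m. s * g (S i))}"
  let ?L = "{S \<in> samples m \<W>. m * ((- (1 - \<eta>)) * (s * \<mu>)) + s * m * \<tau> < (\<Sum>i<m. - (s * g (S i)))}"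
  have "{S \<in> samples m \<W>. m * (\<eta> * \<mu> + \<tau>) < \<bar>(\<Sum>i<m. g (S i)) - m * \<mu>\<bar>} \<subseteq> ?U \<union> ?L"
  proof
    fix S assume "S \<in> {S \<in> samples m \<W>. m * (\<eta> * \<mu> + \<tau>) < \<bar>(\<Sum>i<m. g (S i)) - m * \<mu>\<bar>}"
    then have S: "S \<in> samples m \<W>" and d: "m * (\<eta> * \<mu> + \<tau>) < \<bar>(\<Sum>i<m. g (S i)) - m * \<mu>\<bar>" by auto
    let ?G = "\<Sum>i<m. g (S i)"
    have "s * (m * (\<eta> * \<mu> + \<tau>)) < s * (?G - m * \<mu>) \<or> s * (m * (\<eta> * \<mu> + \<tau>)) < s * (m * \<mu> - ?G)"
      using d s by (auto simp: abs_if split: if_splits)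
    then show "S \<in> ?U \<union> ?L"
      using S by (auto simp: sum_distrib_left[symmetric] sum_negf algebra_simps)
  qed
  then have "card {S \<in> samples m \<W>. m * (\<eta> * \<mu> + \<tau>) < \<bar>(\<Sum>i<m. g (S i)) - m * \<mu>\<bar>} \<le> card (?U \<union> ?L)"
    using finite_samples[OF \<W>(1)] by (intro card_mono) auto
  also have "\<dots> \<le> card ?U + card ?L" by (rule card_Un_le)
  finally have "real (card {S \<in> samples m \<W>. m * (\<eta> * \<mu> + \<tau>) < \<bar>(\<Sum>i<m. g (S i)) - m * \<mu>\<bar>}) \<le> real (card ?U) + real (card ?L)"
    by linarith
  also have "\<dots> \<le> 2 * (card (samples m \<W>) * exp (- (s * m * \<tau>)))" using up lo by linarith
  also have "s * m * \<tau> = \<eta> * m * \<tau> / b" by (simp add: s_def)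
  finally show ?thesis by simp
qed

section \<open>Symmetrization and the mean error of the initialization\<close>

lemma onorm_mult_add: "onorm ((*) (A + B)) \<le> onorm ((*) A) + onorm ((*) (B::fmat))"
proof -
  have "(*) (A + B) = (\<lambda>x. A * x + B * x)" by (rule ext) (rule distrib_right)
  then show ?thesis using onorm_triangle[OF bounded_linear_mult_right bounded_linear_mult_right, of A B] by simp
qed

lemma onorm_mult_scaleR: "onorm ((*) (a *\<^sub>R A)) = \<bar>a\<bar> * onorm ((*) (A::fmat))"
proof -
  have "(*) (a *\<^sub>R A) = (\<lambda>x. a *\<^sub>R (A * x))" by (rule ext) simp
  then show ?thesis using onorm_scaleR[OF bounded_linear_mult_right, of a A] by simp
qed

text \<open>The centred sum is the average of its differences to an independent copy of the sample.
  Exchanging sample and copy at any set of coordinates permutes the pairs of samples, so signs can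
  be inserted for free; the triangle inequality then separates the two, whence the factor 2.\<close>

lemma symmetrization:
  fixes \<zeta> :: "'w \<Rightarrow> fmat"
  assumes \<W>: "finite \<W>" "\<W> \<noteq> {}" and mean: "real (card \<W>) *\<^sub>R c = (\<Sum>W\<in>\<W>. \<zeta> W)"
  shows "2 ^ m * (\<Sum>S\<in>samples m \<W>. onorm ((*) ((\<Sum>i<m. \<zeta> (S i)) - real m *\<^sub>R c)))
    \<le> 2 * (\<Sum>S\<in>samples m \<W>. \<Sum>s\<in>signs {..<m}. onorm ((*) (\<Sum>i<m. s i *\<^sub>R \<zeta> (S i))))"
proof -
  let ?\<Omega> = "samples m \<W>" and ?N = "real (card (samples m \<W>))"
  let ?n = "\<lambda>Z::fmat. onorm ((*) Z)"
  note tri = onorm_mult_add and sc = onorm_mult_scaleR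
  have tri_sum: "?n (\<Sum>x\<in>T. f x) \<le> (\<Sum>x\<in>T. ?n (f x))" if "finite T" for T :: "(nat \<Rightarrow> 'w) set" and f
    using that
  proof (induction rule: finite_induct)
    case (insert x T)
    then show ?case using tri[of "f x" "\<Sum>x\<in>T. f x"] by simp
  qed (simp add: onorm_zero)
  have fin: "finite ?\<Omega>" by (rule finite_samples[OF \<W>(1)])
  have N: "0 < ?N" using \<W> by (simp add: card_samples card_gt_0_iff)
  have cW: "0 < real (card \<W>)" using \<W> by (simp add: card_gt_0_iff)
  have coord: "(\<Sum>S\<in>?\<Omega>. \<zeta> (S i)) = ?N *\<^sub>R c" if i: "i < m" for i
  proof -
    have "real (card \<W>) *\<^sub>R (\<Sum>S\<in>?\<Omega>. \<zeta> (S i)) = ?N *\<^sub>R (\<Sum>W\<in>\<W>. \<zeta> W)"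
    proof (subst vector_eq_ldot[symmetric], rule allI)
      fix C
      show "inner C (real (card \<W>) *\<^sub>R (\<Sum>S\<in>?\<Omega>. \<zeta> (S i))) = inner C (?N *\<^sub>R (\<Sum>W\<in>\<W>. \<zeta> W))"
        using sum_samples_coordinate[OF \<W>(1) i, where h = "\<lambda>W. inner C (\<zeta> W)"] by (simp add: inner_sum_right)
    qed
    then have eq: "real (card \<W>) *\<^sub>R (\<Sum>S\<in>?\<Omega>. \<zeta> (S i)) = real (card \<W>) *\<^sub>R (?N *\<^sub>R c)"
      by (simp add: mean[symmetric])
    show ?thesis by (rule scaleR_left_imp_eq[OF _ eq]) (use cW in simp)
  qed
  have avg: "?N *\<^sub>R ((\<Sum>i<m. \<zeta> (S i)) - real m *\<^sub>R c) = (\<Sum>S'\<in>?\<Omega>. \<Sum>i<m. \<zeta> (S i) - \<zeta> (S' i))" for S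
  proof -
    have "(\<Sum>S'\<in>?\<Omega>. \<Sum>i<m. \<zeta> (S' i)) = (\<Sum>i<m. ?N *\<^sub>R c)"
      by (subst sum.swap) (simp add: coord)
    then show ?thesis
      by (simp add: sum_subtractf scaleR_right_diff_distrib sum_constant_scaleR mult.commute)
  qed
  define \<Phi> where "\<Phi> s = (\<Sum>S\<in>?\<Omega>. \<Sum>S'\<in>?\<Omega>. ?n (\<Sum>i<m. s i *\<^sub>R (\<zeta> (S i) - \<zeta> (S' i))))" for s
  have step1: "?N * (\<Sum>S\<in>?\<Omega>. ?n ((\<Sum>i<m. \<zeta> (S i)) - real m *\<^sub>R c)) \<le> \<Phi> (\<lambda>_. 1)"
    unfolding \<Phi>_def sum_distrib_left
  proof (rule sum_mono)
    fix S
    have "?N * ?n ((\<Sum>i<m. \<zeta> (S i)) - real m *\<^sub>R c) = ?n (?N *\<^sub>R ((\<Sum>i<m. \<zeta> (S i)) - real m *\<^sub>R c))"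
      unfolding sc by simp
    also have "\<dots> \<le> (\<Sum>S'\<in>?\<Omega>. ?n (\<Sum>i<m. \<zeta> (S i) - \<zeta> (S' i)))"
      unfolding avg by (rule tri_sum[OF fin])
    finally show "?N * ?n ((\<Sum>i<m. \<zeta> (S i)) - real m *\<^sub>R c) \<le> (\<Sum>S'\<in>?\<Omega>. ?n (\<Sum>i<m. 1 *\<^sub>R (\<zeta> (S i) - \<zeta> (S' i))))" by simp
  qed
  have swap: "\<Phi> s = \<Phi> (\<lambda>_. 1)" if s: "s \<in> signs {..<m}" for s
  proof -
    \<comment> \<open>Exchanges the two samples exactly at the coordinates with sign -1; it is its
      own inverse.\<close>
    let ?mix = "\<lambda>(S, S'). (\<lambda>i. if i < m \<and> s i = -1 then S' i else S i, \<lambda>i. if i < m \<and> s i = -1 then S i else S' i)"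
    have mem: "?mix p \<in> ?\<Omega> \<times> ?\<Omega>" if "p \<in> ?\<Omega> \<times> ?\<Omega>" for p
      using that by (auto simp: samples_def PiE_def extensional_def)
    have inv: "?mix (?mix p) = p" for p by (cases p) (auto simp: fun_eq_iff)
    have s1: "s i = -1 \<or> s i = 1" if "i < m" for i using s that by (auto simp: signs_def PiE_def Pi_def)
    have "\<Phi> s = (\<Sum>p\<in>?\<Omega> \<times> ?\<Omega>. ?n (\<Sum>i<m. s i *\<^sub>R (\<zeta> (fst p i) - \<zeta> (snd p i))))"
      unfolding \<Phi>_def by (simp add: sum.cartesian_product case_prod_unfold)
    also have "\<dots> = (\<Sum>p\<in>?\<Omega> \<times> ?\<Omega>. ?n (\<Sum>i<m. 1 *\<^sub>R (\<zeta> (fst p i) - \<zeta> (snd p i))))"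
    proof (rule sum.reindex_bij_witness[of _ ?mix ?mix])
      fix p assume "p \<in> ?\<Omega> \<times> ?\<Omega>"
      have "(\<Sum>i<m. 1 *\<^sub>R (\<zeta> (fst (?mix p) i) - \<zeta> (snd (?mix p) i))) = (\<Sum>i<m. s i *\<^sub>R (\<zeta> (fst p i) - \<zeta> (snd p i)))"
      proof (rule sum.cong[OF refl])
        fix i assume "i \<in> {..<m}"
        then show "1 *\<^sub>R (\<zeta> (fst (?mix p) i) - \<zeta> (snd (?mix p) i)) = s i *\<^sub>R (\<zeta> (fst p i) - \<zeta> (snd p i))"
          using s1[of i] by (auto simp: case_prod_unfold)
      qed
      then show "?n (\<Sum>i<m. 1 *\<^sub>R (\<zeta> (fst (?mix p) i) - \<zeta> (snd (?mix p) i))) = ?n (\<Sum>i<m. s i *\<^sub>R (\<zeta> (fst p i) - \<zeta> (snd p i)))"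
        by simp
    qed (use mem inv in auto)
    also have "\<dots> = \<Phi> (\<lambda>_. 1)"
      unfolding \<Phi>_def by (simp add: sum.cartesian_product case_prod_unfold)
    finally show ?thesis .
  qed
  have split: "\<Phi> s \<le> 2 * ?N * (\<Sum>S\<in>?\<Omega>. ?n (\<Sum>i<m. s i *\<^sub>R \<zeta> (S i)))" for s
  proof -
    have "?n (\<Sum>i<m. s i *\<^sub>R (\<zeta> (S i) - \<zeta> (S' i))) \<le> ?n (\<Sum>i<m. s i *\<^sub>R \<zeta> (S i)) + ?n (\<Sum>i<m. s i *\<^sub>R \<zeta> (S' i))" for S S'
    proof -
      have "(\<Sum>i<m. s i *\<^sub>R (\<zeta> (S i) - \<zeta> (S' i))) = (\<Sum>i<m. s i *\<^sub>R \<zeta> (S i)) + (-1) *\<^sub>R (\<Sum>i<m. s i *\<^sub>R \<zeta> (S' i))"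
        by (simp add: scaleR_right_diff_distrib sum_subtractf)
      then show ?thesis using tri[of "\<Sum>i<m. s i *\<^sub>R \<zeta> (S i)" "(-1) *\<^sub>R (\<Sum>i<m. s i *\<^sub>R \<zeta> (S' i))"] unfolding sc by simp
    qed
    then have "\<Phi> s \<le> (\<Sum>S\<in>?\<Omega>. \<Sum>S'\<in>?\<Omega>. ?n (\<Sum>i<m. s i *\<^sub>R \<zeta> (S i)) + ?n (\<Sum>i<m. s i *\<^sub>R \<zeta> (S' i)))"
      unfolding \<Phi>_def by (intro sum_mono) auto
    also have "\<dots> = 2 * ?N * (\<Sum>S\<in>?\<Omega>. ?n (\<Sum>i<m. s i *\<^sub>R \<zeta> (S i)))"
      by (simp add: sum.distrib sum_distrib_left[symmetric])
    finally show ?thesis .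
  qed
  have "?N * (2 ^ m * (\<Sum>S\<in>?\<Omega>. ?n ((\<Sum>i<m. \<zeta> (S i)) - real m *\<^sub>R c))) \<le> 2 ^ m * \<Phi> (\<lambda>_. 1)"
    using step1 by simp
  also have "\<dots> = (\<Sum>s\<in>signs {..<m}. \<Phi> s)" by (simp add: swap card_signs)
  also have "\<dots> \<le> (\<Sum>s\<in>signs {..<m}. 2 * ?N * (\<Sum>S\<in>?\<Omega>. ?n (\<Sum>i<m. s i *\<^sub>R \<zeta> (S i))))" by (rule sum_mono[OF split])
  also have "\<dots> = ?N * (2 * (\<Sum>S\<in>?\<Omega>. \<Sum>s\<in>signs {..<m}. ?n (\<Sum>i<m. s i *\<^sub>R \<zeta> (S i))))"
    by (subst sum.swap) (simp add: sum_distrib_left mult_ac)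
  finally show ?thesis using N by simp
qed

text \<open>For a fixed sample \<open>rademacher_pauli\<close> bounds the sign average by the root
  of the sum of squared coefficients of \<rho>. The mean of that sum is m times the squared norm
  over d by \<open>pauli_parseval\<close>.\<close>

theorem pauli_initialization_mean:
  assumes n: "1 \<le> n" and m: "1 \<le> m" and \<rho>: "supp (2 ^ n) \<rho>" "adj \<rho> = \<rho>"
  shows "(\<Sum>S\<in>samples m (paulis n). onorm ((*) (sgram (2 ^ n / m) m (\<lambda>i. fmat_of (S i)) \<rho> - \<rho>)))
    \<le> card (samples m (paulis n)) * (40 * sqrt (n * 2 ^ n / m) * norm \<rho>)"
proof -
  let ?\<Omega> = "samples m (paulis n)" and ?N = "real (card (samples m (paulis n)))"
  let ?d = "2 ^ n :: real"
  define \<zeta> where "\<zeta> W = inner (fmat_of W) \<rho> *\<^sub>R fmat_of W" for W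
  have m0: "0 < real m" using m by simp
  have cp: "real (card (paulis n)) = ?d * ?d" by (simp add: card_paulis power_mult_distrib[symmetric])
  have mean: "real (card (paulis n)) *\<^sub>R ((1 / ?d) *\<^sub>R \<rho>) = (\<Sum>W\<in>paulis n. \<zeta> W)"
    unfolding \<zeta>_def pauli_inner_sum[OF \<rho>] cp by simp
  have N: "0 < ?N" using paulis_nonempty finite_paulis by (simp add: card_samples card_gt_0_iff)
  have sg: "sgram (?d / m) m (\<lambda>i. fmat_of (S i)) \<rho> - \<rho> = (?d / m) *\<^sub>R ((\<Sum>i<m. \<zeta> (S i)) - real m *\<^sub>R ((1 / ?d) *\<^sub>R \<rho>))" for S
    using m0 by (simp add: sgram_def \<zeta>_def scaleR_right_diff_distrib)
  define Y where "Y S = (\<Sum>i<m. (inner (fmat_of (S i)) \<rho>)\<^sup>2)" for S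
  have rad: "(\<Sum>s\<in>signs {..<m}. onorm ((*) (\<Sum>i<m. s i *\<^sub>R \<zeta> (S i)))) \<le> 2 ^ m * (20 * sqrt (n * Y S))"
    if S: "S \<in> ?\<Omega>" for S
  proof -
    have "(\<Sum>s\<in>signs {..<m}. onorm ((*) (\<Sum>i<m. (s i * inner (fmat_of (S i)) \<rho>) *\<^sub>R fmat_of (S i))))
        \<le> 2 ^ card {..<m} * (20 * sqrt (n * Y S))"
      unfolding Y_def by (rule rademacher_pauli[OF _ n])
        (use samples_mem[OF S] in \<open>auto intro: pauli_opb pauli_adj pauli_supp\<close>)
    then show ?thesis by (simp add: \<zeta>_def)
  qed
  have "2 ^ m * (\<Sum>S\<in>?\<Omega>. onorm ((*) ((\<Sum>i<m. \<zeta> (S i)) - real m *\<^sub>R ((1 / ?d) *\<^sub>R \<rho>))))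
      \<le> 2 * (\<Sum>S\<in>?\<Omega>. \<Sum>s\<in>signs {..<m}. onorm ((*) (\<Sum>i<m. s i *\<^sub>R \<zeta> (S i))))"
    by (rule symmetrization[OF finite_paulis paulis_nonempty mean])
  also have "\<dots> \<le> 2 * (\<Sum>S\<in>?\<Omega>. 2 ^ m * (20 * sqrt (n * Y S)))" by (intro mult_left_mono sum_mono rad) auto
  also have "\<dots> = 2 ^ m * (40 * (\<Sum>S\<in>?\<Omega>. sqrt (n * Y S)))" by (simp add: sum_distrib_left mult_ac)
  finally have 1: "(\<Sum>S\<in>?\<Omega>. onorm ((*) ((\<Sum>i<m. \<zeta> (S i)) - real m *\<^sub>R ((1 / ?d) *\<^sub>R \<rho>)))) \<le> 40 * (\<Sum>S\<in>?\<Omega>. sqrt (n * Y S))"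
    by simp
  have "(\<Sum>S\<in>?\<Omega>. (inner (fmat_of (S i)) \<rho>)\<^sup>2) = ?N * ((norm \<rho>)\<^sup>2 / ?d)" if "i < m" for i
  proof -
    have "?d * ?d * (\<Sum>S\<in>?\<Omega>. (inner (fmat_of (S i)) \<rho>)\<^sup>2) = ?N * (?d * (norm \<rho>)\<^sup>2)"
      using sum_samples_coordinate[OF finite_paulis[of n] that, where h = "\<lambda>W. (inner (fmat_of W) \<rho>)\<^sup>2"]
      unfolding cp pauli_parseval[OF \<rho>] .
    then show ?thesis by (simp add: field_simps)
  qed
  then have Ysum: "(\<Sum>S\<in>?\<Omega>. Y S) = ?N * (m * ((norm \<rho>)\<^sup>2 / ?d))"
    unfolding Y_def by (subst sum.swap) simp
  define c where "c = n * (m * ((norm \<rho>)\<^sup>2 / ?d))"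
  \<comment> \<open>Cauchy-Schwarz against the constant 1 is Jensen's inequality for the square
    root.\<close>
  have "(\<Sum>S\<in>?\<Omega>. sqrt (n * Y S)) \<le> sqrt (\<Sum>S\<in>?\<Omega>. 1\<^sup>2) * sqrt (\<Sum>S\<in>?\<Omega>. (sqrt (n * Y S))\<^sup>2)"
    unfolding real_sqrt_mult[symmetric]
    using Cauchy_Schwarz_ineq_sum[of "\<lambda>_. 1" "\<lambda>S. sqrt (n * Y S)" ?\<Omega>]
    by (intro real_le_rsqrt) simp
  also have "(\<Sum>S\<in>?\<Omega>. (sqrt (n * Y S))\<^sup>2) = (\<Sum>S\<in>?\<Omega>. n * Y S)"
    by (intro sum.cong) (auto simp: Y_def sum_nonneg)
  also have "\<dots> = ?N * c" by (simp add: sum_distrib_left[symmetric] Ysum c_def)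
  also have "sqrt (\<Sum>S\<in>?\<Omega>. 1\<^sup>2) * sqrt (?N * c) = ?N * sqrt c"
    by (simp add: real_sqrt_mult)
  finally have 2: "(\<Sum>S\<in>?\<Omega>. sqrt (n * Y S)) \<le> ?N * sqrt c" .
  have "(\<Sum>S\<in>?\<Omega>. onorm ((*) (sgram (?d / m) m (\<lambda>i. fmat_of (S i)) \<rho> - \<rho>)))
      = (?d / m) * (\<Sum>S\<in>?\<Omega>. onorm ((*) ((\<Sum>i<m. \<zeta> (S i)) - real m *\<^sub>R ((1 / ?d) *\<^sub>R \<rho>))))"
    unfolding sg sum_distrib_left onorm_mult_scaleR by simp
  also have "\<dots> \<le> (?d / m) * (40 * (?N * sqrt c))"
    using 1 2 by (intro mult_left_mono) auto
  also have "\<dots> = ?N * (40 * ((?d / m) * sqrt c))" by simp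
  also have "(?d / m) * sqrt c = sqrt (n * ?d / m) * norm \<rho>"
  proof -
    have "(?d / m) * sqrt c = sqrt ((?d / m)\<^sup>2 * c)" by (simp add: real_sqrt_mult)
    also have "(?d / m)\<^sup>2 * c = (n * ?d / m) * (norm \<rho>)\<^sup>2" using m0 by (simp add: c_def power2_eq_square field_simps)
    finally show ?thesis by (simp only: real_sqrt_mult real_sqrt_abs abs_norm_cancel)
  qed
  finally show ?thesis by simp
qed

section \<open>The restricted isometry property of Pauli samples\<close>

lemma four_power: "(4::real) ^ j = (2 ^ j)\<^sup>2"
  by (induction j) (auto simp: power2_eq_square)

definition low_nuclear :: "nat \<Rightarrow> nat \<Rightarrow> fmat set" where
  "low_nuclear n r = {X. supp (2 ^ n) X \<and> adj X = X \<and> norm X \<le> 1 \<and> nuc_le (2 * sqrt r) X}"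

definition pauli_coeff :: "fmat \<Rightarrow> complex mat \<Rightarrow> real" where
  "pauli_coeff X W = inner (fmat_of W) X"

lemma sum_signs_coordinate:
  assumes "finite I" "i \<in> I" shows "(\<Sum>s\<in>signs I. s i) = 0"
proof -
  have "(\<Sum>s\<in>signs I. s i) = (\<Sum>s\<in>signs I. \<Prod>j\<in>I. if j = i then s j else 1)"
    using assms by (simp add: prod.delta)
  also have "\<dots> = (\<Prod>j\<in>I. (if j = i then - 1 else 1) + (if j = i then 1 else 1))"
    by (rule sum_signs_prod[OF assms(1), of "\<lambda>j x. if j = i then x else 1"])
  also have "\<dots> = 0" using assms by (intro prod_zero) auto
  finally show ?thesis .
qed

text \<open>On a shattered set all \<open>2\<^sup>k\<close> sign patterns are realised with margin \<open>e\<close>; averaging over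
  them turns the margin into a lower bound for a Rademacher average.\<close>

lemma pauli_fat_shattering:
  assumes n: "1 \<le> n" and e: "0 < e" and y: "y \<in> shattered (pauli_coeff ` low_nuclear n r) (paulis n) G e"
  shows "card (dom y) \<le> 1600 * real r * real n / e\<^sup>2"
proof -
  let ?A = "dom y"
  have A: "?A \<subseteq> paulis n" "finite ?A" using y finite_paulis finite_subset by (auto simp: shattered_def)
  let ?k = "real (card ?A)"
  define Z where "Z s = (\<Sum>W\<in>?A. (s W * 1) *\<^sub>R fmat_of W)" for s
  have one: "?k * e \<le> 2 * sqrt r * onorm ((*) (Z s)) - (\<Sum>W\<in>?A. s W * the (y W))" if s: "s \<in> signs ?A" for s
  proof -
    have s1: "s W = -1 \<or> s W = 1" if "W \<in> ?A" for W using s that by (auto simp: signs_def PiE_def Pi_def)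
    obtain f where f: "f \<in> pauli_coeff ` low_nuclear n r" "\<And>W. W \<in> {W \<in> ?A. s W = 1} \<Longrightarrow> the (y W) + e \<le> f W"
      "\<And>W. W \<in> ?A \<Longrightarrow> W \<notin> {W \<in> ?A. s W = 1} \<Longrightarrow> f W \<le> the (y W) - e"
      using shatteredD[OF y, of "{W \<in> ?A. s W = 1}"] by blast
    then obtain X where X: "X \<in> low_nuclear n r" "f = pauli_coeff X" by auto
    have "e \<le> s W * (f W - the (y W))" if "W \<in> ?A" for W
      using s1[OF that] f(2,3)[of W] that by auto
    then have "(\<Sum>W\<in>?A. e) \<le> (\<Sum>W\<in>?A. s W * (f W - the (y W)))" by (rule sum_mono)
    then have "?k * e \<le> (\<Sum>W\<in>?A. s W * f W) - (\<Sum>W\<in>?A. s W * the (y W))"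
      by (simp add: right_diff_distrib sum_subtractf)
    also have "(\<Sum>W\<in>?A. s W * f W) = inner (Z s) X"
      by (simp add: Z_def inner_sum_left X(2) pauli_coeff_def)
    also have "\<dots> \<le> 2 * sqrt r * onorm ((*) (Z s))"
      using X(1) opb_onorm[of "Z s"] by (auto simp: low_nuclear_def nuc_le_def)
    finally show ?thesis by simp
  qed
  have "2 ^ card ?A * (?k * e) = (\<Sum>s\<in>signs ?A. ?k * e)" by (simp add: card_signs A)
  also have "\<dots> \<le> (\<Sum>s\<in>signs ?A. 2 * sqrt r * onorm ((*) (Z s)) - (\<Sum>W\<in>?A. s W * the (y W)))"
    by (rule sum_mono[OF one])
  also have "\<dots> = 2 * sqrt r * (\<Sum>s\<in>signs ?A. onorm ((*) (Z s))) - (\<Sum>s\<in>signs ?A. \<Sum>W\<in>?A. s W * the (y W))"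
    by (simp add: sum_subtractf sum_distrib_left)
  \<comment> \<open>The thresholds are arbitrary, but each is multiplied by a sign of mean
    zero.\<close>
  also have "(\<Sum>s\<in>signs ?A. \<Sum>W\<in>?A. s W * the (y W)) = 0"
    by (subst sum.swap) (simp add: sum_distrib_right[symmetric] sum_signs_coordinate A(2))
  also have "2 * sqrt r * (\<Sum>s\<in>signs ?A. onorm ((*) (Z s))) - 0
      \<le> 2 * sqrt r * (2 ^ card ?A * (20 * sqrt (n * (\<Sum>W\<in>?A. (1::real)\<^sup>2))))"
  proof -
    have "(\<Sum>s\<in>signs ?A. onorm ((*) (Z s))) \<le> 2 ^ card ?A * (20 * sqrt (n * (\<Sum>W\<in>?A. (1::real)\<^sup>2)))"
      unfolding Z_def using A by (intro rademacher_pauli n) (auto intro: pauli_opb pauli_adj pauli_supp)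
    then show ?thesis unfolding diff_0_right by (intro mult_left_mono) auto
  qed
  finally have "?k * e \<le> 40 * (sqrt r * sqrt (n * ?k))" by simp
  then have "(?k * e)\<^sup>2 \<le> (40 * (sqrt r * sqrt (n * ?k)))\<^sup>2" using e by (intro power_mono) auto
  also have "\<dots> = ?k * (1600 * real r * real n)" by (simp add: power_mult_distrib)
  finally have "?k * (?k * e\<^sup>2) \<le> ?k * (1600 * real r * real n)" by (simp add: power2_eq_square mult_ac)
  then have "?k * e\<^sup>2 \<le> 1600 * real r * real n" by (cases "?k = 0") auto
  then show ?thesis using e by (simp add: field_simps)
qed

section \<open>Covers at dyadic scales and the decomposition into levels\<close>

lemma pauli_coeff_bound:
  assumes "X \<in> low_nuclear n r" "W \<in> paulis n" shows "\<bar>pauli_coeff X W\<bar> \<le> 2 * sqrt r"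
  using assms nuc_le_abs[OF _ pauli_opb, of "2 * sqrt r" X W n]
  by (simp add: low_nuclear_def pauli_coeff_def)

text \<open>Dyadic scales descending from the largest possible coefficient, the bound of
  \<open>pauli_coeff_bound\<close>.\<close>

definition level :: "nat \<Rightarrow> nat \<Rightarrow> real" where "level r j = 2 * sqrt r / 2 ^ j"

text \<open>The squared scale is proportional to r, which cancels the r in the fat-shattering
  dimension and leaves order n 4^j. Two further factors n are logarithms of the number of
  point-threshold pairs: one from the exponent \<open>k\<close>, one from the base it is applied
  to.\<close>

lemma pauli_cover:
  assumes n: "1 \<le> n" and r: "1 \<le> r" and j: "j \<le> n + 7"
  obtains C where "finite C" "C \<subseteq> pauli_coeff ` low_nuclear n r" "card C \<le> 2 ^ (495616000000 * n ^ 3 * 4 ^ j)"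
    "\<And>f. f \<in> pauli_coeff ` low_nuclear n r \<Longrightarrow> \<exists>g\<in>C. \<forall>W\<in>paulis n. \<bar>f W - g W\<bar> \<le> level r j / 400"
proof -
  let ?K = "pauli_coeff ` low_nuclear n r"
  \<comment> \<open>The cover has radius 4 e, which is then \<open>level r j / 400\<close>.\<close>
  define e where "e = level r j / 1600"
  define D where "D = 1024000000 * n * 4 ^ j"
  define L where "L = 800 * (2::nat) ^ j"
  \<comment> \<open>There are at most 2^(21 n) point-threshold pairs, so \<open>k\<close> just
    exceeds the logarithm of the number of partial maps with at most \<open>D\<close> points. The
    final constant is 22^2 times that of \<open>D\<close>.\<close>
  define k where "k = 21 * n * D + 1"
  have e: "0 < e" using r by (simp add: e_def level_def)
  have sq: "e\<^sup>2 = real r / (640000 * 4 ^ j)"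
    by (simp add: e_def level_def power_divide power_mult_distrib four_power)
  have c2: "2 \<le> card (paulis n)"
    using power_increasing[of 1 n "4::nat"] n by (simp add: card_paulis)
  have fat: "card (dom y) \<le> D" if y: "y \<in> shattered ?K (paulis n) G e" for G y
  proof -
    have "real (card (dom y)) \<le> 1600 * real r * real n / e\<^sup>2" by (rule pauli_fat_shattering[OF n e y])
    also have "\<dots> = real D" using r by (simp add: sq D_def)
    finally show ?thesis by simp
  qed
  have bL: "2 * sqrt r / (2 * e) \<le> real L" using r by (simp add: e_def level_def L_def)
  let ?N = "card (paulis n) * (2 * L + 1)"
  have tj: "(2::nat) ^ j \<le> 2 ^ n * 128" using power_increasing[OF j, of "2::nat"] by (simp add: power_add)
  have "?N + 1 \<le> 4 ^ n * (1602 * 2 ^ j)"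
  proof -
    have "(1::nat) \<le> 4 ^ n * 2 ^ j" "(1::nat) \<le> 2 ^ j" by simp_all
    then have "4 ^ n * (1600 * 2 ^ j + 1) + 1 \<le> 4 ^ n * (1601 * 2 ^ j) + 4 ^ n * (2::nat) ^ j"
      by (intro add_mono mult_le_mono) auto
    then show ?thesis by (simp add: card_paulis L_def)
  qed
  also have "\<dots> \<le> 4 ^ n * (1602 * (2 ^ n * 128))" using tj by (intro mult_le_mono) auto
  also have "\<dots> \<le> 2 ^ (2 * n) * (2 ^ 18 * 2 ^ n)" by (simp add: power_mult)
  also have "\<dots> = 2 ^ (2 * n + (18 + n))" by (simp only: power_add)
  also have "\<dots> \<le> 2 ^ (21 * n)" using n by (intro power_increasing) auto
  finally have N1: "?N + 1 \<le> 2 ^ (21 * n)" .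
  have "(?N + 1) ^ D \<le> (2 ^ (21 * n)) ^ D" by (rule power_mono[OF N1]) simp
  also have "\<dots> = 2 ^ (21 * n * D)" by (simp add: power_mult)
  also have "\<dots> < 2 ^ k" unfolding k_def by (rule power_strict_increasing) auto
  finally have k: "(?N + 1) ^ D < 2 ^ k" .
  have "2 * ?N \<le> 2 ^ 1 * 2 ^ (21 * n)" using N1 by simp
  also have "\<dots> \<le> 2 ^ (22 * n)" unfolding power_add[symmetric] using n by (intro power_increasing) auto
  finally have "(2 * ?N) ^ k \<le> (2 ^ (22 * n)) ^ k" by (rule power_mono) simp
  also have "\<dots> = 2 ^ (22 * n * k)" by (simp add: power_mult)
  also have "\<dots> \<le> 2 ^ (22 * n * (22 * n * D))"
  proof (intro power_increasing mult_le_mono)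
    have "1 \<le> n * D" using n by (simp add: D_def)
    then show "k \<le> 22 * n * D" by (simp add: k_def)
  qed auto
  also have "22 * n * (22 * n * D) = 495616000000 * n ^ 3 * 4 ^ j" by (simp add: D_def power3_eq_cube)
  finally have size: "(2 * ?N) ^ k \<le> 2 ^ (495616000000 * n ^ 3 * 4 ^ j)" .
  have e4: "4 * e = level r j / 400" by (simp add: e_def)
  show ?thesis
  proof (rule fat_shattering_cover[OF finite_paulis c2 e _ _ bL k])
    show "\<bar>f W\<bar> \<le> 2 * sqrt r" if "f \<in> ?K" "W \<in> paulis n" for f W
      using that pauli_coeff_bound by auto
    show "card (dom y) \<le> D" if "y \<in> shattered ?K (paulis n) G e" for G y by (rule fat[OF that])
  next
    fix C assume C: "finite C" "C \<subseteq> ?K" "card C < (2 * ?N) ^ k"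
      "\<And>f. f \<in> ?K \<Longrightarrow> \<exists>g\<in>C. \<forall>W\<in>paulis n. \<bar>f W - g W\<bar> \<le> 4 * e"
    have "card C \<le> 2 ^ (495616000000 * n ^ 3 * 4 ^ j)" using C(3) size by linarith
    then show ?thesis by (rule that[OF C(1,2) _ C(4)[unfolded e4]])
  qed
qed

text \<open>The cap at 3 times the threshold bounds the summand for every choice of
  \<open>h\<close>, as the Chernoff bound requires. The value depends only on \<open>h\<close> up to
  index j, so at level j the union bound runs over tuples from the first j + 1 covers.\<close>

definition level_part :: "(nat \<Rightarrow> real) \<Rightarrow> nat \<Rightarrow> (nat \<Rightarrow> real) \<Rightarrow> real" where
  "level_part \<theta> j h = (if \<theta> j \<le> \<bar>h j\<bar> \<and> \<bar>h j\<bar> \<le> 3 * \<theta> j \<and> (\<forall>i<j. \<bar>h i\<bar> < \<theta> i) then (h j)\<^sup>2 else 0)"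

lemma level_part_bounds: "0 \<le> level_part \<theta> j h" "level_part \<theta> j h \<le> 9 * (\<theta> j)\<^sup>2"
proof -
  have "(h j)\<^sup>2 \<le> (3 * \<theta> j)\<^sup>2" if "\<bar>h j\<bar> \<le> 3 * \<theta> j"
    using power_mono[OF that abs_ge_zero, of 2] by simp
  then show "level_part \<theta> j h \<le> 9 * (\<theta> j)\<^sup>2" by (auto simp: level_part_def power_mult_distrib)
qed (simp add: level_part_def)

text \<open>Only the first level \<open>j\<close> with \<open>|h j| \<ge> \<theta> j\<close> contributes, and there \<open>h j\<close> is a relative
  approximation of \<open>f\<close>.\<close>

lemma level_decomposition:
  assumes \<theta>: "0 < t" "\<And>j. \<theta> j = t / 2 ^ j" and f: "\<bar>f\<bar> \<le> t"
    and h: "\<And>j. j \<le> J \<Longrightarrow> \<bar>f - h j\<bar> \<le> \<theta> j / 400"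
  shows "\<bar>f\<^sup>2 - (\<Sum>j\<le>J. level_part \<theta> j h)\<bar> \<le> 3 / 400 * (\<Sum>j\<le>J. level_part \<theta> j h) + 4 * (\<theta> J)\<^sup>2"
proof (cases "\<exists>j\<le>J. \<theta> j \<le> \<bar>h j\<bar>")
  case True
  define k where "k = (LEAST j. j \<le> J \<and> \<theta> j \<le> \<bar>h j\<bar>)"
  have k: "k \<le> J" "\<theta> k \<le> \<bar>h k\<bar>" using LeastI_ex[OF True] by (auto simp: k_def)
  have before: "\<bar>h i\<bar> < \<theta> i" if "i < k" for i
  proof (rule ccontr)
    assume "\<not> \<bar>h i\<bar> < \<theta> i"
    then have "k \<le> i" unfolding k_def using that k(1) by (intro Least_le) auto
    then show False using that by simp
  qed
  have \<theta>0: "0 < \<theta> j" for j using \<theta> by simp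
  \<comment> \<open>The level before k was not reached, which keeps f near or below twice the
    threshold of level k; at level 0 the global bound on f takes this part.\<close>
  have up: "\<bar>h k\<bar> \<le> 3 * \<theta> k"
  proof (cases k)
    case 0
    then have "\<theta> k = t" using \<theta>(2)[of 0] by simp
    then show ?thesis using h[OF k(1)] f \<theta>(1) by linarith
  next
    case (Suc i)
    have "\<theta> i = 2 * \<theta> k" by (simp add: \<theta>(2) Suc)
    moreover have "\<bar>h i\<bar> < \<theta> i" "\<bar>f - h i\<bar> \<le> \<theta> i / 400" using before h Suc k(1) by auto
    moreover have "\<bar>f - h k\<bar> \<le> \<theta> k / 400" by (rule h[OF k(1)])
    ultimately show ?thesis using \<theta>0[of k] by linarith
  qed
  have "(\<Sum>j\<le>J. level_part \<theta> j h) = (\<Sum>j\<le>J. if j = k then (h k)\<^sup>2 else 0)"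
  proof (rule sum.cong[OF refl])
    fix j assume "j \<in> {..J}"
    consider "j < k" | "j = k" | "k < j" by linarith
    then show "level_part \<theta> j h = (if j = k then (h k)\<^sup>2 else 0)"
    proof cases
      case 1
      then show ?thesis using before[of j] by (simp add: level_part_def)
    next
      case 2
      then show ?thesis using before k up by (simp add: level_part_def)
    next
      case 3
      then have "\<not> (\<forall>i<j. \<bar>h i\<bar> < \<theta> i)" using k(2) by (meson not_le)
      then show ?thesis using 3 by (auto simp: level_part_def)
    qed
  qed
  then have s: "(\<Sum>j\<le>J. level_part \<theta> j h) = (h k)\<^sup>2" using k(1) by simp
  have d: "\<bar>f - h k\<bar> \<le> \<bar>h k\<bar> / 400" using h[OF k(1)] k(2) by linarith
  have "\<bar>f\<^sup>2 - (h k)\<^sup>2\<bar> = \<bar>f - h k\<bar> * \<bar>f + h k\<bar>"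
    by (simp add: abs_mult[symmetric] power2_eq_square algebra_simps)
  also have "\<dots> \<le> (\<bar>h k\<bar> / 400) * (3 * \<bar>h k\<bar>)" using d by (intro mult_mono) linarith+
  also have "\<dots> = 3 / 400 * (h k)\<^sup>2" by (simp add: power2_eq_square)
  finally show ?thesis unfolding s using zero_le_power2[of "\<theta> J"] by linarith
next
  case False
  then have "\<bar>h J\<bar> < \<theta> J" by auto
  moreover have "\<bar>f - h J\<bar> \<le> \<theta> J / 400" by (rule h) simp
  ultimately have "\<bar>f\<bar> \<le> 2 * \<theta> J" by linarith
  then have "f\<^sup>2 \<le> 4 * (\<theta> J)\<^sup>2" using power_mono[of "\<bar>f\<bar>" "2 * \<theta> J" 2] by (simp add: power_mult_distrib)
  moreover have "(\<Sum>j\<le>J. level_part \<theta> j h) = 0" using False by (intro sum.neutral) (auto simp: level_part_def)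
  ultimately show ?thesis by simp
qed

lemma sum_powers_of_4: "(\<Sum>i\<le>j. (4::nat) ^ i) \<le> 2 * 4 ^ j"
  by (induction j) auto

text \<open>The deterministic half: for a normalized matrix, the sampled form, its level version
  \<open>Gm\<close>, the exact level mean \<open>G\<close> and the value 1 given by Parseval are
  compared in a chain. Each comparison costs at most 3/400 relative plus 1/400 absolute, in total
  below 1/20. The condition on \<open>J\<close> makes coefficients below the last level
  negligible.\<close>

lemma rip_from_levels:
  fixes S :: "nat \<Rightarrow> complex mat" and n r m J :: nat and d :: real
  defines "d \<equiv> 2 ^ n"
  assumes m: "1 \<le> m" and r: "1 \<le> r" and S: "\<And>i. i < m \<Longrightarrow> S i \<in> paulis n"
    and J: "4 * (level r J)\<^sup>2 \<le> 1 / (400 * d)"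
    and C: "\<And>j f. j \<le> J \<Longrightarrow> f \<in> pauli_coeff ` low_nuclear n r \<Longrightarrow> \<exists>g\<in>C j. \<forall>W\<in>paulis n. \<bar>f W - g W\<bar> \<le> level r j / 400"
    and good: "\<And>j h. j \<le> J \<Longrightarrow> h \<in> PiE {..j} C \<Longrightarrow>
      \<bar>(\<Sum>i<m. level_part (level r) j (\<lambda>k. h k (S i))) - m * ((\<Sum>W\<in>paulis n. level_part (level r) j (\<lambda>k. h k W)) / (d * d))\<bar>
      \<le> m * (1 / 400 * ((\<Sum>W\<in>paulis n. level_part (level r) j (\<lambda>k. h k W)) / (d * d)) + 1 / (400 * d * (J + 1)))"
  shows "rip (2 ^ n) r (1 / 20) (d / m) m (\<lambda>i. fmat_of (S i))"
  unfolding rip_def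
proof (intro allI impI)
  fix X assume X: "supp (2 ^ n) X" "adj X = X" "nuc_le (2 * sqrt r * norm X) X"
  let ?q = "sform (d / m) m (\<lambda>i. fmat_of (S i))"
  show "\<bar>?q X X - (norm X)\<^sup>2\<bar> \<le> 1 / 20 * (norm X)\<^sup>2"
  proof (cases "X = 0")
    case True
    then show ?thesis by (simp add: sform_def)
  next
    case False
    define Y where "Y = X /\<^sub>R norm X"
    have nX: "0 < norm X" using False by simp
    have nY: "norm Y = 1" using nX by (simp add: Y_def)
    have "nuc_le (2 * sqrt r) Y"
      unfolding nuc_le_def
    proof safe
      fix c Z assume "opb c Z"
      then have "inner Z X \<le> 2 * sqrt r * norm X * c" using X(3) by (simp add: nuc_le_def)
      then show "inner Z Y \<le> 2 * sqrt r * c" using nX by (simp add: Y_def field_simps)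
    qed
    then have Y: "Y \<in> low_nuclear n r" "supp (2 ^ n) Y" "adj Y = Y"
      using X nY by (auto simp: low_nuclear_def Y_def)
    define f where "f = pauli_coeff Y"
    have f: "f \<in> pauli_coeff ` low_nuclear n r" using Y by (simp add: f_def)
    have fb: "\<bar>f W\<bar> \<le> 2 * sqrt r" if "W \<in> paulis n" for W unfolding f_def by (rule pauli_coeff_bound[OF Y(1) that])
    have "\<forall>j. \<exists>h. j \<le> J \<longrightarrow> h \<in> C j \<and> (\<forall>W\<in>paulis n. \<bar>f W - h W\<bar> \<le> level r j / 400)"
      using C[OF _ f] by blast
    from choice[OF this] obtain h where h: "\<And>j. j \<le> J \<Longrightarrow> h j \<in> C j" "\<And>j W. j \<le> J \<Longrightarrow> W \<in> paulis n \<Longrightarrow> \<bar>f W - h j W\<bar> \<le> level r j / 400"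
      by blast
    define g where "g j W = level_part (level r) j (\<lambda>k. h k W)" for j W
    have dec: "\<bar>(f W)\<^sup>2 - (\<Sum>j\<le>J. g j W)\<bar> \<le> 3 / 400 * (\<Sum>j\<le>J. g j W) + 4 * (level r J)\<^sup>2" if W: "W \<in> paulis n" for W
      unfolding g_def
      by (rule level_decomposition[of "2 * sqrt r"]) (use r fb[OF W] h(2)[OF _ W] in \<open>auto simp: level_def\<close>)
    define \<mu> where "\<mu> j = (\<Sum>W\<in>paulis n. g j W) / (d * d)" for j
    have goodh: "\<bar>(\<Sum>i<m. g j (S i)) - m * \<mu> j\<bar> \<le> m * (1 / 400 * \<mu> j + 1 / (400 * d * (J + 1)))" if j: "j \<le> J" for j
    proof -
      \<comment> \<open>The assumption speaks of extensional tuples indexed up to j; restricting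
        \<open>h\<close> leaves the level part unchanged.\<close>
      define h' where "h' = restrict h {..j}"
      have "h' \<in> PiE {..j} C" using h(1) j by (auto simp: h'_def)
      moreover have "level_part (level r) j (\<lambda>k. h' k W) = g j W" for W
        by (auto simp: g_def level_part_def h'_def)
      ultimately show ?thesis using good[OF j, of h'] by (simp add: \<mu>_def)
    qed
    have d0: "0 < d" by (simp add: d_def)
    have m0: "0 < real m" using m by simp
    have cW: "real (card (paulis n)) = d * d" by (simp add: card_paulis d_def power_mult_distrib[symmetric])
    define G where "G = d * (\<Sum>j\<le>J. \<mu> j)"
    define Gm where "Gm = d / m * (\<Sum>i<m. \<Sum>j\<le>J. g j (S i))"
    define a where "a = d / m * (\<Sum>i<m. (f (S i))\<^sup>2)"
    have tl: "d * (4 * (level r J)\<^sup>2) \<le> 1 / 400"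
    proof -
      have "d * (4 * (level r J)\<^sup>2) \<le> d * (1 / (400 * d))" using J d0 by (intro mult_left_mono) auto
      then show ?thesis using d0 by simp
    qed
    have "\<bar>a - Gm\<bar> = d / m * \<bar>\<Sum>i<m. ((f (S i))\<^sup>2 - (\<Sum>j\<le>J. g j (S i)))\<bar>"
      unfolding a_def Gm_def right_diff_distrib[symmetric] sum_subtractf[symmetric] abs_mult using d0 by simp
    also have "\<dots> \<le> d / m * (\<Sum>i<m. 3 / 400 * (\<Sum>j\<le>J. g j (S i)) + 4 * (level r J)\<^sup>2)"
      using d0 m0 dec[OF S] by (intro mult_left_mono order_trans[OF sum_abs] sum_mono) auto
    also have "\<dots> = 3 / 400 * Gm + d * (4 * (level r J)\<^sup>2)"
      unfolding Gm_def sum.distrib sum_distrib_left[symmetric] using m0 by (simp add: field_simps)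
    finally have 1: "\<bar>a - Gm\<bar> \<le> 3 / 400 * Gm + 1 / 400" using tl by linarith
    have G2: "G = (\<Sum>W\<in>paulis n. \<Sum>j\<le>J. g j W) / d"
      using d0 by (subst sum.swap) (simp add: G_def \<mu>_def sum_divide_distrib[symmetric])
    have "(\<Sum>W\<in>paulis n. (f W)\<^sup>2) = d"
      unfolding f_def pauli_coeff_def using pauli_parseval[OF Y(2,3)] nY by (simp add: d_def)
    then have "1 - G = ((\<Sum>W\<in>paulis n. (f W)\<^sup>2) - (\<Sum>W\<in>paulis n. \<Sum>j\<le>J. g j W)) / d"
      using d0 by (simp add: G2 diff_divide_distrib)
    then have "\<bar>1 - G\<bar> = \<bar>\<Sum>W\<in>paulis n. ((f W)\<^sup>2 - (\<Sum>j\<le>J. g j W))\<bar> / d"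
      using d0 by (simp add: sum_subtractf abs_divide)
    also have "\<dots> \<le> (\<Sum>W\<in>paulis n. 3 / 400 * (\<Sum>j\<le>J. g j W) + 4 * (level r J)\<^sup>2) / d"
      using d0 dec by (intro divide_right_mono order_trans[OF sum_abs] sum_mono) auto
    also have "\<dots> = 3 / 400 * G + d * (4 * (level r J)\<^sup>2)"
      unfolding G2 sum.distrib sum_distrib_left[symmetric] using d0 by (simp add: cW add_divide_distrib)
    finally have 2: "\<bar>1 - G\<bar> \<le> 3 / 400 * G + 1 / 400" using tl by linarith
    have "Gm - G = d / m * (\<Sum>j\<le>J. (\<Sum>i<m. g j (S i)) - m * \<mu> j)"
    proof -
      have "(\<Sum>i<m. \<Sum>j\<le>J. g j (S i)) = (\<Sum>j\<le>J. \<Sum>i<m. g j (S i))" by (rule sum.swap)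
      then show ?thesis using m0 by (simp add: Gm_def G_def sum_subtractf right_diff_distrib sum_distrib_left[symmetric])
    qed
    then have "\<bar>Gm - G\<bar> = d / m * \<bar>\<Sum>j\<le>J. (\<Sum>i<m. g j (S i)) - m * \<mu> j\<bar>" using d0 m0 by (simp add: abs_mult)
    also have "\<dots> \<le> d / m * (\<Sum>j\<le>J. m * (1 / 400 * \<mu> j + 1 / (400 * d * (J + 1))))"
      using d0 m0 goodh by (intro mult_left_mono order_trans[OF sum_abs] sum_mono) auto
    also have "\<dots> = d * (\<Sum>j\<le>J. 1 / 400 * \<mu> j + 1 / (400 * d * (J + 1)))"
      using m0 by (simp add: sum_distrib_left[symmetric])
    also have "\<dots> = d * (1 / 400 * (\<Sum>j\<le>J. \<mu> j) + (real J + 1) * (1 / (400 * d * (real J + 1))))"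
      unfolding sum.distrib sum_distrib_left[symmetric] by (simp add: add.commute)
    also have "(real J + 1) * (1 / (400 * d * (real J + 1))) = 1 / (400 * d)"
    proof -
      have "p * (1 / (400 * d * p)) = 1 / (400 * d)" if "0 < p" for p using that d0 by simp
      then show ?thesis by (simp only: add_pos_nonneg[OF zero_less_one of_nat_0_le_iff] add.commute)
    qed
    also have "d * (1 / 400 * (\<Sum>j\<le>J. \<mu> j) + 1 / (400 * d)) = 1 / 400 * G + 1 / 400"
      using d0 by (simp add: G_def field_simps)
    finally have 3: "\<bar>Gm - G\<bar> \<le> 1 / 400 * G + 1 / 400" .
    have "\<bar>a - 1\<bar> \<le> 1 / 20" using 1 2 3 unfolding abs_le_iff by linarith
    moreover have "?q X X = (norm X)\<^sup>2 * a"
    proof -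
      have "?q Y Y = a" by (simp add: sform_def a_def f_def pauli_coeff_def power2_eq_square)
      moreover have "X = norm X *\<^sub>R Y" using nX by (simp add: Y_def)
      then have "?q X X = norm X * (norm X * ?q Y Y)" by (metis sform_simps(5,6))
      ultimately show ?thesis by (simp add: power2_eq_square)
    qed
    then have "?q X X - (norm X)\<^sup>2 = (norm X)\<^sup>2 * (a - 1)" by (simp add: right_diff_distrib)
    ultimately show ?thesis using mult_left_mono[of "\<bar>a - 1\<bar>" "1 / 20" "(norm X)\<^sup>2"] by (simp add: abs_mult)
  qed
qed

text \<open>At level j the summands are at most 36 r / 4^j, so the Chernoff exponent is proportional
  to 4^j, exactly as the logarithm of the number of tuples is. One condition on m therefore serves
  all levels.\<close>

theorem pauli_rip:
  fixes n r m :: nat and \<epsilon> :: real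
  assumes n: "1 \<le> n" and r: "1 \<le> r" "r \<le> 2 ^ n" and \<epsilon>: "0 < \<epsilon>" "\<epsilon> \<le> 1"
    and m: "52000000 * real r * 2 ^ n * real n ^ 4 * (1000000000000 + ln (36 / \<epsilon>)) \<le> real m"
  shows "card {S \<in> samples m (paulis n). \<not> rip (2 ^ n) r (1 / 20) (2 ^ n / m) m (\<lambda>i. fmat_of (S i))}
    \<le> \<epsilon> * card (samples m (paulis n))"
proof -
  let ?\<Omega> = "samples m (paulis n)" and ?d = "2 ^ n :: real" and ?\<Lambda> = "495616000000 :: nat"
  \<comment> \<open>The last level must satisfy 4 (level)^2 <= 1 / (400 d); with r <= 2^n this holds
    once 4^J >= 6400 * 4^n, and 4^7 = 16384.\<close>
  define J where "J = n + 7"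
  \<comment> \<open>The additive allowance is shared equally among the J + 1 levels, so that its
    total is 1 / (400 d).\<close>
  let ?\<tau> = "1 / (400 * ?d * (J + 1))"
  define T where "T = 1000000000000 + ln (36 / \<epsilon>)"
  have ln36: "0 \<le> ln (36 / \<epsilon>)" using \<epsilon> by (intro ln_ge_zero) (simp add: field_simps)
  have n1: "1 \<le> real n" using n by simp
  have r1: "1 \<le> real r" using r by simp
  have "0 < 52000000 * real r * ?d * real n ^ 4 * T" using r1 n1 ln36 by (auto simp: T_def intro!: mult_pos_pos add_pos_nonneg)
  then have m1: "1 \<le> m" using m by (auto simp: T_def Suc_le_eq intro: gr0I)
  define P where "P j C \<longleftrightarrow> finite C \<and> card C \<le> 2 ^ (?\<Lambda> * n ^ 3 * 4 ^ j) \<and>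
    (\<forall>f\<in>pauli_coeff ` low_nuclear n r. \<exists>g\<in>C. \<forall>W\<in>paulis n. \<bar>f W - g W\<bar> \<le> level r j / 400)" for j C
  have "\<exists>C. j \<le> J \<longrightarrow> P j C" for j
  proof (cases "j \<le> J")
    case True
    then have j: "j \<le> n + 7" by (simp add: J_def)
    show ?thesis
    proof (rule pauli_cover[OF n r(1) j])
      fix C assume "finite C" "C \<subseteq> pauli_coeff ` low_nuclear n r" "card C \<le> 2 ^ (?\<Lambda> * n ^ 3 * 4 ^ j)"
        "\<And>f. f \<in> pauli_coeff ` low_nuclear n r \<Longrightarrow> \<exists>g\<in>C. \<forall>W\<in>paulis n. \<bar>f W - g W\<bar> \<le> level r j / 400"
      then have "P j C" unfolding P_def by (intro conjI ballI)
      then show ?thesis by blast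
    qed
  qed simp
  then obtain C where CP: "\<And>j. j \<le> J \<Longrightarrow> P j (C j)" using choice[of "\<lambda>j C. j \<le> J \<longrightarrow> P j C"] by blast
  have C: "\<And>j. j \<le> J \<Longrightarrow> finite (C j)" "\<And>j. j \<le> J \<Longrightarrow> card (C j) \<le> 2 ^ (?\<Lambda> * n ^ 3 * 4 ^ j)"
    "\<And>j f. j \<le> J \<Longrightarrow> f \<in> pauli_coeff ` low_nuclear n r \<Longrightarrow> \<exists>g\<in>C j. \<forall>W\<in>paulis n. \<bar>f W - g W\<bar> \<le> level r j / 400"
    using CP unfolding P_def by blast+
  define g where "g j h W = level_part (level r) j (\<lambda>k. h k W)" for j and h :: "nat \<Rightarrow> complex mat \<Rightarrow> real" and W
  define \<mu> where "\<mu> j h = (\<Sum>W\<in>paulis n. g j h W) / card (paulis n)" for j h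
  define bad where "bad j h = {S \<in> ?\<Omega>. m * (1 / 400 * \<mu> j h + ?\<tau>) < \<bar>(\<Sum>i<m. g j h (S i)) - m * \<mu> j h\<bar>}" for j h
  have cW: "real (card (paulis n)) = ?d * ?d" by (simp add: card_paulis power_mult_distrib[symmetric])
  have sub: "{S \<in> ?\<Omega>. \<not> rip (2 ^ n) r (1 / 20) (?d / m) m (\<lambda>i. fmat_of (S i))} \<subseteq> (\<Union>j\<le>J. \<Union>h\<in>PiE {..j} C. bad j h)"
  proof (rule subsetI, rule ccontr)
    fix S assume "S \<in> {S \<in> ?\<Omega>. \<not> rip (2 ^ n) r (1 / 20) (?d / m) m (\<lambda>i. fmat_of (S i))}"
      and "S \<notin> (\<Union>j\<le>J. \<Union>h\<in>PiE {..j} C. bad j h)"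
    then have S: "S \<in> ?\<Omega>" "\<not> rip (2 ^ n) r (1 / 20) (?d / m) m (\<lambda>i. fmat_of (S i))"
      "\<And>j h. j \<le> J \<Longrightarrow> h \<in> PiE {..j} C \<Longrightarrow> S \<notin> bad j h" by auto
    have lev: "4 * (level r J)\<^sup>2 \<le> 1 / (400 * ?d)"
    proof -
      have "real r * ?d \<le> ?d * ?d" using r(2) by (intro mult_right_mono) (simp_all flip: of_nat_le_iff)
      also have "?d * ?d = 4 ^ n" by (simp add: power_mult_distrib[symmetric])
      finally have "real r * ?d \<le> 4 ^ n" .
      then have a: "6400 * (real r * ?d) \<le> 16384 * 4 ^ n" using zero_le_power[of "4::real" n] by linarith
      have lv: "(level r J)\<^sup>2 = 4 * real r / (16384 * 4 ^ n)"
        by (simp add: level_def J_def power_divide power_mult_distrib power_add four_power)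
      show ?thesis unfolding lv using a by (simp add: field_simps)
    qed
    have "rip (2 ^ n) r (1 / 20) (?d / m) m (\<lambda>i. fmat_of (S i))"
      by (rule rip_from_levels[OF m1 r(1) samples_mem[OF S(1)] lev C(3)])
        (use S(1,3) in \<open>auto simp: bad_def g_def \<mu>_def cW not_less\<close>)
    then show False using S(2) by simp
  qed
  have lp: "level r j \<noteq> 0" for j using r by (simp add: level_def)
  have badc: "card (bad j h) \<le> 2 * card ?\<Omega> * exp (- (1 / 400 * m * ?\<tau> / (9 * (level r j)\<^sup>2)))" for j h
    unfolding bad_def
    by (rule chernoff_samples[OF finite_paulis paulis_nonempty])
      (use lp level_part_bounds in \<open>auto simp: g_def \<mu>_def\<close>)
  \<comment> \<open>5760000 is 400 * 400 * 9 * 4: the two factors 400 of \<eta> and \<tau>, the cap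
    9 of the level part and the 4 in the squared level.\<close>
  define Q where "Q = real m / (5760000 * r * ?d * (J + 1))"
  have expo: "1 / 400 * m * ?\<tau> / (9 * (level r j)\<^sup>2) = Q * 4 ^ j" for j
  proof -
    have "(level r j)\<^sup>2 = 4 * real r / 4 ^ j"
      by (simp add: level_def power_divide power_mult_distrib four_power)
    then show ?thesis using r1 by (simp add: Q_def)
  qed
  have Qbig: "2 * ?\<Lambda> * n ^ 3 + (n + ln (36 / \<epsilon>)) \<le> Q"
  proof -
    have J9: "real (J + 1) \<le> 9 * n" using n1 by (simp add: J_def)
    have n3: "real n \<le> real n ^ 3" "1 \<le> real n ^ 3" using n1 self_le_power[of "real n" 3] by auto
    have "ln (36 / \<epsilon>) \<le> real n ^ 3 * ln (36 / \<epsilon>)" using n3(2) ln36 mult_right_mono[of 1 "real n ^ 3" "ln (36 / \<epsilon>)"] by simp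
    moreover have "2 * ?\<Lambda> * n ^ 3 + (n + ln (36 / \<epsilon>)) = 991232000000 * real n ^ 3 + (real n + ln (36 / \<epsilon>))" by simp
    moreover have "n ^ 3 * T = 1000000000000 * real n ^ 3 + real n ^ 3 * ln (36 / \<epsilon>)" by (simp add: T_def algebra_simps)
    ultimately have "2 * ?\<Lambda> * n ^ 3 + (n + ln (36 / \<epsilon>)) \<le> n ^ 3 * T" using n3 by linarith
    moreover have "n ^ 3 * T * (5760000 * r * ?d * (J + 1)) \<le> real m"
    proof -
      have "n ^ 3 * T * (5760000 * r * ?d * (J + 1)) \<le> n ^ 3 * T * (5760000 * r * ?d * (9 * n))"
        using J9 ln36 by (intro mult_left_mono) (auto simp: T_def)
      also have "\<dots> = 51840000 * (r * ?d * n ^ 4 * T)" by (simp add: power_numeral_reduce)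
      also have "\<dots> \<le> 52000000 * (r * ?d * n ^ 4 * T)" using ln36 by (intro mult_right_mono) (auto simp: T_def)
      also have "\<dots> \<le> real m" using m by (simp add: T_def mult_ac)
      finally show ?thesis .
    qed
    then have "n ^ 3 * T \<le> Q" unfolding Q_def using r1 by (simp add: pos_le_divide_eq)
    ultimately show ?thesis by linarith
  qed
  have level_sum: "(\<Sum>h\<in>PiE {..j} C. real (card (bad j h))) \<le> card ?\<Omega> * (2 * (exp (- real n) * (\<epsilon> / 36)))" if j: "j \<le> J" for j
  proof -
    \<comment> \<open>The sizes of the covers multiply over the levels up to j, but their logarithms
      form a geometric series, so the total is at most twice the last one.\<close>
    have "card (PiE {..j} C) = (\<Prod>i\<le>j. card (C i))" by (simp add: card_PiE)
    also have "\<dots> \<le> (\<Prod>i\<le>j. 2 ^ (?\<Lambda> * n ^ 3 * 4 ^ i))" using C(2) j by (intro prod_mono) auto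
    also have "\<dots> = 2 ^ (\<Sum>i\<le>j. ?\<Lambda> * n ^ 3 * 4 ^ i)" by (rule power_sum[symmetric])
    also have "\<dots> \<le> 2 ^ (?\<Lambda> * n ^ 3 * (2 * 4 ^ j))"
      unfolding sum_distrib_left[symmetric] by (intro power_increasing mult_le_mono2 sum_powers_of_4) auto
    finally have "real (card (PiE {..j} C)) \<le> 2 ^ (?\<Lambda> * n ^ 3 * (2 * 4 ^ j))" by (metis of_nat_le_iff of_nat_numeral of_nat_power)
    also have "\<dots> \<le> exp 1 ^ (?\<Lambda> * n ^ 3 * (2 * 4 ^ j))" using exp_ge_add_one_self[of 1] by (intro power_mono) auto
    also have "\<dots> = exp (2 * ?\<Lambda> * n ^ 3 * 4 ^ j)" by (simp add: exp_of_nat_mult[symmetric] mult_ac)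
    finally have cT: "real (card (PiE {..j} C)) \<le> exp (2 * ?\<Lambda> * n ^ 3 * 4 ^ j)" .
    have "(\<Sum>h\<in>PiE {..j} C. real (card (bad j h))) \<le> (\<Sum>h\<in>PiE {..j} C. 2 * card ?\<Omega> * exp (- (Q * 4 ^ j)))"
      by (intro sum_mono badc[of j, unfolded expo])
    also have "\<dots> = card ?\<Omega> * (2 * (card (PiE {..j} C) * exp (- (Q * 4 ^ j))))" by simp
    also have "\<dots> \<le> card ?\<Omega> * (2 * (exp (2 * ?\<Lambda> * n ^ 3 * 4 ^ j) * exp (- (Q * 4 ^ j))))"
      using cT by (intro mult_left_mono mult_right_mono) auto
    also have "\<dots> \<le> card ?\<Omega> * (2 * exp (- (n + ln (36 / \<epsilon>))))"
    proof (intro mult_left_mono)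
      have "(n + ln (36 / \<epsilon>)) * 1 \<le> (n + ln (36 / \<epsilon>)) * 4 ^ j" using ln36 by (intro mult_left_mono) auto
      also have "\<dots> \<le> (Q - 2 * ?\<Lambda> * n ^ 3) * 4 ^ j" using Qbig by (intro mult_right_mono) auto
      finally show "exp (2 * ?\<Lambda> * n ^ 3 * 4 ^ j) * exp (- (Q * 4 ^ j)) \<le> exp (- (n + ln (36 / \<epsilon>)))"
        by (simp add: exp_add[symmetric] algebra_simps)
    qed auto
    also have "exp (- (n + ln (36 / \<epsilon>))) = exp (- real n) * (\<epsilon> / 36)"
    proof -
      have "exp (- (n + ln (36 / \<epsilon>))) = exp (- real n) * exp (- ln (36 / \<epsilon>))" by (simp add: exp_add[symmetric])
      also have "exp (- ln (36 / \<epsilon>)) = \<epsilon> / 36" using \<epsilon> by (simp add: exp_minus)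
      finally show ?thesis .
    qed
    finally show ?thesis .
  qed
  have finP: "finite (PiE {..j} C)" if "j \<le> J" for j using C(1) that by (intro finite_PiE) auto
  have "card {S \<in> ?\<Omega>. \<not> rip (2 ^ n) r (1 / 20) (?d / m) m (\<lambda>i. fmat_of (S i))} \<le> card (\<Union>j\<le>J. \<Union>h\<in>PiE {..j} C. bad j h)"
    by (intro card_mono[OF _ sub] finite_UN_I finP) (auto simp: bad_def finite_samples finite_paulis)
  also have "\<dots> \<le> (\<Sum>j\<le>J. \<Sum>h\<in>PiE {..j} C. card (bad j h))"
    by (intro order_trans[OF card_UN_le] sum_mono card_UN_le finP) auto
  finally have "real (card {S \<in> ?\<Omega>. \<not> rip (2 ^ n) r (1 / 20) (?d / m) m (\<lambda>i. fmat_of (S i))})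
      \<le> (\<Sum>j\<le>J. \<Sum>h\<in>PiE {..j} C. real (card (bad j h)))"
    by (simp flip: of_nat_sum)
  also have "\<dots> \<le> (\<Sum>j\<le>J. card ?\<Omega> * (2 * (exp (- real n) * (\<epsilon> / 36))))"
    by (intro sum_mono level_sum) auto
  also have "\<dots> = real (J + 1) * (exp (- real n)) * (card ?\<Omega> * (\<epsilon> / 18))" by simp
  \<comment> \<open>The reserve exp (-n) kept at every level pays for the at most 9n levels of the
    union bound.\<close>
  also have "\<dots> \<le> 9 * (card ?\<Omega> * (\<epsilon> / 18))"
  proof (intro mult_right_mono)
    have "real (J + 1) \<le> 9 * n" using n1 by (simp add: J_def)
    also have "\<dots> \<le> 9 * exp (real n)" using exp_ge_add_one_self[of "real n"] by linarith
    finally have "real (J + 1) * exp (- real n) \<le> 9 * exp (real n) * exp (- real n)" by (rule mult_right_mono) simp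
    then show "real (J + 1) * exp (- real n) \<le> 9" by (simp add: mult.assoc exp_add[symmetric])
  qed (use \<epsilon> in auto)
  also have "\<dots> \<le> \<epsilon> * card ?\<Omega>" using \<epsilon> by simp
  finally show ?thesis .
qed

section \<open>The main theorem\<close>

text \<open>Outside the first m indices both descriptions fix the value \<open>undefined\<close>, so
  the law is uniform on a finite set and probabilities become counting.\<close>

lemma pauli_sample_prob:
  "measure_pmf.prob (pauli_sample n m) A
    = card (samples m (paulis n) \<inter> A) / card (samples m (paulis n))"
proof -
  have "PiE_dflt {..<m} undefined (\<lambda>_. paulis n) = samples m (paulis n)"
    by (auto simp: PiE_dflt_def samples_def PiE_def extensional_def Pi_def)
  then have "pauli_sample n m = pmf_of_set (samples m (paulis n))"
    unfolding pauli_sample_def using Pi_pmf_of_set[of "{..<m}" "\<lambda>_. paulis n"]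
    by (simp add: finite_paulis paulis_nonempty)
  moreover have "samples m (paulis n) \<noteq> {}" by (simp add: samples_def PiE_eq_empty_iff paulis_nonempty)
  ultimately show ?thesis
    using measure_pmf_of_set[OF _ finite_samples[OF finite_paulis]] by simp
qed

text \<open>Markov's inequality for the operator norm of the error, which is why \<epsilon>
  multiplies \<delta> in the smallness condition.\<close>

lemma pauli_initialization:
  fixes n m :: nat and \<rho> :: fmat and \<delta> \<epsilon> :: real
  assumes n: "1 \<le> n" and m: "1 \<le> m" and \<rho>: "supp (2 ^ n) \<rho>" "adj \<rho> = \<rho>" and \<delta>: "0 < \<delta>"
    and small: "40 * sqrt (real n * 2 ^ n / real m) * norm \<rho> \<le> \<epsilon> * \<delta>"
  shows "card {S \<in> samples m (paulis n). \<not> opb \<delta> (sgram (2 ^ n / m) m (\<lambda>i. fmat_of (S i)) \<rho> - \<rho>)}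
    \<le> \<epsilon> * card (samples m (paulis n))"
proof -
  let ?\<Omega> = "samples m (paulis n)"
  let ?E = "\<lambda>S. onorm ((*) (sgram (2 ^ n / m) m (\<lambda>i. fmat_of (S i)) \<rho> - \<rho>))"
  let ?B = "{S \<in> ?\<Omega>. \<not> opb \<delta> (sgram (2 ^ n / m) m (\<lambda>i. fmat_of (S i)) \<rho> - \<rho>)}"
  have fin: "finite ?\<Omega>" by (rule finite_samples[OF finite_paulis])
  have pos: "0 \<le> ?E S" for S by (rule onorm_pos_le[OF bounded_linear_mult_right])
  have "card ?B * \<delta> = (\<Sum>S\<in>?B. \<delta>)" by simp
  also have "\<dots> \<le> (\<Sum>S\<in>?B. ?E S)"
  proof (rule sum_mono)
    fix S assume "S \<in> ?B"
    then have no: "\<not> opb \<delta> (sgram (2 ^ n / m) m (\<lambda>i. fmat_of (S i)) \<rho> - \<rho>)" by simp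
    show "\<delta> \<le> ?E S"
    proof (rule ccontr)
      assume "\<not> \<delta> \<le> ?E S"
      then have "opb \<delta> (sgram (2 ^ n / m) m (\<lambda>i. fmat_of (S i)) \<rho> - \<rho>)"
        by (intro opb_mono[OF opb_onorm]) simp
      with no show False by simp
    qed
  qed
  also have "\<dots> \<le> (\<Sum>S\<in>?\<Omega>. ?E S)" using fin pos by (intro sum_mono2) auto
  also have "\<dots> \<le> card ?\<Omega> * (40 * sqrt (real n * 2 ^ n / real m) * norm \<rho>)"
    by (rule pauli_initialization_mean[OF n m \<rho>])
  also have "\<dots> \<le> card ?\<Omega> * (\<epsilon> * \<delta>)" by (rule mult_left_mono[OF small]) simp
  finally have "card ?B * \<delta> \<le> (\<epsilon> * card ?\<Omega>) * \<delta>" by (simp add: mult_ac)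
  then show ?thesis using \<delta> by simp
qed

section \<open>Arithmetic of the constants\<close>

lemma half_power_le:
  assumes x: "0 < x" and k: "ln x / ln 2 \<le> real k" shows "(1 / 2) ^ k * x \<le> (1::real)"
proof -
  have "ln x \<le> ln (2 ^ k)" using k by (simp add: pos_divide_le_eq ln_realpow)
  then have "x \<le> 2 ^ k" using x by simp
  then show ?thesis by (simp add: power_one_over field_simps)
qed

text \<open>Since ln 2 >= 1/2, n^6 is at most 64 times the sixth power of ln d; this is the factor
  64. The two summands of the constant serve the isometry and the initialization.\<close>

lemma sample_size_conditions:
  fixes \<kappa> \<epsilon> :: real and n r m :: nat
  assumes n: "1 \<le> n" and r: "1 \<le> r" and \<kappa>: "1 \<le> \<kappa>" and \<epsilon>: "0 < \<epsilon>" "\<epsilon> < 1"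
    and m: "64 * (52000000 * (1000000000000 + ln (36 / (\<epsilon> / 2))) + (10240 / \<epsilon>)\<^sup>2) * \<kappa>\<^sup>2 * (real r)\<^sup>2 * 2 ^ n * (ln (2 ^ n)) ^ 6 \<le> real m"
  shows "52000000 * real r * 2 ^ n * real n ^ 4 * (1000000000000 + ln (36 / (\<epsilon> / 2))) \<le> real m"
    "(10240 / \<epsilon>)\<^sup>2 * (\<kappa>\<^sup>2 * (real r)\<^sup>2 * (real n * 2 ^ n)) \<le> real m"
proof -
  define T where "T = 52000000 * (1000000000000 + ln (36 / (\<epsilon> / 2)))"
  define Z where "Z = (10240 / \<epsilon>)\<^sup>2"
  have m2: "64 * (T + Z) * \<kappa>\<^sup>2 * (real r)\<^sup>2 * 2 ^ n * (ln (2 ^ n)) ^ 6 \<le> real m" using m unfolding T_def Z_def .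
  have T: "0 \<le> T" using \<epsilon> by (auto simp: T_def field_simps intro!: add_nonneg_nonneg ln_ge_zero)
  have Z: "0 \<le> Z" by (simp add: Z_def)
  have n1: "1 \<le> real n" using n by simp
  have "1 / 2 \<le> ln (2::real)" using ln2_ge_two_thirds by simp
  then have "real n / 2 \<le> ln (2 ^ n)" using n1 by (simp add: ln_realpow)
  then have "(real n / 2) ^ 6 \<le> (ln (2 ^ n)) ^ 6" by (intro power_mono) auto
  then have l: "real n ^ 6 \<le> 64 * (ln (2 ^ n)) ^ 6" by (simp add: power_divide)
  have "(T + Z) * (\<kappa>\<^sup>2 * (real r)\<^sup>2 * 2 ^ n * real n ^ 6) \<le> (T + Z) * (\<kappa>\<^sup>2 * (real r)\<^sup>2 * 2 ^ n * (64 * (ln (2 ^ n)) ^ 6))"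
    using l T Z by (intro mult_left_mono) auto
  also have "\<dots> = 64 * (T + Z) * \<kappa>\<^sup>2 * (real r)\<^sup>2 * 2 ^ n * (ln (2 ^ n)) ^ 6" by (simp only: mult_ac)
  also note m2
  finally have m': "(T + Z) * (\<kappa>\<^sup>2 * (real r)\<^sup>2 * 2 ^ n * real n ^ 6) \<le> real m" .
  have k2: "1 \<le> \<kappa>\<^sup>2" using \<kappa> by simp
  have r2: "real r \<le> (real r)\<^sup>2" using r by (simp add: power2_eq_square)
  have n4: "real n ^ 4 \<le> real n ^ 6" "real n \<le> real n ^ 6" using n1 power_increasing[of 4 6 "real n"] self_le_power[of "real n" 6] by auto
  have a: "1 * real r * 2 ^ n * real n ^ 4 \<le> \<kappa>\<^sup>2 * (real r)\<^sup>2 * 2 ^ n * real n ^ 6"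
    by (intro mult_mono k2 r2 n4) auto
  have b: "\<kappa>\<^sup>2 * (real r)\<^sup>2 * 2 ^ n * real n \<le> \<kappa>\<^sup>2 * (real r)\<^sup>2 * 2 ^ n * real n ^ 6"
    by (intro mult_left_mono n4) auto
  have "T * (1 * real r * 2 ^ n * real n ^ 4) \<le> (T + Z) * (\<kappa>\<^sup>2 * (real r)\<^sup>2 * 2 ^ n * real n ^ 6)"
    using T Z by (intro mult_mono a) auto
  also note m'
  finally show "52000000 * real r * 2 ^ n * real n ^ 4 * (1000000000000 + ln (36 / (\<epsilon> / 2))) \<le> real m"
    by (simp only: T_def mult_ac mult_1)
  have "Z * (\<kappa>\<^sup>2 * (real r)\<^sup>2 * 2 ^ n * real n) \<le> (T + Z) * (\<kappa>\<^sup>2 * (real r)\<^sup>2 * 2 ^ n * real n ^ 6)"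
    using T Z by (intro mult_mono b) auto
  also note m'
  finally show "(10240 / \<epsilon>)\<^sup>2 * (\<kappa>\<^sup>2 * (real r)\<^sup>2 * (real n * 2 ^ n)) \<le> real m"
    by (simp only: Z_def mult_ac)
qed

text \<open>The initial bound without noise is N / (32 sqrt r \<kappa>), which is where C0 = 1/32
  comes from. With noise, the iteration count brings the transient part down to 2 sqrt r times
  \<open>lam\<close>; added to the limit 10 it gives 12.\<close>

lemma error_bounds:
  fixes e :: "nat \<Rightarrow> real"
  assumes r: "1 \<le> (r::nat)" and \<kappa>: "1 \<le> \<kappa>" and N: "0 < N"
    and e: "\<And>k. e k \<le> (1 / 2) ^ k * (4 * sqrt r * (N / (128 * real r * \<kappa>) + lam)) + 10 * (sqrt r * lam)"
  shows "0 < lam \<Longrightarrow> 1 / ln (1 / (1 / 2)) * (ln (2 * (1 / 32) * N / (real r * \<kappa> * lam) + 2 * sqrt 2) - ln (12 - 11)) \<le> real k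
      \<Longrightarrow> e k / N \<le> 12 * (sqrt (real r) * lam / N)"
    "lam = 0 \<Longrightarrow> 0 < \<epsilon> \<Longrightarrow> ln (1 / 32 / (sqrt (real r) * \<kappa> * \<epsilon>)) / ln (1 / (1 / 2)) \<le> real k \<Longrightarrow> e k / N \<le> \<epsilon>"
proof -
  have r0: "0 < sqrt r" "sqrt r * sqrt r = r" using r by auto
  assume lam: "0 < lam" and k: "1 / ln (1 / (1 / 2)) * (ln (2 * (1 / 32) * N / (real r * \<kappa> * lam) + 2 * sqrt 2) - ln (12 - 11)) \<le> real k"
  define x where "x = N / (16 * real r * \<kappa> * lam) + 2 * sqrt 2"
  have "0 < N / (16 * real r * \<kappa> * lam)" using N lam r \<kappa> by auto
  then have x: "0 < x" by (simp add: x_def add_pos_pos)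
  have "2 * (1 / 32) * N / (real r * \<kappa> * lam) + 2 * sqrt 2 = x" by (simp add: x_def)
  then have "ln x / ln 2 \<le> real k" using k by simp
  then have hp: "(1 / 2) ^ k * x \<le> 1" by (rule half_power_le[OF x])
  have "4 * (N / (128 * real r * \<kappa>) + lam) = lam * (N / (32 * real r * \<kappa> * lam) + 4)"
    using lam r \<kappa> by (simp add: field_simps)
  also have "\<dots> \<le> lam * (2 * x)"
  proof (intro mult_left_mono)
    have *: "q / 32 + 4 \<le> 2 * (q / 16 + 2 * s)" if "0 \<le> q" "1 \<le> s" for q s :: real
    proof -
      have "q / 32 + 4 \<le> q / 8 + 4 * s" using that by (intro add_mono) auto
      also have "\<dots> = 2 * (q / 16 + 2 * s)" by simp
      finally show ?thesis .
    qed
    have "0 \<le> N / (r * \<kappa> * lam)" using N lam r \<kappa> by auto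
    moreover have e: "N / (32 * real r * \<kappa> * lam) = N / (r * \<kappa> * lam) / 32" "N / (16 * real r * \<kappa> * lam) = N / (r * \<kappa> * lam) / 16"
      by (simp_all add: mult_ac)
    ultimately show "N / (32 * real r * \<kappa> * lam) + 4 \<le> 2 * x" unfolding x_def e by (intro *) simp_all
  qed (use lam in simp)
  finally have "sqrt r * (4 * (N / (128 * real r * \<kappa>) + lam)) \<le> sqrt r * (lam * (2 * x))" using r0 by (intro mult_left_mono) auto
  then have "(1 / 2) ^ k * (4 * sqrt r * (N / (128 * real r * \<kappa>) + lam)) \<le> (1 / 2) ^ k * (sqrt r * (lam * (2 * x)))"
    by (intro mult_left_mono) (auto simp: mult_ac)
  also have "\<dots> = (sqrt r * lam * 2) * ((1 / 2) ^ k * x)" by simp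
  also have "\<dots> \<le> (sqrt r * lam * 2) * 1" using lam r0 by (intro mult_left_mono hp) auto
  finally have "e k \<le> 12 * (sqrt r * lam)" using e[of k] by linarith
  then show "e k / N \<le> 12 * (sqrt (real r) * lam / N)" using N by (simp add: divide_right_mono)
next
  have r0: "0 < sqrt r" "sqrt r * sqrt r = r" using r by auto
  assume lam: "lam = 0" and \<epsilon>: "0 < \<epsilon>" and k: "ln (1 / 32 / (sqrt (real r) * \<kappa> * \<epsilon>)) / ln (1 / (1 / 2)) \<le> real k"
  have hp: "(1 / 2) ^ k * (1 / 32 / (sqrt (real r) * \<kappa> * \<epsilon>)) \<le> 1"
    by (rule half_power_le) (use k r0 \<kappa> \<epsilon> in auto)
  have "4 * sqrt r * (N / (128 * real r * \<kappa>)) = (N * \<epsilon>) * (1 / 32 / (sqrt (real r) * \<kappa> * \<epsilon>))"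
  proof -
    have "4 * sqrt r * (N / (128 * real r * \<kappa>)) = 4 * sqrt r * (N / (128 * (sqrt r * sqrt r) * \<kappa>))" by (simp only: r0(2))
    also have "\<dots> = (N * \<epsilon>) * (1 / 32 / (sqrt (real r) * \<kappa> * \<epsilon>))" using r0(1) \<epsilon> \<kappa> by (simp add: field_simps del: real_sqrt_mult_self)
    finally show ?thesis .
  qed
  then have "e k \<le> (1 / 2) ^ k * ((N * \<epsilon>) * (1 / 32 / (sqrt (real r) * \<kappa> * \<epsilon>)))"
    using e[of k] lam by simp
  also have "\<dots> = (N * \<epsilon>) * ((1 / 2) ^ k * (1 / 32 / (sqrt (real r) * \<kappa> * \<epsilon>)))" by simp
  also have "\<dots> \<le> (N * \<epsilon>) * 1" using N \<epsilon> by (intro mult_left_mono hp) auto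
  finally show "e k / N \<le> \<epsilon>" using N by (simp add: field_simps)
qed

theorem corollary2:
  shows "\<exists>c1 \<gamma> C0 C1 C2 :: real.
    0 < c1 \<and> 0 < \<gamma> \<and> \<gamma> < 1 \<and> 0 < C0 \<and> 0 < C1 \<and> 0 < C2 \<and> C1 < C2 \<and>
    (\<forall>\<epsilon>::real. 0 < \<epsilon> \<and> \<epsilon> < 1 \<longrightarrow> (\<exists>c2::real. 0 < c2 \<and>
      (\<forall>(n::nat) (d::nat) (r::nat) (\<rho>::complex mat) (\<sigma>::nat \<Rightarrow> real) (\<kappa>::real) (lam::real) (m::nat).
        1 \<le> n \<longrightarrow> d = 2 ^ n \<longrightarrow> 1 \<le> r \<longrightarrow> r \<le> d \<longrightarrow>
        density_mat d \<rho> \<longrightarrow> vec_space.rank d \<rho> = r \<longrightarrow>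
        (\<forall>i\<in>{1..r}. \<sigma> i = singular_values \<rho> ! (i - 1)) \<longrightarrow> \<kappa> = \<sigma> 1 / \<sigma> r \<longrightarrow>
        0 \<le> lam \<longrightarrow> lam \<le> c1 * (\<sigma> r / sqrt (real r)) \<longrightarrow>
        real m \<ge> c2 * \<kappa>\<^sup>2 * (real r)\<^sup>2 * real d * (ln (real d)) ^ 6 \<longrightarrow>
        measure_pmf.prob (pauli_sample n m)
          {S. \<forall>z y X\<^sub>0 X.
            z \<in> carrier_vec m \<longrightarrow> spectral_norm (sampling_adj d m S z) \<le> lam \<longrightarrow>
            y = sampling_map d m S \<rho> + z \<longrightarrow>
            hard_threshold r (sampling_adj d m S y) X\<^sub>0 \<longrightarrow>
            rgd_iterates d m S y r X\<^sub>0 X \<longrightarrow>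
            (0 < lam \<longrightarrow> (\<forall>k::nat.
               real k \<ge> 1 / ln (1 / \<gamma>) *
                 (ln (2 * C0 * frob_norm \<rho> / (real r * \<kappa> * lam) + 2 * sqrt 2) - ln (C2 - C1)) \<longrightarrow>
               frob_norm (X k - \<rho>) / frob_norm \<rho> \<le> C2 * (sqrt (real r) * lam / frob_norm \<rho>))) \<and>
            (lam = 0 \<and> z = 0\<^sub>v m \<longrightarrow> (\<forall>\<epsilon>'::real. 0 < \<epsilon>' \<longrightarrow> (\<forall>k::nat.
               real k \<ge> ln (C0 / (sqrt (real r) * \<kappa> * \<epsilon>')) / ln (1 / \<gamma>) \<longrightarrow>
               frob_norm (X k - \<rho>) / frob_norm \<rho> \<le> \<epsilon>')))}
        \<ge> 1 - \<epsilon>)))"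
proof (rule exI[of _ "1 / 160"], rule exI[of _ "1 / 2"], rule exI[of _ "1 / 32"], rule exI[of _ 11], rule exI[of _ 12],
    intro conjI allI impI)
  \<comment> \<open>The choice C1 = 11, C2 = 12 makes the term ln (C2 - C1) vanish, and 1/160 is the
    noise level that keeps the ball of radius \<sigma>_r / 16 invariant.\<close>
  fix \<epsilon> :: real assume \<epsilon>': "0 < \<epsilon> \<and> \<epsilon> < 1"
  then have \<epsilon>: "0 < \<epsilon>" "\<epsilon> < 1" by auto
  define c2 where "c2 = 64 * (52000000 * (1000000000000 + ln (36 / (\<epsilon> / 2))) + (10240 / \<epsilon>)\<^sup>2)"
  have "0 \<le> ln (36 / (\<epsilon> / 2))" using \<epsilon> by (intro ln_ge_zero) (simp add: field_simps)
  then have c2: "0 < c2" unfolding c2_def by (intro mult_pos_pos add_pos_nonneg) auto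
  show "\<exists>c2::real. 0 < c2 \<and>
      (\<forall>(n::nat) (d::nat) (r::nat) (\<rho>::complex mat) (\<sigma>::nat \<Rightarrow> real) (\<kappa>::real) (lam::real) (m::nat).
        1 \<le> n \<longrightarrow> d = 2 ^ n \<longrightarrow> 1 \<le> r \<longrightarrow> r \<le> d \<longrightarrow>
        density_mat d \<rho> \<longrightarrow> vec_space.rank d \<rho> = r \<longrightarrow>
        (\<forall>i\<in>{1..r}. \<sigma> i = singular_values \<rho> ! (i - 1)) \<longrightarrow> \<kappa> = \<sigma> 1 / \<sigma> r \<longrightarrow>
        0 \<le> lam \<longrightarrow> lam \<le> 1 / 160 * (\<sigma> r / sqrt (real r)) \<longrightarrow>
        real m \<ge> c2 * \<kappa>\<^sup>2 * (real r)\<^sup>2 * real d * (ln (real d)) ^ 6 \<longrightarrow>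
        measure_pmf.prob (pauli_sample n m)
          {S. \<forall>z y X\<^sub>0 X.
            z \<in> carrier_vec m \<longrightarrow> spectral_norm (sampling_adj d m S z) \<le> lam \<longrightarrow>
            y = sampling_map d m S \<rho> + z \<longrightarrow>
            hard_threshold r (sampling_adj d m S y) X\<^sub>0 \<longrightarrow>
            rgd_iterates d m S y r X\<^sub>0 X \<longrightarrow>
            (0 < lam \<longrightarrow> (\<forall>k::nat.
               real k \<ge> 1 / ln (1 / (1 / 2)) *
                 (ln (2 * (1 / 32) * frob_norm \<rho> / (real r * \<kappa> * lam) + 2 * sqrt 2) - ln (12 - 11)) \<longrightarrow>
               frob_norm (X k - \<rho>) / frob_norm \<rho> \<le> 12 * (sqrt (real r) * lam / frob_norm \<rho>))) \<and>
            (lam = 0 \<and> z = 0\<^sub>v m \<longrightarrow> (\<forall>\<epsilon>'::real. 0 < \<epsilon>' \<longrightarrow> (\<forall>k::nat.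
               real k \<ge> ln (1 / 32 / (sqrt (real r) * \<kappa> * \<epsilon>')) / ln (1 / (1 / 2)) \<longrightarrow>
               frob_norm (X k - \<rho>) / frob_norm \<rho> \<le> \<epsilon>')))}
        \<ge> 1 - \<epsilon>)" (is "\<exists>c2. 0 < c2 \<and> (\<forall>n d r \<rho> \<sigma> \<kappa> lam m. ?P c2 n d r \<rho> \<sigma> \<kappa> lam m)")
  proof (intro exI[of _ c2] conjI allI impI c2)
    fix n d r :: nat and \<rho> :: "complex mat" and \<sigma> :: "nat \<Rightarrow> real" and \<kappa> lam :: real and m :: nat
    assume n: "1 \<le> n" and d2n: "d = 2 ^ n" and r: "1 \<le> r" "r \<le> d" and \<rho>: "density_mat d \<rho>" "vec_space.rank d \<rho> = r"
      and \<sigma>: "\<forall>i\<in>{1..r}. \<sigma> i = singular_values \<rho> ! (i - 1)" and \<kappa>: "\<kappa> = \<sigma> 1 / \<sigma> r"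
      and lam: "0 \<le> lam" "lam \<le> 1 / 160 * (\<sigma> r / sqrt (real r))"
      and m: "real m \<ge> c2 * \<kappa>\<^sup>2 * (real r)\<^sup>2 * real d * (ln (real d)) ^ 6"
    note dg = density_ground_truth[OF \<rho>(1) r(1) \<rho>(2) \<sigma>]
    obtain K Q R where gt: "ground_truth d r (\<sigma> r) (fmat_of \<rho>) K Q R" using dg(4) by blast
    have \<rho>c: "\<rho> \<in> carrier_mat d d" and \<rho>h: "hermitian_mat d \<rho>" using \<rho>(1) by (auto simp: density_mat_def hermitian_mat_def)
    have \<rho>f: "supp (2 ^ n) (fmat_of \<rho>)" "adj (fmat_of \<rho>) = fmat_of \<rho>" using hermitian_mat_emb[OF \<rho>h] d2n by auto
    let ?N = "norm (fmat_of \<rho>)"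
    have N: "0 < ?N"
    proof (rule ccontr)
      assume "\<not> 0 < ?N"
      then have "\<rho> = 0\<^sub>m d d" using \<rho>c by (intro emb_inject[of _ d d]) (auto intro!: fmat_eqI simp: ent_emb)
      then have "mat_trace \<rho> = 0" by (simp add: mat_trace_def)
      then show False using \<rho>(1) by (simp add: density_mat_def)
    qed
    have \<kappa>1: "1 \<le> \<kappa>" using dg(1,2) by (simp add: \<kappa>)
    have rd: "real d = 2 ^ n" using d2n by simp
    note sz = sample_size_conditions[OF n r(1) \<kappa>1 \<epsilon> m[unfolded rd c2_def]]
    have r1: "1 \<le> real r" using r by simp
    have "0 < (10240 / \<epsilon>)\<^sup>2 * (\<kappa>\<^sup>2 * (real r)\<^sup>2 * (real n * 2 ^ n))" using \<epsilon> \<kappa>1 r n by simp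
    then have m1: "1 \<le> m" using sz(2) by (cases m) auto
    have m0: "0 < real m" using m1 by simp
    \<comment> \<open>As the norm of \<rho> is at most sqrt r times the largest singular value, this
      gives 4 sqrt r \<delta> <= \<sigma>_r / 32, half of the radius needed at the start. The 10240
      of the sample size is 40 * 2 * 128.\<close>
    define \<delta> where "\<delta> = ?N / (128 * real r * \<kappa>)"
    have \<delta>: "0 < \<delta>" using N r \<kappa>1 by (simp add: \<delta>_def)
    have small: "40 * sqrt (real n * 2 ^ n / real m) * ?N \<le> \<epsilon> / 2 * \<delta>"
    proof -
      have "real n * 2 ^ n / real m \<le> (\<epsilon> / (10240 * real r * \<kappa>))\<^sup>2"
        using sz(2) m0 \<epsilon> r1 \<kappa>1 by (simp add: power_divide power_mult_distrib field_simps)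
      then have "sqrt (real n * 2 ^ n / real m) \<le> \<epsilon> / (10240 * real r * \<kappa>)"
        using \<epsilon> r1 \<kappa>1 by (intro real_le_lsqrt) auto
      then have "40 * sqrt (real n * 2 ^ n / real m) * ?N \<le> 40 * (\<epsilon> / (10240 * real r * \<kappa>)) * ?N"
        by (intro mult_left_mono mult_right_mono) auto
      also have "\<dots> = \<epsilon> / 2 * \<delta>" by (simp add: \<delta>_def)
      finally show ?thesis .
    qed
    let ?\<Omega> = "samples m (paulis n)"
    let ?B1 = "{S \<in> ?\<Omega>. \<not> rip (2 ^ n) r (1 / 20) (2 ^ n / m) m (\<lambda>i. fmat_of (S i))}"
    let ?B2 = "{S \<in> ?\<Omega>. \<not> opb \<delta> (sgram (2 ^ n / m) m (\<lambda>i. fmat_of (S i)) (fmat_of \<rho>) - fmat_of \<rho>)}"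
    \<comment> \<open>Isometry and initialization each receive half of the failure
      probability.\<close>
    have b1: "card ?B1 \<le> \<epsilon> / 2 * card ?\<Omega>" using pauli_rip[OF n r(1) _ _ _ sz(1)] r(2) \<epsilon> d2n by simp
    have b2: "card ?B2 \<le> \<epsilon> / 2 * card ?\<Omega>" by (rule pauli_initialization[OF n m1 \<rho>f \<delta> small])
    have rt: "0 < sqrt r" "sqrt r * sqrt r = r" using r1 by auto
    have sl: "sqrt r * lam \<le> \<sigma> r / 160"
    proof -
      have "sqrt r * lam \<le> sqrt r * (1 / 160 * (\<sigma> r / sqrt r))" using rt by (intro mult_left_mono lam) auto
      then show ?thesis using rt by simp
    qed
    have sd: "4 * sqrt r * \<delta> \<le> \<sigma> r / 32"
    proof -
      have "4 * sqrt r * \<delta> \<le> 4 * sqrt r * (sqrt r * \<sigma> 1 / (128 * real r * \<kappa>))"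
        unfolding \<delta>_def using dg(3) \<kappa>1 r1 by (intro mult_left_mono divide_right_mono) auto
      also have "\<dots> = \<sigma> 1 / (32 * \<kappa>)"
      proof -
        have cancel: "4 * s * (s * x / (128 * (s * s) * k)) = x / (32 * k)" if "0 < s" "0 < k" for s x k :: real
          using that by (simp add: field_simps)
        have "0 < \<kappa>" using \<kappa>1 by simp
        then show ?thesis by (rule cancel[OF rt(1), unfolded rt(2)])
      qed
      also have "\<dots> = \<sigma> r / 32" using dg(1,2) by (simp add: \<kappa> field_simps)
      finally show ?thesis .
    qed
    have close: "4 * sqrt r * (\<delta> + lam) \<le> \<sigma> r / 16" "160 * (sqrt r * lam) \<le> \<sigma> r"
      using sl sd dg(1) by (auto simp: distrib_left)
    let ?Good = "{S. \<forall>z y X\<^sub>0 X.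
            z \<in> carrier_vec m \<longrightarrow> spectral_norm (sampling_adj d m S z) \<le> lam \<longrightarrow>
            y = sampling_map d m S \<rho> + z \<longrightarrow>
            hard_threshold r (sampling_adj d m S y) X\<^sub>0 \<longrightarrow>
            rgd_iterates d m S y r X\<^sub>0 X \<longrightarrow>
            (0 < lam \<longrightarrow> (\<forall>k::nat.
               real k \<ge> 1 / ln (1 / (1 / 2)) *
                 (ln (2 * (1 / 32) * frob_norm \<rho> / (real r * \<kappa> * lam) + 2 * sqrt 2) - ln (12 - 11)) \<longrightarrow>
               frob_norm (X k - \<rho>) / frob_norm \<rho> \<le> 12 * (sqrt (real r) * lam / frob_norm \<rho>))) \<and>
            (lam = 0 \<and> z = 0\<^sub>v m \<longrightarrow> (\<forall>\<epsilon>'::real. 0 < \<epsilon>' \<longrightarrow> (\<forall>k::nat.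
               real k \<ge> ln (1 / 32 / (sqrt (real r) * \<kappa> * \<epsilon>')) / ln (1 / (1 / 2)) \<longrightarrow>
               frob_norm (X k - \<rho>) / frob_norm \<rho> \<le> \<epsilon>')))}"
    have good: "S \<in> ?Good" if St: "S \<in> ?\<Omega>" "S \<notin> ?B1" "S \<notin> ?B2" for S
    proof (rule CollectI, rule allI, rule allI, rule allI, rule allI, rule impI, rule impI, rule impI, rule impI, rule impI)
      fix z y X\<^sub>0 X
      assume z: "z \<in> carrier_vec m" "spectral_norm (sampling_adj d m S z) \<le> lam"
        and y: "y = sampling_map d m S \<rho> + z" and X0: "hard_threshold r (sampling_adj d m S y) X\<^sub>0"
        and it: "rgd_iterates d m S y r X\<^sub>0 X"
      interpret pauli_samples d m S
        by standard (use samples_mem[OF St(1)] pauli_hermitian_mat d2n in auto)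
      have "rip d r (1 / 20) sc m Sf" "opb \<delta> (sgram sc m Sf (fmat_of \<rho>) - fmat_of \<rho>)" using St d2n by auto
      note conv = rgd_convergence[OF this(1) gt \<rho>c z(1) spectral_norm_opb[OF hermitian_sampling_adj _ z(2)] this(2) close
          X0[unfolded y] it[unfolded y]]
      have d0: "0 < d" using d2n by simp
      have e: "norm (fmat_of (X k) - fmat_of \<rho>) \<le> (1 / 2) ^ k * (4 * sqrt r * (?N / (128 * real r * \<kappa>) + lam)) + 10 * (sqrt r * lam)" for k
        using conv(2)[OF d0, of k] by (simp add: \<delta>_def)
      have fe: "frob_norm (X k - \<rho>) = norm (fmat_of (X k) - fmat_of \<rho>)" for k
        by (simp add: frob_norm_emb emb_diff[OF conv(1)[OF d0] \<rho>c])
      note eb = error_bounds[OF r(1) \<kappa>1 N e]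
      show "(0 < lam \<longrightarrow> (\<forall>k::nat.
               real k \<ge> 1 / ln (1 / (1 / 2)) *
                 (ln (2 * (1 / 32) * frob_norm \<rho> / (real r * \<kappa> * lam) + 2 * sqrt 2) - ln (12 - 11)) \<longrightarrow>
               frob_norm (X k - \<rho>) / frob_norm \<rho> \<le> 12 * (sqrt (real r) * lam / frob_norm \<rho>))) \<and>
            (lam = 0 \<and> z = 0\<^sub>v m \<longrightarrow> (\<forall>\<epsilon>'::real. 0 < \<epsilon>' \<longrightarrow> (\<forall>k::nat.
               real k \<ge> ln (1 / 32 / (sqrt (real r) * \<kappa> * \<epsilon>')) / ln (1 / (1 / 2)) \<longrightarrow>
               frob_norm (X k - \<rho>) / frob_norm \<rho> \<le> \<epsilon>')))"
        unfolding fe frob_norm_emb[of \<rho>] by (intro conjI impI allI; (elim conjE)?; rule eb; assumption)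
    qed
    have fin: "finite ?\<Omega>" by (rule finite_samples[OF finite_paulis])
    have c0: "0 < real (card ?\<Omega>)"
      using card_gt_0_iff[of "paulis n"] finite_paulis paulis_nonempty by (simp add: card_samples)
    have cover: "A \<subseteq> (A \<inter> G) \<union> (B \<union> B')" if "\<And>S. S \<in> A \<Longrightarrow> S \<notin> B \<Longrightarrow> S \<notin> B' \<Longrightarrow> S \<in> G"
      for A B B' G :: "(nat \<Rightarrow> complex mat) set" using that by blast
    have "card ?\<Omega> \<le> card ((?\<Omega> \<inter> ?Good) \<union> (?B1 \<union> ?B2))"
      by (rule card_mono[OF _ cover[OF good]]) (simp_all add: fin)
    also have "\<dots> \<le> card (?\<Omega> \<inter> ?Good) + (card ?B1 + card ?B2)"
      by (meson add_left_mono card_Un_le order_trans)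
    finally have "real (card ?\<Omega>) \<le> real (card (?\<Omega> \<inter> ?Good)) + (real (card ?B1) + real (card ?B2))" by linarith
    then have "(1 - \<epsilon>) * card ?\<Omega> \<le> card (?\<Omega> \<inter> ?Good)" using b1 b2 by (simp add: algebra_simps)
    then show "1 - \<epsilon> \<le> measure_pmf.prob (pauli_sample n m) ?Good"
      unfolding pauli_sample_prob using c0 by (simp add: pos_le_divide_eq)
  qed
qed auto

end
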